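(* For any $\beta>0$, there exist a non-smooth profile function $\phi_\beta\in C^{\frac1{\beta+1}}([0,\infty))$ with $\phi_\beta>0$, $\phi_\beta(0)=1$ and $\phi_\beta$ decreasing on $[0,\infty)$, and a constant $\delta>0$ such that the following holds true. For any $\tilde\nu_0^*>0$ there exists $\lambda_0^*>0$, and for all $0<\lambda_0\leq\lambda_0^*$ a constant $\kappa>0$, such that if $$a_0(Z)=\frac1{\lambda_0}\phi_\beta\Big(\frac Z{\nu_0}\Big)+\tilde a_0(Z),\qquad 0\leq Z\leq1,$$ with $$0<\lambda_0\leq\lambda_0^*,\qquad 0<\tilde\nu_0=\frac{\nu_0}{\lambda_0^\beta}\leq\tilde\nu_0^*,\qquad \|\tilde a_0\|_{C^1([0,1])}\leq\kappa,$$ then there exist $T>0$, $\tilde\nu_\infty>0$, $C>0$ such that the solution $a$ of the system $$a_t-a^2+\Big(\int_0^Z a(t,\tilde Z)\,d\tilde Z\Big)a_Z+2\int_0^1a^2\,dZ=0,\qquad\int_0^1a(t,Z)\,dZ=0,\qquad Z\in[0,1],$$ with $a(t=0)=a_0$ blows up at time $T$ with $$a(t,Z)=\frac1{T-t}\phi_\beta\Big(\frac Z{\nu(t)}\Big)+\tilde a(t,Z),\qquad \nu(t)=\tilde\nu_\infty(T-t)^\beta,$$ where for all $t\in[0,T)$: $$\|\tilde a(t)\|_{L^\infty([0,1])}\leq C(T-t)^{-1+\delta}.$$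
   Context: The unknown is a real-valued function $a=a(t,Z)$ of time $t\ge 0$ and $Z\in[0,1]$; subscripts $t$, $Z$ denote partial derivatives. $C^{\frac{1}{\beta+1}}$ denotes the Hölder space with exponent $\frac1{\beta+1}$. *)

theory Defs
  imports "HOL-Analysis.Analysis" "HOL-Probability.Essential_Supremum"
begin

text \<open>Functions on an interval are represented by total functions on \<open>real\<close>; every notion below
  only looks at their values on the interval, so derivatives at end points are one-sided.\<close>

definition holder_space :: "real \<Rightarrow> real set \<Rightarrow> (real \<Rightarrow> real) \<Rightarrow> bool" where
  "holder_space \<gamma> S f \<longleftrightarrow>
     bounded (f ` S) \<and> (\<exists>C. \<forall>x\<in>S. \<forall>y\<in>S. \<bar>f x - f y\<bar> \<le> C * \<bar>x - y\<bar> powr \<gamma>)"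

text \<open>\<open>D k\<close> is the \<open>k\<close>-th derivative of \<open>f\<close> relative to \<open>S\<close>.\<close>

definition smooth_within :: "real set \<Rightarrow> (real \<Rightarrow> real) \<Rightarrow> bool" where
  "smooth_within S f \<longleftrightarrow>
     (\<exists>D :: nat \<Rightarrow> real \<Rightarrow> real. (\<forall>x\<in>S. D 0 x = f x) \<and>
        (\<forall>k. \<forall>x\<in>S. (D k has_real_derivative D (Suc k) x) (at x within S)))"

definition C1_space :: "(real \<Rightarrow> real) \<Rightarrow> bool" where
  "C1_space f \<longleftrightarrow> f differentiable_on {0..1} \<and>
     continuous_on {0..1} (\<lambda>z. vector_derivative f (at z within {0..1}))"

text \<open>Meaningful only together with \<^const>\<open>C1_space\<close>, which makes both suprema finite.\<close>

definition C1_norm :: "(real \<Rightarrow> real) \<Rightarrow> real" where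
  "C1_norm f = (SUP z\<in>{0..1}. \<bar>f z\<bar>) +
     (SUP z\<in>{0..1}. \<bar>vector_derivative f (at z within {0..1})\<bar>)"

definition Linf_norm :: "(real \<Rightarrow> real) \<Rightarrow> ereal" where
  "Linf_norm f = esssup (lebesgue_on {0..1}) (\<lambda>z. ereal \<bar>f z\<bar>)"

text \<open>Classical solutions on \<open>[0,T)\<close>, with initial datum \<open>a0\<close>, of
  \<open>a_t - a\<^sup>2 + (\<integral>\<^sub>0\<^sup>Z a) a_Z + 2 \<integral>\<^sub>0\<^sup>1 a\<^sup>2 = 0\<close> and \<open>\<integral>\<^sub>0\<^sup>1 a = 0\<close>.
  The data of interest are only Hoelder continuous at \<open>Z = 0\<close>, where \<open>a_Z\<close> does not exist. Hence
  \<open>a\<close> is required to be continuous on \<open>[0,T) \<times> [0,1]\<close> but continuously differentiable only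
  for \<open>Z > 0\<close>. The equation at \<open>Z = 0\<close> is kept: there the factor \<open>\<integral>\<^sub>0\<^sup>Z a\<close> is zero,
  so the transport term vanishes whatever the (irrelevant) value \<open>a_Z t 0\<close>.\<close>

definition solution_on :: "real \<Rightarrow> (real \<Rightarrow> real) \<Rightarrow> (real \<Rightarrow> real \<Rightarrow> real) \<Rightarrow> bool" where
  "solution_on T a0 a \<longleftrightarrow>
     continuous_on ({0..<T} \<times> {0..1}) (\<lambda>(t, Z). a t Z) \<and>
     (\<exists>a_t a_Z :: real \<Rightarrow> real \<Rightarrow> real.
        continuous_on ({0..<T} \<times> {0<..1}) (\<lambda>(t, Z). a_t t Z) \<and>
        continuous_on ({0..<T} \<times> {0<..1}) (\<lambda>(t, Z). a_Z t Z) \<and>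
        (\<forall>t\<in>{0..<T}. \<forall>Z\<in>{0..1}.
           ((\<lambda>s. a s Z) has_real_derivative a_t t Z) (at t within {0..<T})) \<and>
        (\<forall>t\<in>{0..<T}. \<forall>Z\<in>{0<..1}.
           (a t has_real_derivative a_Z t Z) (at Z within {0..1})) \<and>
        (\<forall>t\<in>{0..<T}. \<forall>Z\<in>{0..1}.
           a_t t Z - (a t Z)\<^sup>2 + integral {0..Z} (a t) * a_Z t Z
             + 2 * integral {0..1} (\<lambda>z. (a t z)\<^sup>2) = 0)) \<and>
     (\<forall>t\<in>{0..<T}. integral {0..1} (a t) = 0) \<and>
     (\<forall>Z\<in>{0..1}. a 0 Z = a0 Z)"

text \<open>The solution with datum \<open>a0\<close>: it contains every other solution with that datum.\<close>

definition maximal_solution :: "real \<Rightarrow> (real \<Rightarrow> real) \<Rightarrow> (real \<Rightarrow> real \<Rightarrow> real) \<Rightarrow> bool" where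
  "maximal_solution T a0 a \<longleftrightarrow> solution_on T a0 a \<and>
     (\<forall>T' b. 0 < T' \<and> solution_on T' a0 b \<longrightarrow>
        T' \<le> T \<and> (\<forall>t\<in>{0..<T'}. \<forall>Z\<in>{0..1}. b t Z = a t Z))"

definition blows_up_at :: "real \<Rightarrow> (real \<Rightarrow> real) \<Rightarrow> (real \<Rightarrow> real \<Rightarrow> real) \<Rightarrow> bool" where
  "blows_up_at T a0 a \<longleftrightarrow>
     maximal_solution T a0 a \<and> ((\<lambda>t. Linf_norm (a t)) \<longlongrightarrow> \<infinity>) (at_left T)"

end

theory Submission
  imports Defs "HOL-Real_Asymp.Real_Asymp"
begin

text \<open>
  The equation is a Riccati equation along particle paths and can be solved explicitly.  Let \<open>g\<close> be
  the datum and use an artificial time \<open>e\<close>, related to \<open>t\<close> by \<open>dt = (K e)\<^sup>2 de\<close>.  With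
  \<open>J e x = 1 - e g(x)\<close> and \<open>K e = \<integral>\<^sub>0\<^sup>1 1/J\<close>, the particle that starts at \<open>x\<close> sits at
  \<open>flow e x = (\<integral>\<^sub>0\<^sup>x 1/J) / K\<close> and carries the value \<open>A e x = (g/J - K'/K) / K\<^sup>2\<close>.  The
  normalisation by \<open>K\<close> keeps the total length equal to one, which is what the nonlocal terms of the
  equation are for.  So \<open>explicit_solution\<close> is a computation with integrals of powers of \<open>J\<close>.

  The solution breaks down when \<open>J\<close> first vanishes.  A datum that is a profile plus a small Lipschitz
  function has its strict maximum \<open>M\<close> at \<open>0\<close>, with a cusp \<open>M - g(x) \<sim> c x\<^sup>p\<close> where
  \<open>p = 1/(\<beta>+1)\<close>; a Lipschitz perturbation is of lower order than the cusp.  Put \<open>\<epsilon> = 1 - M e\<close>.  Then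
  \<open>J \<approx> \<epsilon> + (c/M) x\<^sup>p\<close>, and since \<open>p < 1\<close> the integral \<open>K\<close> converges to a finite limit
  \<open>Ks\<close> as \<open>\<epsilon> \<rightarrow> 0\<close>.  Therefore the blow-up time is finite, \<open>T - t \<approx> Ks\<^sup>2 \<epsilon> / M\<close>, and
  \<open>A \<approx> (M / Ks\<^sup>2) / J\<close>.  In the variable \<open>s\<close> with \<open>(c/M) x\<^sup>p = \<epsilon> s\<^sup>p\<close> the value is proportional
  to \<open>1 / (1 + s\<^sup>p)\<close> and the position to \<open>\<integral>\<^sub>0\<^sup>s dr / (1 + r\<^sup>p)\<close>.  Eliminating \<open>s\<close> defines
  the profile, and the position scales like \<open>\<epsilon> powr (1/p-1)\<close>, that is, like \<open>(T - t)\<^sup>\<beta>\<close>.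

  All corrections are smaller than the main term by a factor \<open>\<epsilon>\<^sup>\<delta>\<close>: the estimates interpolate between
  \<open>J \<ge> \<epsilon>\<close> and \<open>J \<ge> const x\<^sup>p\<close>, and any \<open>\<delta>\<close> with \<open>p (1 + \<delta>) < 1\<close> leaves an integrable power of
  \<open>x\<close>.  Errors in the position of a particle are harmless because a relative error in the argument of
  the profile only causes a relative error of its value (\<open>profile_ratio\<close>); this leads to
  \<open>solution_asymp\<close>.

  That the explicit solution is the maximal one is an \<open>L\<^sup>2\<close> energy argument (\<open>solution_unique\<close>).
  Its only delicate term contains the derivative of the explicit solution, which is bounded by a
  multiple of \<open>Z powr (p-1)\<close>; the difference of the velocities contributes \<open>Z powr (1/2)\<close>, and
  the square of the product is integrable.
\<close>

section \<open>Calculus preliminaries\<close>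

text \<open>Solutions have one-sided derivatives at the initial time and at \<open>Z = 1\<close>, so the rule for inverse
  functions is needed up to the end points.\<close>

lemma strict_mono_on_inverse_has_real_derivative:
  fixes f :: "real \<Rightarrow> real"
  assumes cont: "continuous_on {a..b} f" and mono: "strict_mono_on {a..b} f"
    and x: "x \<in> {a..b}" and d: "(f has_real_derivative d) (at x within {a..b})" "d \<noteq> 0"
    and g: "\<And>y. y \<in> {a..b} \<Longrightarrow> g (f y) = y"
  shows "(g has_real_derivative 1 / d) (at (f x) within {f a..f b})"
proof -
  have ab: "a \<le> b" using x by auto
  have im: "f ` {a..b} = {f a..f b}"
  proof
    show "f ` {a..b} \<subseteq> {f a..f b}"
      using strict_mono_on_leD[OF mono] ab by auto
    show "{f a..f b} \<subseteq> f ` {a..b}"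
      using IVT'[OF _ _ ab cont] by (force simp: image_iff)
  qed
  have "continuous_on (f ` {a..b}) g"
    by (rule continuous_on_inv[OF cont]) (use g in auto)
  then have cg: "continuous (at (f x) within f ` {a..b}) g"
    using x by (auto simp: continuous_on_eq_continuous_within)
  have "(g has_derivative ((*) (1/d))) (at (f x) within f ` {a..b})"
  proof (rule has_derivative_inverse_within[where f' = "(*) d"])
    show "(f has_derivative (*) d) (at x within {a..b})"
      using d(1) by (simp add: has_field_derivative_def)
    show "linear ((*) (1 / d))"
      by (simp add: linear_iff algebra_simps add_divide_distrib)
  qed (use cg x g d(2) in \<open>auto simp: fun_eq_iff\<close>)
  then show ?thesis
    by (simp add: has_field_derivative_def im)
qed

text \<open>Subadditivity holds because \<open>z \<le> z\<^sup>p\<close> for both shares \<open>z = x/(x+y)\<close> and \<open>z = y/(x+y)\<close>,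
  which add up to one.\<close>

lemma powr_add_le_add_powr:
  fixes x y p :: real
  assumes "0 \<le> x" "0 \<le> y" "0 < p" "p \<le> 1"
  shows "(x + y) powr p \<le> x powr p + y powr p"
proof (cases "x + y = 0")
  case False
  define s where "s = x + y"
  have s: "s > 0" using False assms by (simp add: s_def)
  have le: "z / s \<le> (z / s) powr p" if "0 \<le> z" "z \<le> s" for z
    using powr_mono'[of p 1 "z/s"] that s assms by auto
  have "1 = x / s + y / s"
    using s by (simp add: s_def add_divide_distrib[symmetric])
  also have "\<dots> \<le> (x/s) powr p + (y/s) powr p"
    using le[of x] le[of y] assms by (simp add: s_def)
  also have "\<dots> = (x powr p + y powr p) / s powr p"
    by (simp add: powr_divide add_divide_distrib)
  finally show ?thesis
    using s by (simp add: s_def field_simps)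
qed (use assms in auto)

section \<open>The blow-up profile\<close>

locale profile_exponent =
  fixes p :: real
  assumes p0: "0 < p" and p1: "p < 1"
begin

text \<open>The self-similar form of \<open>x \<mapsto> \<integral>\<^sub>0\<^sup>x 1/J\<close>: the rescaled position, close to the blow-up, of the
  particle with rescaled starting point \<open>s\<close>.\<close>

definition stretch :: "real \<Rightarrow> real" where
  "stretch s = integral {0..s} (\<lambda>r. 1 / (1 + r powr p))"

definition label :: "real \<Rightarrow> real" where
  "label z = (THE s. 0 \<le> s \<and> stretch s = z)"

text \<open>Given implicitly by \<open>profile (stretch s) = 1 / (1 + s\<^sup>p)\<close>: the rescaled value of \<open>1/J\<close> as a
  function of the rescaled position.\<close>

definition profile :: "real \<Rightarrow> real" where
  "profile z = 1 / (1 + label z powr p)"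

lemma one_plus_powr_pos [simp]: "0 < 1 + (x::real) powr q"
  by (smt (verit) powr_ge_zero)

lemma one_plus_powr_ne [simp]: "1 + (x::real) powr q \<noteq> 0"
  by (smt (verit) powr_ge_zero)

lemma powr_p_continuous [continuous_intros]:
  "continuous_on A f \<Longrightarrow> (\<And>x. x \<in> A \<Longrightarrow> 0 \<le> f x) \<Longrightarrow> continuous_on A (\<lambda>x. f x powr p)"
  for f :: "'b::topological_space \<Rightarrow> real"
  by (rule continuous_on_powr') (use p0 in \<open>auto intro: continuous_intros\<close>)

lemma integrand_continuous: "continuous_on {0..b} (\<lambda>r::real. 1 / (1 + r powr p))"
  by (intro continuous_intros) auto

lemma stretch_has_derivative:
  assumes "s \<in> {0..b}"
  shows "(stretch has_real_derivative 1 / (1 + s powr p)) (at s within {0..b})"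
  unfolding stretch_def[abs_def] using integral_has_real_derivative[OF integrand_continuous assms] .

lemma stretch_continuous: "continuous_on {0..b} stretch"
  by (rule DERIV_continuous_on[OF stretch_has_derivative])

lemma stretch_0 [simp]: "stretch 0 = 0" by (simp add: stretch_def)

lemma stretch_increment:
  assumes "0 \<le> s" "s \<le> s'"
  shows "(s' - s) / (1 + s' powr p) \<le> stretch s' - stretch s" "stretch s' - stretch s \<le> (s' - s) / (1 + s powr p)"
proof -
  have eq: "stretch s' - stretch s = integral {s..s'} (\<lambda>r. 1 / (1 + r powr p))"
    unfolding stretch_def
    using Henstock_Kurzweil_Integration.integral_combine[of 0 s s' "\<lambda>r. 1 / (1 + r powr p)"] assms
      integrable_continuous_real[OF integrand_continuous[of s']] by auto
  have int: "(\<lambda>r. 1 / (1 + r powr p)) integrable_on {s..s'}"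
    by (rule integrable_continuous_real)
      (use assms in \<open>auto intro!: continuous_on_subset[OF integrand_continuous[of s']]\<close>)
  have "integral {s..s'} (\<lambda>r. 1 / (1 + s' powr p)) \<le> stretch s' - stretch s"
    unfolding eq using assms int p0
    by (intro integral_le) (auto intro!: divide_left_mono powr_mono2 simp: one_plus_powr_pos)
  then show "(s' - s) / (1 + s' powr p) \<le> stretch s' - stretch s" using assms by simp
  have "stretch s' - stretch s \<le> integral {s..s'} (\<lambda>r. 1 / (1 + s powr p))"
    unfolding eq using assms int p0
    by (intro integral_le) (auto intro!: divide_left_mono powr_mono2 simp: one_plus_powr_pos)
  then show "stretch s' - stretch s \<le> (s' - s) / (1 + s powr p)" using assms by simp
qed

lemma stretch_strict_mono: "strict_mono_on {0..} stretch"
proof (rule strict_mono_onI)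
  fix r s :: real assume "r \<in> {0..}" "s \<in> {0..}" "r < s"
  then have "0 < (s - r) / (1 + s powr p)" by (simp add: one_plus_powr_pos)
  also have "\<dots> \<le> stretch s - stretch r" using stretch_increment(1)[of r s] \<open>r < s\<close> \<open>r \<in> _\<close> by simp
  finally show "stretch r < stretch s" by simp
qed

lemma stretch_lower: "0 \<le> s \<Longrightarrow> s / (1 + s powr p) \<le> stretch s"
  using stretch_increment(1)[of 0 s] by simp

lemma stretch_upper: "0 \<le> s \<Longrightarrow> stretch s \<le> s"
  using stretch_increment(2)[of 0 s] p0 by simp

lemma stretch_upper_powr: assumes "0 \<le> s" shows "stretch s \<le> s powr (1 - p) / (1 - p)"
proof -
  have *: "((\<lambda>r. r powr (-p)) has_integral (s powr (1 - p) / (1 - p))) {0..s}"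
    using has_integral_powr_from_0[of "-p" s] p0 p1 assms by simp
  have 1: "((\<lambda>r. 1 / (1 + r powr p)) has_integral stretch s) {0..s}"
    unfolding stretch_def using integrable_continuous_real[OF integrand_continuous[of s]] by blast
  show ?thesis
  proof (rule has_integral_le[OF has_integral_spike_finite[OF _ _ 1, where S="{0}"] *])
    fix x assume "x \<in> {0..s}"
    show "(if x = 0 then 0 else 1 / (1 + x powr p)) \<le> x powr - p"
      by (auto simp: powr_minus divide_simps one_plus_powr_pos)
  qed auto
qed

text \<open>Since \<open>p < 1\<close>, the lower bound \<open>s / (1 + s\<^sup>p)\<close> grows like \<open>s powr (1-p)\<close>; the witness makes
  this power as large as required.\<close>

lemma stretch_unbounded: "0 \<le> z \<Longrightarrow> \<exists>b\<ge>0. z \<le> stretch b"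
proof -
  assume "0 \<le> z"
  define b where "b = max 1 ((2 * z) powr (1 / (1 - p)))"
  have b: "1 \<le> b" by (simp add: b_def)
  have "2 * z = ((2 * z) powr (1 / (1 - p))) powr (1 - p)"
    using \<open>0 \<le> z\<close> p1 by (simp add: powr_powr)
  also have "\<dots> \<le> b powr (1 - p)"
    by (rule powr_mono2) (use p1 in \<open>auto simp: b_def\<close>)
  also have "\<dots> = b / b powr p" using b by (simp add: powr_diff)
  also have "\<dots> \<le> 2 * (b / (1 + b powr p))"
  proof -
    have "1 \<le> b powr p" using b p0 by (simp add: ge_one_powr_ge_zero)
    then show ?thesis using b by (simp add: divide_simps)
  qed
  also have "\<dots> \<le> 2 * stretch b" using stretch_lower[of b] b by simp
  finally show ?thesis using b by (intro exI[of _ b]) auto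
qed

lemma label_stretch [simp]: assumes "0 \<le> s" shows "label (stretch s) = s"
  unfolding label_def
  by (rule the_equality) (use assms strict_mono_on_eqD[OF stretch_strict_mono] in auto)

lemma stretch_surj: assumes "0 \<le> z" obtains s where "0 \<le> s" "stretch s = z"
proof -
  obtain b where "0 \<le> b" "z \<le> stretch b" using stretch_unbounded[OF assms] by auto
  then show ?thesis using IVT'[of stretch 0 z b] stretch_continuous assms that by auto
qed

lemma label_nonneg: "0 \<le> z \<Longrightarrow> 0 \<le> label z"
  and stretch_label: "0 \<le> z \<Longrightarrow> stretch (label z) = z"
  by (metis stretch_surj label_stretch)+

lemma label_strict_mono: "0 \<le> x \<Longrightarrow> x < y \<Longrightarrow> label x < label y"
  by (smt (verit) stretch_label label_nonneg atLeast_iff strict_mono_on_leD[OF stretch_strict_mono])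

lemma label_ge: "0 \<le> z \<Longrightarrow> z \<le> label z"
  using stretch_upper[OF label_nonneg] stretch_label by simp

lemma label_has_derivative:
  assumes "0 < z"
  shows "(label has_real_derivative 1 + label z powr p) (at z)"
proof -
  obtain b where b: "0 \<le> b" "z + 1 \<le> stretch b" using stretch_unbounded[of "z+1"] assms by auto
  have mono: "strict_mono_on {0..b} stretch"
    using stretch_strict_mono by (rule monotone_on_subset) auto
  have lb: "label z \<in> {0..b}"
    using label_nonneg[of z] label_strict_mono[of z "stretch b"] b assms by auto
  have "(label has_real_derivative 1 / (1 / (1 + label z powr p))) (at (stretch (label z)) within {stretch 0..stretch b})"
    by (rule strict_mono_on_inverse_has_real_derivative[OF stretch_continuous mono lb stretch_has_derivative[OF lb]]) auto
  moreover have "at z within {0..stretch b} = at z"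
    using assms b by (intro at_within_interior) auto
  ultimately show ?thesis using assms by (simp add: stretch_label)
qed

lemma profile_stretch: "0 \<le> s \<Longrightarrow> profile (stretch s) = 1 / (1 + s powr p)"
  by (simp add: profile_def)

lemma profile_pos: "0 < profile z"
  by (simp add: profile_def one_plus_powr_pos)

lemma profile_le_1: "profile z \<le> 1"
  by (simp add: profile_def one_plus_powr_pos divide_simps)

lemma label_0 [simp]: "label 0 = 0"
  using label_stretch[of 0] by simp

lemma profile_0: "profile 0 = 1"
  using p0 by (simp add: profile_def)

lemma profile_strict_antimono: "strict_antimono_on {0..} profile"
proof (rule monotone_onI)
  fix x y :: real assume "x \<in> {0..}" "y \<in> {0..}" "x < y"
  then have "label x powr p < label y powr p"
    using p0 label_strict_mono label_nonneg by (intro powr_less_mono2) auto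
  then show "profile x > profile y"
    by (simp add: profile_def one_plus_powr_pos divide_strict_left_mono)
qed

lemma one_minus_profile: "1 - profile z = label z powr p / (1 + label z powr p)"
  by (simp add: profile_def field_simps)

lemma one_minus_profile_le: assumes "0 \<le> z" shows "1 - profile z \<le> z powr p"
proof -
  define s where "s = label z"
  have s: "0 \<le> s" "stretch s = z" using label_nonneg stretch_label assms by (auto simp: s_def)
  have "1 - profile z = s powr p / (1 + s powr p) powr 1"
    by (simp add: one_minus_profile s_def)
  also have "\<dots> \<le> s powr p / (1 + s powr p) powr p"
    using p0 p1 by (intro divide_left_mono powr_mono mult_pos_pos) (auto simp: one_plus_powr_pos)
  also have "\<dots> = (s / (1 + s powr p)) powr p" by (simp add: powr_divide)
  also have "\<dots> \<le> z powr p"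
    using stretch_lower[OF s(1)] s p0 by (intro powr_mono2) (auto simp: one_plus_powr_pos)
  finally show ?thesis .
qed

lemma one_minus_profile_ge:
  assumes "0 \<le> z" shows "z powr p / (1 + z powr p) \<le> 1 - profile z"
proof -
  have "z powr p \<le> label z powr p" using label_ge[OF assms] assms p0 by (intro powr_mono2) auto
  then have "1 / (1 + label z powr p) \<le> 1 / (1 + z powr p)"
    by (intro divide_left_mono) (auto simp: one_plus_powr_pos)
  moreover have "z powr p / (1 + z powr p) = 1 - 1 / (1 + z powr p)"
    by (simp add: field_simps)
  ultimately show ?thesis by (simp add: profile_def)
qed

lemma profile_cusp:
  assumes "0 \<le> z" shows "\<bar>(1 - profile z) - z powr p\<bar> \<le> z powr (2 * p)"
proof -
  define w where "w = z powr p"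
  have w: "0 \<le> w" "z powr (2*p) = w^2"
    by (auto simp: w_def power2_eq_square powr_add[symmetric])
  have "w / (1 + w) \<ge> w - w^2"
    using w by (simp add: field_simps power2_eq_square)
  then show ?thesis
    using one_minus_profile_le[OF assms] one_minus_profile_ge[OF assms] w
    by (simp add: w_def[symmetric])
qed

text \<open>In terms of the starting points the profile is as regular as \<open>s\<^sup>p\<close>.  Passing to positions costs a
  factor \<open>(1 + s'\<^sup>p)\<^sup>p\<close>, and this is paid for by the denominator of the difference of the values.\<close>

lemma profile_holder: "holder_space p {0..} profile"
  unfolding holder_space_def
proof
  show "bounded (profile ` {0..})"
    by (rule boundedI[of _ 1]) (use profile_pos profile_le_1 in \<open>auto simp: abs_of_pos\<close>)
  have main: "profile x - profile y \<le> (y - x) powr p" "profile y \<le> profile x"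
    if "0 \<le> x" "x \<le> y" for x y
  proof -
    define s s' where "s = label x" and "s' = label y"
    have s: "0 \<le> s" "stretch s = x" "0 \<le> s'" "stretch s' = y"
      using label_nonneg stretch_label that by (auto simp: s_def s'_def)
    have ss: "s \<le> s'" using label_strict_mono[of x y] that by (cases "x = y") (auto simp: s_def s'_def)
    let ?A = "1 + s powr p" and ?B = "1 + s' powr p"
    have AB: "1 \<le> ?A" "1 \<le> ?B" by auto
    have mono: "s powr p \<le> s' powr p" using ss s p0 by (intro powr_mono2) auto
    have "profile x - profile y = 1 / ?A - 1 / ?B"
      by (simp add: profile_def s_def s'_def)
    also have "\<dots> = (s' powr p - s powr p) / ?B / ?A"
      by (simp add: field_simps)
    also have "\<dots> \<le> (s' powr p - s powr p) / ?B"
      using AB mono divide_left_mono[of 1 ?A "(s' powr p - s powr p) / ?B"] by simp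
    also have "\<dots> \<le> (s' - s) powr p / ?B"
      using powr_add_le_add_powr[of s "s' - s" p] s ss p0 p1 AB by (intro divide_right_mono) auto
    also have "\<dots> \<le> (s' - s) powr p / ?B powr p"
      using powr_mono[of p 1 ?B] p1 AB by (intro divide_left_mono) (auto simp: one_plus_powr_pos)
    also have "\<dots> = ((s' - s) / ?B) powr p" by (simp add: powr_divide)
    also have "\<dots> \<le> (y - x) powr p"
      using stretch_increment(1)[OF s(1) ss] s ss p0 AB by (intro powr_mono2) auto
    finally show "profile x - profile y \<le> (y - x) powr p" .
    show "profile y \<le> profile x"
      using mono by (auto simp: profile_def s_def s'_def one_plus_powr_pos intro!: divide_left_mono)
  qed
  show "\<exists>C. \<forall>x\<in>{0..}. \<forall>y\<in>{0..}. \<bar>profile x - profile y\<bar> \<le> C * \<bar>x - y\<bar> powr p"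
  proof (intro exI[of _ 1] ballI)
    fix x y :: real assume "x \<in> {0..}" "y \<in> {0..}"
    then show "\<bar>profile x - profile y\<bar> \<le> 1 * \<bar>x - y\<bar> powr p"
      using main[of x y] main[of y x] by (cases "x \<le> y") (auto simp: abs_minus_commute)
  qed
qed

lemma profile_continuous: "continuous_on {0..} profile"
proof -
  obtain C where C: "\<And>x y. 0 \<le> x \<Longrightarrow> 0 \<le> y \<Longrightarrow> \<bar>profile x - profile y\<bar> \<le> C * \<bar>x - y\<bar> powr p"
    using profile_holder unfolding holder_space_def by auto
  show ?thesis
    unfolding continuous_on_def
  proof
    fix x :: real assume x: "x \<in> {0..}"
    have ev: "\<forall>\<^sub>F y in at x within {0..}. norm (profile y - profile x) \<le> C * \<bar>y - x\<bar> powr p"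
      unfolding eventually_at_filter by (rule always_eventually) (use x C in auto)
    have "((\<lambda>y. C * \<bar>y - x\<bar> powr p) \<longlongrightarrow> C * \<bar>x - x\<bar> powr p) (at x within {0..})"
      by (intro tendsto_intros) (use p0 in auto)
    then have "((\<lambda>y. C * \<bar>y - x\<bar> powr p) \<longlongrightarrow> 0) (at x within {0..})" by simp
    from Lim_null_comparison[OF ev this] show "(profile \<longlongrightarrow> profile x) (at x within {0..})"
      by (rule LIM_zero_cancel)
  qed
qed

text \<open>The difference quotients at \<open>0\<close> are at most \<open>- y powr (p-1) / 2\<close> near \<open>0\<close>, hence unbounded.\<close>

lemma profile_not_smooth: "\<not> smooth_within {0..} profile"
proof
  assume "smooth_within {0..} profile"
  then obtain D where D: "\<forall>x\<in>{0..}. D 0 x = profile x"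
    "\<forall>k. \<forall>x\<in>{0..}. (D k has_real_derivative D (Suc k) x) (at x within {0..})"
    unfolding smooth_within_def by blast
  have D0: "D 0 x = profile x" if "x \<ge> 0" for x using D(1) that by simp
  have D1: "(D 0 has_real_derivative D (Suc 0) 0) (at 0 within {0..})" using D(2) by simp
  have lim: "((\<lambda>y. (D 0 y - D 0 0) / (y - 0)) \<longlongrightarrow> D (Suc 0) 0) (at_right 0)"
    using D1 unfolding has_field_derivative_iff at_within_Ici_at_right .
  have "filterlim (\<lambda>y. y powr (p - 1) / 2) at_top (at_right (0::real))"
    using p1 by real_asymp
  moreover have "\<forall>\<^sub>F y in at_right 0. y powr (p - 1) / 2 \<le> - ((D 0 y - D 0 0) / (y - 0))"
    using eventually_at_right_real[of 0 1, simplified]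
  proof eventually_elim
    case (elim y)
    have "y powr (p - 1) / 2 = y powr p / (2 * y)"
      using elim by (simp add: powr_diff)
    also have "\<dots> \<le> y powr p / ((1 + y powr p) * y)"
      using elim p0 powr_le1[of p y] by (intro divide_left_mono mult_right_mono mult_pos_pos) (auto simp: one_plus_powr_pos)
    also have "\<dots> \<le> (1 - profile y) / y"
      using one_minus_profile_ge[of y] elim by (simp add: divide_simps) 
    also have "\<dots> = - ((D 0 y - D 0 0) / (y - 0))"
      using elim by (simp add: D0 profile_0 diff_divide_distrib)
    finally show ?case .
  qed
  ultimately have "filterlim (\<lambda>y. - ((D 0 y - D 0 0) / (y - 0))) at_top (at_right 0)"
    by (rule filterlim_at_top_mono)
  then show False
    using not_tendsto_and_filterlim_at_infinity[OF _ tendsto_minus[OF lim]]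
      filterlim_at_top_imp_at_infinity trivial_limit_at_right_real by blast
qed

definition profile' :: "real \<Rightarrow> real" where
  "profile' z = - (p * label z powr (p - 1) / (1 + label z powr p))"

lemma label_pos: "0 < z \<Longrightarrow> 0 < label z" using label_ge[of z] by simp

lemma profile_has_derivative:
  assumes "0 < z" shows "(profile has_real_derivative profile' z) (at z)"
proof -
  have "(profile has_real_derivative
      (0 * (1 + label z powr p) - 1 * (0 + p * label z powr (p - 1) * (1 + label z powr p)))
        / ((1 + label z powr p) * (1 + label z powr p))) (at z)"
    unfolding profile_def[abs_def] using label_pos[OF assms]
    by (intro DERIV_divide DERIV_add DERIV_const DERIV_chain2[OF has_real_derivative_powr]
        label_has_derivative assms) auto
  then show ?thesis by (simp add: profile'_def)
qed

lemma label_continuous: "continuous_on {0<..} label"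
  using label_has_derivative by (meson DERIV_isCont continuous_at_imp_continuous_on greaterThan_iff)

lemma profile'_continuous: "continuous_on {0<..} profile'"
  unfolding profile'_def
  by (intro continuous_intros label_continuous) (use label_pos in \<open>auto simp: less_imp_neq[symmetric]\<close>)

lemma profile'_bound: assumes "0 < z" shows "\<bar>profile' z\<bar> \<le> z powr (p - 1)"
proof -
  have "\<bar>profile' z\<bar> = p * (label z powr (p - 1) / (1 + label z powr p))"
    using p0 one_plus_powr_pos[of "label z" p] by (simp add: profile'_def abs_of_pos)
  also have "\<dots> \<le> 1 * (label z powr (p - 1) / 1)"
    using p0 p1 by (intro mult_mono divide_left_mono) (auto simp: one_plus_powr_pos)
  also have "\<dots> \<le> z powr (p - 1)"
    using label_ge[of z] assms p1 by (simp add: powr_mono2')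
  finally show ?thesis .
qed

text \<open>This is the bound \<open>- z \<phi>'(z) \<le> p/(1-p) \<phi>(z)\<close> on the logarithmic slope of the profile, in
  integrated form.  In the variable \<open>s\<close> it reduces to \<open>stretch s \<le> s powr (1-p) / (1-p)\<close>.\<close>

lemma profile_scaled_mono:
  assumes "0 \<le> x" "x \<le> y"
  shows "x * profile x powr (1 / p - 1) \<le> y * profile y powr (1 / p - 1)"
proof -
  define b where "b = 1 / p - 1"
  have b: "b > 0" "b * p = 1 - p" using p0 p1 by (auto simp: b_def field_simps)
  define F where "F = (\<lambda>s. stretch s * (1 / (1 + s powr p)) powr b)"
  have der: "\<exists>y. (F has_real_derivative y) (at s) \<and> 0 \<le> y" if "0 < s" for s
  proof -
    have "at s within {0..s+1} = at s" using that by (intro at_within_interior) auto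
    then have dS: "(stretch has_real_derivative 1 / (1 + s powr p)) (at s)"
      using stretch_has_derivative[of s "s+1"] that by simp
    let ?A = "1 + s powr p"
    have A: "?A > 0" by (rule one_plus_powr_pos)
    have F': "F = (\<lambda>s. stretch s * (1 + s powr p) powr (-b))"
      unfolding F_def by (auto simp: powr_divide powr_minus field_simps)
    have dA: "((\<lambda>s. 1 + s powr p) has_real_derivative p * s powr (p - 1)) (at s)"
      using that by (auto intro!: derivative_eq_intros simp: powr_diff)
    have "(F has_real_derivative
        1 / ?A * ?A powr (-b) + (- b * ?A powr (- b - 1) * (p * s powr (p - 1))) * stretch s) (at s)"
      unfolding F' using A
      by (intro DERIV_mult dS DERIV_chain2[OF has_real_derivative_powr dA]) auto
    moreover have "1 / ?A * ?A powr (-b) + (- b * ?A powr (- b - 1) * (p * s powr (p - 1))) * stretch s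
       = ?A powr (-b) / ?A * (1 - (1 - p) * (stretch s * s powr (p - 1)))"
    proof -
      have "?A powr (- b - 1) = ?A powr (-b) / ?A" using A by (simp add: powr_diff)
      then have "1 / ?A * ?A powr (-b) + (- b * ?A powr (- b - 1) * (p * s powr (p - 1))) * stretch s
         = ?A powr (-b) / ?A * (1 - (b * p) * (stretch s * s powr (p - 1)))"
        by (simp add: right_diff_distrib)
      then show ?thesis by (simp only: b(2))
    qed
    moreover have "(1 - p) * (stretch s * s powr (p - 1)) \<le> 1"
    proof -
      have "stretch s * s powr (p - 1) \<le> s powr (1 - p) / (1 - p) * s powr (p - 1)"
        using stretch_upper_powr[of s] that by (intro mult_right_mono) auto
      also have "\<dots> = 1 / (1 - p)"
        using that by (simp add: powr_add[symmetric])
      finally show ?thesis using p1 by (simp add: field_simps)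
    qed
    ultimately show ?thesis using A by (intro exI conjI) auto
  qed
  have main: "F s \<le> F s'" if "0 < s" "s \<le> s'" for s s'
    by (rule DERIV_nonneg_imp_nondecreasing[OF that(2)]) (use der that in auto)
  show ?thesis
  proof (cases "x = 0")
    case False
    then have "F (label x) \<le> F (label y)"
      using assms label_strict_mono[of x y] by (intro main label_pos) (auto simp: less_le)
    then show ?thesis using assms by (simp add: F_def profile_def stretch_label b_def)
  qed (use assms in auto)
qed

text \<open>A relative error in the argument causes a comparable relative error in the value, however small the
  value is.  Between \<open>x\<close> and \<open>y\<close> the profile decreases, but no faster than the power
  \<open>z powr (-p/(1-p))\<close>, by \<open>profile_scaled_mono\<close>.\<close>

lemma profile_ratio:
  assumes "0 < x" "0 < y"
  shows "\<bar>profile y / profile x - 1\<bar> \<le> \<bar>(x / y) powr (p / (1 - p)) - 1\<bar>"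
proof -
  define b where "b = p / (1 - p)"
  have b: "b > 0" "(1/p - 1) * b = 1" using p0 p1 by (auto simp: b_def field_simps)
  have key: "1 \<le> profile u / profile v \<and> profile u / profile v \<le> (v / u) powr b"
    if "0 < u" "u \<le> v" for u v
  proof -
    have "u * profile u powr (1 / p - 1) \<le> v * profile v powr (1 / p - 1)"
      using profile_scaled_mono[of u v] that by simp
    then have "(profile u / profile v) powr (1 / p - 1) \<le> v / u"
      using that profile_pos[of v] by (simp add: powr_divide field_simps)
    then have "((profile u / profile v) powr (1 / p - 1)) powr b \<le> (v / u) powr b"
      using b(1) by (intro powr_mono2) (auto simp: less_imp_le)
    then have "profile u / profile v \<le> (v / u) powr b"
      using profile_pos[of u] profile_pos[of v] unfolding powr_powr b(2) by simp
    moreover have "profile v \<le> profile u"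
      using monotone_onD[OF profile_strict_antimono, of u v] that by (cases "u = v") auto
    ultimately show ?thesis
      using profile_pos[of v] by simp
  qed
  show ?thesis
  proof (cases "y \<le> x")
    case True
    then show ?thesis using key[of y x] assms by (simp add: b_def[symmetric])
  next
    case False
    define A where "A = profile x / profile y"
    define B where "B = (y / x) powr b"
    have AB: "1 \<le> A" "A \<le> B" using key[of x y] assms False by (auto simp: A_def B_def)
    have "profile y / profile x = 1 / A" by (simp add: A_def)
    moreover have "(x / y) powr b = 1 / B" by (simp add: B_def powr_divide)
    moreover have "1 / B \<le> 1 / A" "1 / A \<le> 1" using AB by (auto intro: divide_left_mono)
    ultimately show ?thesis by (simp add: b_def[symmetric])
  qed
qed

end

lemma continuous_on_slice:
  assumes "continuous_on (U \<times> V) (\<lambda>x. f (fst x) (snd x))" "t \<in> U"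
  shows "continuous_on V (f t)"
proof -
  have "continuous_on V ((\<lambda>x. f (fst x) (snd x)) \<circ> Pair t)"
    by (rule continuous_on_compose) (use assms in \<open>auto intro!: continuous_intros elim: continuous_on_subset\<close>)
  then show ?thesis by (simp add: o_def)
qed

text \<open>Scaling the interval of integration to \<open>[0,1]\<close> turns the variable upper limit into a parameter of
  the integrand.\<close>

lemma continuous_on_integral_upper:
  fixes f :: "'a::topological_space \<Rightarrow> real \<Rightarrow> real"
  assumes "continuous_on (U \<times> {0..1}) (\<lambda>(t, z). f t z)"
  shows "continuous_on (U \<times> {0..1}) (\<lambda>(t, Z). integral {0..Z} (f t))"
proof -
  have scale: "integral {0..Z} (f t) = Z * integral {0..1} (\<lambda>s. f t (Z * s))"
    if "t \<in> U" "Z \<in> {0..1}" for t Z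
  proof -
    have cf: "continuous_on {0..1} (f t)"
      using continuous_on_slice[of U "{0..1}" f t] assms that by (simp add: split_beta)
    have "((\<lambda>s. Z *\<^sub>R f t (Z * s)) has_integral (integral {Z * 0..Z * 1} (f t))) {0..1}"
      by (rule has_integral_substitution[OF _ _ _ cf])
        (use that in \<open>auto intro!: derivative_eq_intros mult_le_one\<close>)
    from integral_unique[OF this] show ?thesis by simp
  qed
  have "continuous_on ((U \<times> {0..1}) \<times> cbox 0 1) (\<lambda>(x, s). f (fst x) (snd x * s))"
    unfolding split_beta
    by (rule continuous_on_compose2[OF assms[unfolded split_beta],
        where f = "\<lambda>x. (fst (fst x), snd (fst x) * snd x)", unfolded fst_conv snd_conv])
      (auto intro!: continuous_intros mult_le_one)
  then have "continuous_on (U \<times> {0..1}) (\<lambda>x. integral (cbox 0 1) (\<lambda>s. f (fst x) (snd x * s)))"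
    by (rule integral_continuous_on_param)
  then have "continuous_on (U \<times> {0..1}) (\<lambda>x. snd x * integral (cbox 0 1) (\<lambda>s. f (fst x) (snd x * s)))"
    by (intro continuous_intros)
  then show ?thesis
    by (rule continuous_on_eq) (auto simp: scale)
qed

text \<open>Implicit differentiation with a one-sided time derivative.  By the mean value theorem in the second
  argument, \<open>F t (x t) - F t (x t0) = Fx t \<xi> (x t - x t0)\<close> for an intermediate point \<open>\<xi>\<close>,
  which tends to \<open>x t0\<close>; continuity of \<open>Fx\<close> then gives the limit of the quotient.\<close>

lemma implicit_has_real_derivative:
  fixes F :: "real \<Rightarrow> real \<Rightarrow> real" and x :: "real \<Rightarrow> real"
  assumes t0: "t0 \<in> U" and cx: "continuous (at t0 within U) x"
    and xab: "\<And>t. t \<in> U \<Longrightarrow> x t \<in> {a..b}" and const: "\<And>t. t \<in> U \<Longrightarrow> F t (x t) = k"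
    and Fx: "\<And>t y. t \<in> U \<Longrightarrow> y \<in> {a..b} \<Longrightarrow> (F t has_real_derivative Fx t y) (at y within {a..b})"
    and cFx: "continuous_on (U \<times> {a..b}) (\<lambda>(t, y). Fx t y)"
    and pos: "\<And>t y. t \<in> U \<Longrightarrow> y \<in> {a..b} \<Longrightarrow> Fx t y \<noteq> 0"
    and Ft: "((\<lambda>t. F t (x t0)) has_real_derivative Ft) (at t0 within U)"
  shows "(x has_real_derivative - Ft / Fx t0 (x t0)) (at t0 within U)"
proof -
  have "\<exists>\<xi>. \<bar>\<xi> - x t0\<bar> \<le> \<bar>x t - x t0\<bar> \<and> \<xi> \<in> {a..b} \<and> F t (x t) - F t (x t0) = Fx t \<xi> * (x t - x t0)"
    if t: "t \<in> U" for t
  proof -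
    have mv: "\<exists>\<xi>\<in>{u<..<v}. F t v - F t u = Fx t \<xi> * (v - u)" if "u < v" "u \<in> {a..b}" "v \<in> {a..b}" for u v
    proof (rule mvt_simple[OF that(1)])
      fix y assume "u \<le> y" "y \<le> v"
      then have "(F t has_real_derivative Fx t y) (at y within {u..v})"
        using that by (intro DERIV_subset[OF Fx[OF t]]) auto
      then show "(F t has_derivative (*) (Fx t y)) (at y within {u..v})"
        by (simp add: has_field_derivative_def)
    qed
    consider "x t = x t0" | "x t < x t0" | "x t0 < x t" by linarith
    then show ?thesis
    proof cases
      case 1 then show ?thesis using xab[OF t0] by auto
    next
      case 2
      then obtain \<xi> where "\<xi> \<in> {x t<..<x t0}" "F t (x t0) - F t (x t) = Fx t \<xi> * (x t0 - x t)"
        using mv xab t t0 by blast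
      then show ?thesis using xab[OF t] xab[OF t0] by (intro exI[of _ \<xi>]) (auto simp: algebra_simps)
    next
      case 3
      then obtain \<xi> where "\<xi> \<in> {x t0<..<x t}" "F t (x t) - F t (x t0) = Fx t \<xi> * (x t - x t0)"
        using mv xab t t0 by blast
      then show ?thesis using xab[OF t] xab[OF t0] by (intro exI[of _ \<xi>]) auto
    qed
  qed
  then obtain \<xi> where \<xi>: "\<And>t. t \<in> U \<Longrightarrow> \<bar>\<xi> t - x t0\<bar> \<le> \<bar>x t - x t0\<bar>" "\<And>t. t \<in> U \<Longrightarrow> \<xi> t \<in> {a..b}"
    "\<And>t. t \<in> U \<Longrightarrow> F t (x t) - F t (x t0) = Fx t (\<xi> t) * (x t - x t0)"
    by metis
  have inU: "\<forall>\<^sub>F t in at t0 within U. t \<in> U" by (simp add: eventually_at_filter)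
  have "((\<lambda>t. x t - x t0) \<longlongrightarrow> 0) (at t0 within U)"
    using cx unfolding continuous_within by (simp add: LIM_zero)
  then have "((\<lambda>t. \<xi> t - x t0) \<longlongrightarrow> 0) (at t0 within U)"
    by (rule Lim_null_comparison[rotated, OF tendsto_rabs_zero])
      (use inU in \<open>auto elim!: eventually_mono simp: \<xi>(1)\<close>)
  then have \<xi>lim: "(\<xi> \<longlongrightarrow> x t0) (at t0 within U)" by (rule LIM_zero_cancel)
  have pl: "((\<lambda>t. (t, \<xi> t)) \<longlongrightarrow> (t0, x t0)) (at t0 within U)"
    by (intro tendsto_intros \<xi>lim)
  then have Fxlim: "((\<lambda>t. Fx t (\<xi> t)) \<longlongrightarrow> Fx t0 (x t0)) (at t0 within U)"
    using continuous_on_tendsto_compose[OF cFx pl] eventually_mono[OF inU, of "\<lambda>t. (t, \<xi> t) \<in> U \<times> {a..b}"]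
      xab[OF t0] t0 \<xi>(2) by auto
  have "((\<lambda>t. - ((F t (x t0) - F t0 (x t0)) / (t - t0)) / Fx t (\<xi> t)) \<longlongrightarrow> - Ft / Fx t0 (x t0)) (at t0 within U)"
    using Ft[unfolded has_field_derivative_iff] pos[OF t0 xab[OF t0]]
    by (intro tendsto_intros Fxlim) auto
  then show ?thesis unfolding has_field_derivative_iff
  proof (rule Lim_transform_eventually)
    show "\<forall>\<^sub>F t in at t0 within U. - ((F t (x t0) - F t0 (x t0)) / (t - t0)) / Fx t (\<xi> t) = (x t - x t0) / (t - t0)"
      using inU
    proof eventually_elim
      case (elim t)
      have "F t0 (x t0) - F t (x t0) = Fx t (\<xi> t) * (x t - x t0)"
        using \<xi>(3)[OF elim] const[OF elim] const[OF t0] by simp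
      then have "x t - x t0 = - (F t (x t0) - F t0 (x t0)) / Fx t (\<xi> t)"
        using pos[OF elim \<xi>(2)[OF elim]] by (simp add: field_simps)
      then show ?case by (simp add: minus_divide_left mult.commute)
    qed
  qed
qed

section \<open>The explicit solution\<close>

text \<open>The derivative may be singular at \<open>0\<close>.  The bound \<open>M\<close> on the datum fixes the interval
  \<open>0 \<le> e < 1/M\<close> on which \<open>J = 1 - e g\<close> is positive.\<close>

locale datum =
  fixes g g' :: "real \<Rightarrow> real" and M :: real
  assumes g_cont: "continuous_on {0..1} g"
    and g_deriv: "\<And>x. x \<in> {0<..1} \<Longrightarrow> (g has_real_derivative g' x) (at x within {0..1})"
    and g'_cont: "continuous_on {0<..1} g'"
    and g_le: "\<And>x. x \<in> {0..1} \<Longrightarrow> g x \<le> M"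
    and M_pos: "0 < M"
    and g_mean: "integral {0..1} g = 0"
begin

definition I :: "real set" where "I = {0..<1/M}"
definition J :: "real \<Rightarrow> real \<Rightarrow> real" where "J e x = 1 - e * g x"
definition R :: "real \<Rightarrow> real \<Rightarrow> real" where "R e x = integral {0..x} (\<lambda>y. 1 / J e y)"

text \<open>Differentiation with respect to \<open>e\<close> turns \<open>R\<close> into \<open>Q\<close>, \<open>K\<close> into \<open>G\<close> and \<open>G\<close> into
  \<open>2 H\<close>.\<close>

definition Q :: "real \<Rightarrow> real \<Rightarrow> real" where "Q e x = integral {0..x} (\<lambda>y. g y / (J e y)^2)"
definition K :: "real \<Rightarrow> real" where "K e = integral {0..1} (\<lambda>y. 1 / J e y)"
definition G :: "real \<Rightarrow> real" where "G e = integral {0..1} (\<lambda>y. g y / (J e y)^2)"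
definition H :: "real \<Rightarrow> real" where "H e = integral {0..1} (\<lambda>y. (g y)^2 / (J e y)^3)"

text \<open>The position at artificial time \<open>e\<close> of the particle that starts at \<open>x\<close>.\<close>

definition flow :: "real \<Rightarrow> real \<Rightarrow> real" where "flow e x = R e x / K e"

text \<open>The \<open>e\<close>-derivative of the position, hence \<open>K\<^sup>2\<close> times the velocity of the particle.\<close>

definition flow_e :: "real \<Rightarrow> real \<Rightarrow> real" where "flow_e e x = Q e x / K e - R e x * G e / (K e)^2"

text \<open>The starting point of the particle that sits at \<open>Z\<close>.\<close>

definition X :: "real \<Rightarrow> real \<Rightarrow> real" where "X e Z = inv_into {0..1} (flow e) Z"

text \<open>The value carried by the particle that starts at \<open>x\<close>.\<close>

definition A :: "real \<Rightarrow> real \<Rightarrow> real" where "A e x = (g x / J e x - G e / K e) / (K e)^2"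

lemma I_convex: "convex I" by (simp add: I_def)
lemma zero_in_I: "0 \<in> I" using M_pos by (simp add: I_def)

lemma J_lower: assumes "0 \<le> e" "x \<in> {0..1}" shows "1 - e * M \<le> J e x"
  using mult_left_mono[OF g_le[OF assms(2)] assms(1)] by (simp add: J_def)

lemma J_pos: assumes "e \<in> I" "x \<in> {0..1}" shows "0 < J e x"
  using J_lower[of e x] assms M_pos by (auto simp: I_def field_simps)

lemma J_ne: "e \<in> I \<Longrightarrow> x \<in> {0..1} \<Longrightarrow> J e x \<noteq> 0"
  using J_pos by force

lemma g_snd_cont [continuous_intros]: "continuous_on (U \<times> {0..1}) (\<lambda>x. g (snd x))"
  by (rule continuous_on_compose2[OF g_cont]) (auto intro: continuous_intros)

lemma J_joint_cont [continuous_intros]: "continuous_on (U \<times> {0..1}) (\<lambda>x. J (fst x) (snd x))"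
  unfolding J_def by (intro continuous_intros)

lemma J_cont [continuous_intros]: "continuous_on {0..1} (J e)"
  unfolding J_def[abs_def] by (intro continuous_intros g_cont)

lemma inv_J_cont: "e \<in> I \<Longrightarrow> continuous_on {0..1} (\<lambda>y. 1 / J e y)"
  and gJ2_cont: "e \<in> I \<Longrightarrow> continuous_on {0..1} (\<lambda>y. g y / (J e y)^2)"
  and g2J3_cont: "e \<in> I \<Longrightarrow> continuous_on {0..1} (\<lambda>y. (g y)^2 / (J e y)^3)"
  by (intro continuous_intros g_cont; use J_ne in auto)+

lemma J_deriv_e: "((\<lambda>e. J e x) has_real_derivative - g x) (at e within U)"
  unfolding J_def by (auto intro!: derivative_eq_intros)

lemma R_deriv_e:
  assumes "e \<in> I" "x \<in> {0..1}"
  shows "((\<lambda>e. R e x) has_real_derivative Q e x) (at e within I)"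
proof -
  have sub: "y \<in> {0..1}" if "y \<in> cbox 0 x" for y using that assms by auto
  have "((\<lambda>e. integral (cbox 0 x) (\<lambda>y. 1 / J e y)) has_real_derivative
      integral (cbox 0 x) (\<lambda>y. g y / (J e y)^2)) (at e within I)"
  proof (rule leibniz_rule_field_derivative[OF _ _ _ assms(1) I_convex])
    fix e y assume ey: "e \<in> I" "y \<in> cbox 0 x"
    show "((\<lambda>e. 1 / J e y) has_real_derivative g y / (J e y)^2) (at e within I)"
      using J_ne[OF ey(1) sub[OF ey(2)]]
      by (auto intro!: derivative_eq_intros J_deriv_e simp: power2_eq_square)
  next
    fix e assume "e \<in> I"
    then show "(\<lambda>y. 1 / J e y) integrable_on cbox 0 x"
      using continuous_on_subset[OF inv_J_cont[of e], of "cbox 0 x"] sub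
      by (intro integrable_continuous) auto
  next
    have "continuous_on (I \<times> {0..1}) (\<lambda>x. g (snd x) / (J (fst x) (snd x))^2)"
      by (intro continuous_intros) (use J_ne in auto)
    then show "continuous_on (I \<times> cbox 0 x) (\<lambda>(e, y). g y / (J e y)^2)"
      unfolding split_beta by (rule continuous_on_subset) (use sub in auto)
  qed
  then show ?thesis by (simp add: R_def[abs_def] Q_def[abs_def])
qed

lemma K_R: "K e = R e 1" and G_Q: "G e = Q e 1"
  by (simp_all add: K_def R_def G_def Q_def)

lemma K_deriv: "e \<in> I \<Longrightarrow> (K has_real_derivative G e) (at e within I)"
  using R_deriv_e[of e 1] by (simp add: K_R[abs_def] G_Q)

lemma G_deriv:
  assumes "e \<in> I"
  shows "(G has_real_derivative 2 * H e) (at e within I)"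
proof -
  have "((\<lambda>e. integral (cbox 0 1) (\<lambda>y. g y / (J e y)^2)) has_real_derivative
      integral (cbox 0 1) (\<lambda>y. 2 * ((g y)^2 / (J e y)^3))) (at e within I)"
  proof (rule leibniz_rule_field_derivative[OF _ _ _ assms I_convex])
    fix e y :: real assume ey: "e \<in> I" "y \<in> cbox 0 1"
    show "((\<lambda>e. g y / (J e y)^2) has_real_derivative 2 * ((g y)^2 / (J e y)^3)) (at e within I)"
      using J_ne[OF ey(1)] ey(2)
      by (auto intro!: derivative_eq_intros J_deriv_e simp: divide_simps power2_eq_square eval_nat_numeral)
  next
    fix e assume "e \<in> I"
    then show "(\<lambda>y. g y / (J e y)^2) integrable_on cbox 0 1"
      using gJ2_cont[of e] by (intro integrable_continuous) auto
  next
    have "continuous_on (I \<times> {0..1}) (\<lambda>x. 2 * ((g (snd x))^2 / (J (fst x) (snd x))^3))"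
      by (intro continuous_intros) (use J_ne in auto)
    then show "continuous_on (I \<times> cbox 0 1) (\<lambda>(e, y). 2 * ((g y)^2 / (J e y)^3))"
      by (simp add: split_beta)
  qed
  then show ?thesis by (simp add: G_def[abs_def] H_def[abs_def] del: times_divide_eq_right)
qed

lemma R_deriv_x:
  assumes "e \<in> I" "x \<in> {0..1}"
  shows "(R e has_real_derivative 1 / J e x) (at x within {0..1})"
  unfolding R_def[abs_def] by (rule integral_has_real_derivative[OF inv_J_cont[OF assms(1)] assms(2)])

lemma R_strict_mono: assumes "e \<in> I" shows "strict_mono_on {0..1} (R e)"
proof (rule strict_mono_onI)
  fix x y :: real assume xy: "x \<in> {0..1}" "y \<in> {0..1}" "x < y"
  show "R e x < R e y"
  proof (rule DERIV_pos_imp_increasing_open[OF xy(3)])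
    fix z assume z: "x < z" "z < y"
    then have "at z within {0..1} = at z" using xy by (intro at_within_interior) auto
    then show "\<exists>w. (R e has_real_derivative w) (at z) \<and> 0 < w"
      using R_deriv_x[OF assms, of z] J_pos[OF assms, of z] z xy by auto
  next
    have "continuous_on {0..1} (R e)"
      by (rule DERIV_continuous_on[OF R_deriv_x[OF assms]])
    then show "continuous_on {x..y} (R e)" by (rule continuous_on_subset) (use xy in auto)
  qed
qed

lemma R_0 [simp]: "R e 0 = 0" by (simp add: R_def)

lemma K_pos: "e \<in> I \<Longrightarrow> 0 < K e"
  using strict_mono_onD[OF R_strict_mono, of e 0 1] by (simp add: K_R)

lemma K_ne: "e \<in> I \<Longrightarrow> K e \<noteq> 0" using K_pos by force

lemma K_cont: "continuous_on I K"
  by (rule DERIV_continuous_on[OF K_deriv])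

lemma G_cont: "continuous_on I G"
  by (rule DERIV_continuous_on[OF G_deriv])

lemma K_fst_cont [continuous_intros]: "continuous_on (I \<times> U) (\<lambda>x. K (fst x))"
  by (rule continuous_on_compose2[OF K_cont]) (auto intro: continuous_intros)

lemma G_fst_cont [continuous_intros]: "continuous_on (I \<times> U) (\<lambda>x. G (fst x))"
  by (rule continuous_on_compose2[OF G_cont]) (auto intro: continuous_intros)

lemma flow_deriv_x:
  assumes "e \<in> I" "x \<in> {0..1}"
  shows "(flow e has_real_derivative 1 / (K e * J e x)) (at x within {0..1})"
  unfolding flow_def[abs_def] using DERIV_cdivide[OF R_deriv_x[OF assms], of "K e"]
  by (simp add: mult.commute)

lemma flow_deriv_e:
  assumes "e \<in> I" "x \<in> {0..1}"
  shows "((\<lambda>e. flow e x) has_real_derivative flow_e e x) (at e within I)"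
  unfolding flow_def[abs_def] flow_e_def
  by (rule DERIV_cong[OF DERIV_divide[OF R_deriv_e[OF assms] K_deriv[OF assms(1)] K_ne[OF assms(1)]]])
    (use K_ne[OF assms(1)] in \<open>simp add: diff_divide_distrib power2_eq_square mult.commute\<close>)

lemma flow_0 [simp]: "flow e 0 = 0" and flow_1: "e \<in> I \<Longrightarrow> flow e 1 = 1"
  using K_ne by (simp_all add: flow_def K_R[symmetric])

lemma flow_strict_mono: "e \<in> I \<Longrightarrow> strict_mono_on {0..1} (flow e)"
  using R_strict_mono K_pos by (auto simp: strict_mono_on_def flow_def divide_strict_right_mono)

lemma flow_cont: "e \<in> I \<Longrightarrow> continuous_on {0..1} (flow e)"
  by (rule DERIV_continuous_on[OF flow_deriv_x])

lemma flow_image: assumes "e \<in> I" shows "flow e ` {0..1} = {0..1}"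
proof
  show "flow e ` {0..1} \<subseteq> {0..1}"
  proof (rule image_subsetI)
    fix x :: real assume "x \<in> {0..1}"
    then show "flow e x \<in> {0..1}"
      using strict_mono_on_leD[OF flow_strict_mono[OF assms], of 0 x]
        strict_mono_on_leD[OF flow_strict_mono[OF assms], of x 1] flow_1[OF assms] by simp
  qed
  show "{0..1} \<subseteq> flow e ` {0..1}"
  proof
    fix z :: real assume "z \<in> {0..1}"
    then show "z \<in> flow e ` {0..1}"
      using IVT'[of "flow e" 0 z 1] flow_cont[OF assms] flow_1[OF assms] by auto
  qed
qed

lemma flow_in: "e \<in> I \<Longrightarrow> x \<in> {0..1} \<Longrightarrow> flow e x \<in> {0..1}"
  using flow_image by blast

lemma X_flow: "e \<in> I \<Longrightarrow> x \<in> {0..1} \<Longrightarrow> X e (flow e x) = x"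
  unfolding X_def using strict_mono_on_imp_inj_on[OF flow_strict_mono] by (rule inv_into_f_f)

lemma X_in: "e \<in> I \<Longrightarrow> Z \<in> {0..1} \<Longrightarrow> X e Z \<in> {0..1}"
  and flow_X: "e \<in> I \<Longrightarrow> Z \<in> {0..1} \<Longrightarrow> flow e (X e Z) = Z"
  unfolding X_def using flow_image by (metis inv_into_into, metis f_inv_into_f)

lemma X_0: "e \<in> I \<Longrightarrow> X e 0 = 0" using X_flow[of e 0] by simp

lemma X_pos: assumes "e \<in> I" "Z \<in> {0<..1}" shows "X e Z \<in> {0<..1}"
proof -
  have "X e Z \<noteq> 0" using flow_X[of e Z] assms by auto
  then show ?thesis using X_in[of e Z] assms by auto
qed

lemma X_deriv_Z:
  assumes "e \<in> I" "Z \<in> {0..1}"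
  shows "(X e has_real_derivative K e * J e (X e Z)) (at Z within {0..1})"
  using strict_mono_on_inverse_has_real_derivative[OF flow_cont[OF assms(1)] flow_strict_mono[OF assms(1)]
      X_in[OF assms] flow_deriv_x[OF assms(1) X_in[OF assms]], of "X e"]
    X_flow[OF assms(1)] flow_X[OF assms] flow_1[OF assms(1)] K_ne[OF assms(1)] J_ne[OF assms(1) X_in[OF assms]]
  by simp

lemma inv_J_joint_cont: "continuous_on (I \<times> {0..1}) (\<lambda>(e, x). 1 / J e x)"
  unfolding split_beta by (intro continuous_intros) (use J_ne in auto)

lemma flow_joint_cont: "continuous_on (I \<times> {0..1}) (\<lambda>x. flow (fst x) (snd x))"
  unfolding flow_def using continuous_on_integral_upper[OF inv_J_joint_cont] K_ne
  by (intro continuous_intros) (auto simp: R_def split_beta)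

end

lemma DERIV_chain_within:
  assumes "(f has_real_derivative a) (at (h x) within B)" "(h has_real_derivative b) (at x within U)"
    and "\<And>y. y \<in> U \<Longrightarrow> h y \<in> B"
  shows "((\<lambda>x. f (h x)) has_real_derivative a * b) (at x within U)"
proof -
  have "(f has_real_derivative a) (at (h x) within h ` U)"
    by (rule DERIV_subset[OF assms(1)]) (use assms(3) in auto)
  from DERIV_image_chain[OF this assms(2)] show ?thesis by (simp add: o_def)
qed

lemma riccati_quotient_derivative:
  fixes y :: "real \<Rightarrow> real"
  assumes "(y has_real_derivative y') (at e within U)" "1 - e * y e \<noteq> 0"
  shows "((\<lambda>e. y e / (1 - e * y e)) has_real_derivative (y' + (y e)^2) / (1 - e * y e)^2) (at e within U)"
  by (rule DERIV_cong[OF DERIV_divide[OF assms(1)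
        DERIV_diff[OF DERIV_const DERIV_mult[OF DERIV_ident assms(1)]] assms(2)]])
    (simp add: power2_eq_square algebra_simps)

text \<open>The uniqueness argument needs a bound on the spatial derivative of one of the two solutions, so this
  derivative has to be accessible by name.\<close>

definition solution_with ::
  "real \<Rightarrow> (real \<Rightarrow> real) \<Rightarrow> (real \<Rightarrow> real \<Rightarrow> real) \<Rightarrow> (real \<Rightarrow> real \<Rightarrow> real) \<Rightarrow> (real \<Rightarrow> real \<Rightarrow> real) \<Rightarrow> bool"
where
  "solution_with T a0 a a_t a_Z \<longleftrightarrow>
     continuous_on ({0..<T} \<times> {0..1}) (\<lambda>(t, Z). a t Z) \<and>
     continuous_on ({0..<T} \<times> {0<..1}) (\<lambda>(t, Z). a_t t Z) \<and>
     continuous_on ({0..<T} \<times> {0<..1}) (\<lambda>(t, Z). a_Z t Z) \<and>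
     (\<forall>t\<in>{0..<T}. \<forall>Z\<in>{0..1}.
        ((\<lambda>s. a s Z) has_real_derivative a_t t Z) (at t within {0..<T})) \<and>
     (\<forall>t\<in>{0..<T}. \<forall>Z\<in>{0<..1}.
        (a t has_real_derivative a_Z t Z) (at Z within {0..1})) \<and>
     (\<forall>t\<in>{0..<T}. \<forall>Z\<in>{0..1}.
        a_t t Z - (a t Z)^2 + integral {0..Z} (a t) * a_Z t Z
          + 2 * integral {0..1} (\<lambda>z. (a t z)^2) = 0) \<and>
     (\<forall>t\<in>{0..<T}. integral {0..1} (a t) = 0) \<and>
     (\<forall>Z\<in>{0..1}. a 0 Z = a0 Z)"

lemma solution_on_iff: "solution_on T a0 a \<longleftrightarrow> (\<exists>a_t a_Z. solution_with T a0 a a_t a_Z)"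
  unfolding solution_on_def solution_with_def by blast

context datum
begin

text \<open>On a compact set of times, \<open>(e, x) \<mapsto> (e, flow e x)\<close> is a continuous bijection of a compact
  rectangle onto itself, so its inverse is continuous; continuity is local in \<open>e\<close>.\<close>

lemma X_joint_cont: "continuous_on (I \<times> {0..1}) (\<lambda>x. X (fst x) (snd x))"
  unfolding continuous_on_eq_continuous_within
proof
  fix x assume "x \<in> I \<times> {0..1::real}"
  then obtain e Z where x: "x = (e, Z)" "e \<in> I" "Z \<in> {0..1}" by auto
  obtain e1 where e1: "e < e1" "e1 < 1 / M" using x(2) dense[of e "1 / M"] by (auto simp: I_def)
  let ?C = "{0..e1} \<times> {0..1::real}"
  have CI: "?C \<subseteq> I \<times> {0..1}" using e1 by (auto simp: I_def)
  have "continuous_on ((\<lambda>x. (fst x, flow (fst x) (snd x))) ` ?C) (\<lambda>x. (fst x, X (fst x) (snd x)))"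
  proof (rule continuous_on_inv)
    show "continuous_on ?C (\<lambda>x. (fst x, flow (fst x) (snd x)))"
      by (intro continuous_intros continuous_on_subset[OF flow_joint_cont CI])
    show "compact ?C" by (intro compact_Times) auto
    show "\<forall>x\<in>?C. (fst (fst x, flow (fst x) (snd x)), X (fst (fst x, flow (fst x) (snd x)))
       (snd (fst x, flow (fst x) (snd x)))) = x"
      using CI X_flow by (auto simp: subset_eq)
  qed
  moreover have "(\<lambda>x. (fst x, flow (fst x) (snd x))) ` ?C = ?C"
  proof -
    have "(\<lambda>x. (fst x, flow (fst x) (snd x))) ` ?C = (\<Union>e\<in>{0..e1}. {e} \<times> flow e ` {0..1})" by force
    also have "\<dots> = (\<Union>e\<in>{0..e1}. {e} \<times> {0..1})"
      by (intro SUP_cong refl arg_cong2[where f="(\<times>)"] flow_image) (use e1 in \<open>auto simp: I_def\<close>)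
    finally show ?thesis by auto
  qed
  ultimately have "continuous_on ?C (\<lambda>x. (fst x, X (fst x) (snd x)))" by simp
  from continuous_on_snd[OF this] have "continuous_on ?C (\<lambda>x. X (fst x) (snd x))" by simp
  then have "continuous (at x within ?C) (\<lambda>x. X (fst x) (snd x))"
    using x e1 by (auto simp: continuous_on_eq_continuous_within I_def)
  moreover have "at x within ?C = at x within (I \<times> {0..1})"
    by (rule at_within_nhd[of x "{..<e1} \<times> UNIV"])
      (use x e1 in \<open>auto simp: I_def intro!: open_Times\<close>)
  ultimately show "continuous (at x within I \<times> {0..1}) (\<lambda>x. X (fst x) (snd x))" by simp
qed

lemma X_deriv_e:
  assumes "e \<in> I" "Z \<in> {0..1}"
  shows "((\<lambda>e. X e Z) has_real_derivative - flow_e e (X e Z) * (K e * J e (X e Z))) (at e within I)"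
proof -
  have "((\<lambda>e. X e Z) has_real_derivative - flow_e e (X e Z) / (1 / (K e * J e (X e Z)))) (at e within I)"
  proof (rule implicit_has_real_derivative[where F = flow and a = 0 and b = 1 and k = Z])
    have "continuous_on I (\<lambda>e. X e Z)"
      by (rule continuous_on_compose2[OF X_joint_cont, where f = "\<lambda>e. (e, Z)", unfolded fst_conv snd_conv])
        (use assms in \<open>auto intro!: continuous_intros\<close>)
    then show "continuous (at e within I) (\<lambda>e. X e Z)"
      using assms by (simp add: continuous_on_eq_continuous_within)
    show "continuous_on (I \<times> {0..1}) (\<lambda>(e, x). 1 / (K e * J e x))"
      unfolding split_beta by (intro continuous_intros) (use K_ne J_ne in auto)
  qed (use assms X_in flow_X flow_deriv_x flow_deriv_e K_ne J_ne in auto)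
  then show ?thesis by simp
qed

definition sol :: "real \<Rightarrow> real \<Rightarrow> real" where "sol e Z = A e (X e Z)"
definition sol_Z :: "real \<Rightarrow> real \<Rightarrow> real" where "sol_Z e Z = g' (X e Z) / (K e * J e (X e Z))"

lemma A_joint_cont: "continuous_on (I \<times> {0..1}) (\<lambda>x. A (fst x) (snd x))"
  unfolding A_def by (intro continuous_intros) (use K_ne J_ne in auto)

lemma eX_cont: "continuous_on (I \<times> {0..1}) (\<lambda>x. (fst x, X (fst x) (snd x)))"
  by (intro continuous_intros X_joint_cont)

lemma sol_joint_cont: "continuous_on (I \<times> {0..1}) (\<lambda>x. sol (fst x) (snd x))"
  unfolding sol_def using continuous_on_compose2[OF A_joint_cont eX_cont] X_in by force

lemma sol_cont: "e \<in> I \<Longrightarrow> continuous_on {0..1} (sol e)"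
  by (rule continuous_on_slice[OF sol_joint_cont])

lemma sol_Z_joint_cont: "continuous_on (I \<times> {0<..1}) (\<lambda>x. sol_Z (fst x) (snd x))"
proof -
  have sub: "I \<times> {0<..1} \<subseteq> I \<times> {0..1::real}" by auto
  have 1: "continuous_on (I \<times> {0<..1}) (\<lambda>x. g' (X (fst x) (snd x)))"
    by (rule continuous_on_compose2[OF g'_cont continuous_on_subset[OF X_joint_cont sub]])
      (use X_pos in auto)
  have 2: "continuous_on (I \<times> {0<..1}) (\<lambda>x. J (fst x) (X (fst x) (snd x)))"
    using continuous_on_compose2[OF J_joint_cont[of I] continuous_on_subset[OF eX_cont sub]] X_in by force
  show ?thesis unfolding sol_Z_def
    by (intro continuous_intros 1 2) (use K_ne J_ne X_in in auto)
qed

lemma sol_deriv_Z: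
  assumes "e \<in> I" "Z \<in> {0<..1}"
  shows "(sol e has_real_derivative sol_Z e Z) (at Z within {0..1})"
proof -
  have Z: "Z \<in> {0..1}" using assms by auto
  note X = X_in[OF assms(1) Z] X_pos[OF assms]
  have gX: "((\<lambda>Z. g (X e Z)) has_real_derivative g' (X e Z) * (K e * J e (X e Z))) (at Z within {0..1})"
    by (rule DERIV_chain_within[OF g_deriv[OF X(2)] X_deriv_Z[OF assms(1) Z] X_in[OF assms(1)]])
  have nz: "1 - e * g (X e Z) \<noteq> 0" using J_ne[OF assms(1) X(1)] by (simp add: J_def)
  let ?y' = "g' (X e Z) * (K e * J e (X e Z))"
  have "((\<lambda>Z. g (X e Z) / (1 - e * g (X e Z))) has_real_derivative ?y' / (1 - e * g (X e Z))^2) (at Z within {0..1})"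
    by (rule DERIV_cong[OF DERIV_divide[OF gX DERIV_diff[OF DERIV_const DERIV_cmult[OF gX]] nz]])
      (simp add: power2_eq_square algebra_simps)
  from DERIV_cdivide[OF DERIV_diff[OF this DERIV_const], of "G e / K e" "(K e)^2"]
  have "((\<lambda>Z. (g (X e Z) / (1 - e * g (X e Z)) - G e / K e) / (K e)^2) has_real_derivative
     ?y' / (J e (X e Z))^2 / (K e)^2) (at Z within {0..1})"
    by (simp add: J_def)
  moreover have "(g' (X e Z) * (K e * J e (X e Z))) / (J e (X e Z))^2 / (K e)^2 = sol_Z e Z"
    using K_ne[OF assms(1)] J_ne[OF assms(1) X(1)] by (simp add: sol_Z_def power2_eq_square)
  ultimately show ?thesis by (simp add: sol_def[abs_def] A_def J_def)
qed

lemma integral_flow_substitution: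
  assumes e: "e \<in> I" and f: "continuous_on {0..1} f" and x: "x \<in> {0..1}"
  shows "integral {0..flow e x} f = integral {0..x} (\<lambda>y. f (flow e y) / (K e * J e y))"
proof -
  have "((\<lambda>y. (1 / (K e * J e y)) *\<^sub>R f (flow e y)) has_integral integral {flow e 0..flow e x} f) {0..x}"
  proof (rule has_integral_substitution[OF _ _ _ f])
    show "flow e ` {0..x} \<subseteq> {0..1}"
      by (rule image_subsetI, rule flow_in[OF e]) (use x in auto)
    show "(flow e has_real_derivative 1 / (K e * J e y)) (at y within {0..x})" if "y \<in> {0..x}" for y
      using that x by (intro DERIV_subset[OF flow_deriv_x[OF e]]) auto
  qed (use x flow_in[OF e x] in auto)
  then show ?thesis by (simp add: integral_unique divide_inverse mult.commute)
qed

text \<open>In particle coordinates the integral of the solution up to \<open>flow e x\<close> is the integral of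
  \<open>A / (K J)\<close>, whose integrand is a combination of \<open>g/J\<^sup>2\<close> and \<open>1/J\<close>.  The outcome is the
  velocity of the particle.\<close>

lemma integral_sol:
  assumes e: "e \<in> I" and x: "x \<in> {0..1}"
  shows "integral {0..flow e x} (sol e) = flow_e e x / (K e)^2"
proof -
  have int: "((\<lambda>y. g y / (J e y)^2) has_integral Q e x) {0..x}" "((\<lambda>y. 1 / J e y) has_integral R e x) {0..x}"
    unfolding Q_def R_def
    by (intro integrable_integral integrable_continuous_real continuous_on_subset[OF gJ2_cont[OF e]]
        continuous_on_subset[OF inv_J_cont[OF e]]; use x in auto)+
  have "integral {0..flow e x} (sol e) = integral {0..x} (\<lambda>y. sol e (flow e y) / (K e * J e y))"
    by (rule integral_flow_substitution[OF e sol_cont[OF e] x])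
  also have "\<dots> = integral {0..x} (\<lambda>y. (1 / (K e)^3) * (g y / (J e y)^2) - (G e / (K e)^4) * (1 / J e y))"
  proof (rule integral_cong)
    fix y assume "y \<in> {0..x}"
    then have y: "y \<in> {0..1}" using x by auto
    show "sol e (flow e y) / (K e * J e y)
       = (1 / (K e)^3) * (g y / (J e y)^2) - (G e / (K e)^4) * (1 / J e y)"
      using K_ne[OF e] J_ne[OF e y]
      by (simp add: sol_def X_flow[OF e y] A_def field_simps eval_nat_numeral)
  qed
  also have "\<dots> = (1 / (K e)^3) * Q e x - (G e / (K e)^4) * R e x"
    by (rule integral_unique[OF has_integral_diff[OF has_integral_mult_right[OF int(1)] has_integral_mult_right[OF int(2)]]])
  also have "\<dots> = flow_e e x / (K e)^2"
    using K_ne[OF e] by (simp add: flow_e_def field_simps eval_nat_numeral)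
  finally show ?thesis .
qed

lemma integral_sol_total: assumes "e \<in> I" shows "integral {0..1} (sol e) = 0"
  using integral_sol[OF assms, of 1] flow_1[OF assms] K_ne[OF assms]
  by (simp add: flow_e_def K_R[symmetric] G_Q[symmetric] power2_eq_square)

lemma integral_sol_square:
  assumes e: "e \<in> I"
  shows "integral {0..1} (\<lambda>z. (sol e z)^2) = (H e - (G e)^2 / K e) / (K e)^5"
proof -
  have int: "((\<lambda>y. g y / (J e y)^2) has_integral G e) {0..1}" "((\<lambda>y. 1 / J e y) has_integral K e) {0..1}"
    "((\<lambda>y. (g y)^2 / (J e y)^3) has_integral H e) {0..1}"
    unfolding G_def K_def H_def
    by (intro integrable_integral integrable_continuous_real gJ2_cont[OF e] inv_J_cont[OF e] g2J3_cont[OF e])+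
  have "integral {0..1} (\<lambda>z. (sol e z)^2) = integral {0..1} (\<lambda>y. (sol e (flow e y))^2 / (K e * J e y))"
    using integral_flow_substitution[OF e, of "\<lambda>z. (sol e z)^2" 1] sol_cont[OF e] flow_1[OF e]
    by (auto intro!: continuous_intros)
  also have "\<dots> = integral {0..1} (\<lambda>y. (1 / (K e)^5) * ((g y)^2 / (J e y)^3)
     + ((- 2 * G e / (K e)^6) * (g y / (J e y)^2) + ((G e)^2 / (K e)^7) * (1 / J e y)))"
  proof (rule integral_cong)
    fix y :: real assume y: "y \<in> {0..1}"
    show "(sol e (flow e y))^2 / (K e * J e y) = (1 / (K e)^5) * ((g y)^2 / (J e y)^3)
     + ((- 2 * G e / (K e)^6) * (g y / (J e y)^2) + ((G e)^2 / (K e)^7) * (1 / J e y))"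
      using K_ne[OF e] J_ne[OF e y]
      by (simp add: sol_def X_flow[OF e y] A_def field_simps eval_nat_numeral)
  qed
  also have "\<dots> = (1 / (K e)^5) * H e + ((- 2 * G e / (K e)^6) * G e + ((G e)^2 / (K e)^7) * K e)"
    by (rule integral_unique[OF has_integral_add[OF has_integral_mult_right[OF int(3)]
          has_integral_add[OF has_integral_mult_right[OF int(1)] has_integral_mult_right[OF int(2)]]]])
  also have "\<dots> = (H e - (G e)^2 / K e) / (K e)^5"
    using K_ne[OF e] by (simp add: field_simps eval_nat_numeral)
  finally show ?thesis .
qed

text \<open>Up to the factor \<open>K\<^sup>2 = dt/de\<close> this is the differential equation.  Along a path \<open>g/J\<close> solves the
  Riccati equation \<open>y' = y\<^sup>2\<close>, the motion of the particles yields the transport term, and the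
  derivatives of \<open>K\<close> and \<open>G\<close> complete the square \<open>A\<^sup>2\<close> up to a term independent of \<open>Z\<close>,
  which is minus twice the integral of the square.\<close>

lemma sol_deriv_e:
  assumes e: "e \<in> I" and Z: "Z \<in> {0..1}"
  shows "((\<lambda>e. sol e Z) has_real_derivative
      (K e)^2 * ((sol e Z)^2 - integral {0..Z} (sol e) * sol_Z e Z - 2 * integral {0..1} (\<lambda>z. (sol e z)^2)))
     (at e within I)"
proof -
  define x where "x = X e Z"
  have x: "x \<in> {0..1}" using X_in[OF e Z] by (simp add: x_def)
  define y' where "y' = (if Z = 0 then 0 else g' x * (- flow_e e x * (K e * J e x)))"
  have gX: "((\<lambda>e. g (X e Z)) has_real_derivative y') (at e within I)"
  proof (cases "Z = 0")
    case True
    have "((\<lambda>e. g (X e Z)) has_real_derivative 0) (at e within I)"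
      by (rule has_field_derivative_transform_within[OF DERIV_const[of "g 0"] zero_less_one e])
        (simp add: True X_0)
    then show ?thesis by (simp add: True y'_def)
  next
    case False
    then have "Z \<in> {0<..1}" using Z by auto
    from DERIV_chain_within[OF g_deriv[OF X_pos[OF e this]] X_deriv_e[OF e Z] X_in[OF _ Z]]
    show ?thesis using False by (simp add: y'_def x_def)
  qed
  have nz: "1 - e * g (X e Z) \<noteq> 0" "K e \<noteq> 0" "J e x \<noteq> 0"
    using J_ne[OF e X_in[OF e Z]] K_ne[OF e] by (simp_all add: J_def x_def)
  have y'u: "y' / (J e x)^2 / (K e)^2 = - ((K e)^2 * (integral {0..Z} (sol e) * sol_Z e Z))"
  proof (cases "Z = 0")
    case False
    have "integral {0..Z} (sol e) = flow_e e x / (K e)^2"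
      using integral_sol[OF e x] flow_X[OF e Z] by (simp add: x_def)
    then show ?thesis using False nz
      by (simp add: y'_def sol_Z_def x_def[symmetric] field_simps eval_nat_numeral)
  qed (simp add: y'_def)
  have d1: "((\<lambda>e. g (X e Z) / (1 - e * g (X e Z))) has_real_derivative (y' + (g x)^2) / (J e x)^2) (at e within I)"
    using riccati_quotient_derivative[OF gX nz(1)] by (simp add: J_def x_def)
  have d2: "((\<lambda>e. G e / K e) has_real_derivative (2 * H e * K e - G e * G e) / (K e * K e)) (at e within I)"
    by (rule DERIV_divide[OF G_deriv[OF e] K_deriv[OF e] nz(2)])
  have d3: "((\<lambda>e. (K e)^2) has_real_derivative 2 * K e * G e) (at e within I)"
    by (rule DERIV_cong[OF DERIV_power[OF K_deriv[OF e], of 2]]) simp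
  let ?N = "g x / J e x - G e / K e"
  let ?N' = "(y' + (g x)^2) / (J e x)^2 - (2 * H e * K e - G e * G e) / (K e * K e)"
  have D: "((\<lambda>e. (g (X e Z) / (1 - e * g (X e Z)) - G e / K e) / (K e)^2) has_real_derivative
     (?N' * (K e)^2 - ?N * (2 * K e * G e)) / ((K e)^2 * (K e)^2)) (at e within I)"
    using DERIV_divide[OF DERIV_diff[OF d1 d2] d3] nz by (simp add: J_def x_def)
  have E: "(?N' * (K e)^2 - ?N * (2 * K e * G e)) / ((K e)^2 * (K e)^2)
    = y' / (J e x)^2 / (K e)^2 + (K e)^2 * ((sol e Z)^2 - 2 * ((H e - (G e)^2 / K e) / (K e)^5))"
    using nz unfolding sol_def A_def x_def[symmetric]
    by (simp add: field_simps eval_nat_numeral)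
  have alg: "- (k * i) + k * (a - w) = k * (a - i - w)" for k i a w :: real
    by (simp add: algebra_simps)
  show ?thesis
    using D unfolding E y'u alg integral_sol_square[OF e, symmetric]
    by (simp add: sol_def[abs_def] A_def J_def)
qed

lemma sol_initial: assumes "Z \<in> {0..1}" shows "sol 0 Z = g Z"
proof -
  have J0: "J 0 x = 1" for x by (simp add: J_def)
  have K0: "K 0 = 1" by (simp add: K_def J0)
  have "flow 0 Z = Z" using assms by (simp add: flow_def R_def J0 K0)
  then have "X 0 Z = Z" using X_flow[OF zero_in_I assms] by simp
  then show ?thesis by (simp add: sol_def A_def J0 K0 G_def g_mean)
qed

theorem explicit_solution:
  assumes E: "\<And>t. t \<in> {0..<T} \<Longrightarrow> E t \<in> I" "E 0 = 0"
    and dE: "\<And>t. t \<in> {0..<T} \<Longrightarrow> (E has_real_derivative 1 / (K (E t))^2) (at t within {0..<T})"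
  shows "solution_with T g (\<lambda>t. sol (E t))
     (\<lambda>t Z. (sol (E t) Z)^2 - integral {0..Z} (sol (E t)) * sol_Z (E t) Z
       - 2 * integral {0..1} (\<lambda>z. (sol (E t) z)^2)) (\<lambda>t. sol_Z (E t))"
  unfolding solution_with_def
proof (intro conjI ballI)
  have cE: "continuous_on {0..<T} E" by (rule DERIV_continuous_on[OF dE])
  have cE2: "continuous_on ({0..<T} \<times> U) (\<lambda>x. (E (fst x), snd x))" for U :: "real set"
    by (intro continuous_intros continuous_on_compose2[OF cE]) auto
  have csol: "continuous_on ({0..<T} \<times> {0..1}) (\<lambda>x. sol (E (fst x)) (snd x))"
    by (rule continuous_on_compose2[OF sol_joint_cont cE2, unfolded fst_conv snd_conv]) (use E(1) in auto)
  then show "continuous_on ({0..<T} \<times> {0..1}) (\<lambda>(t, Z). sol (E t) Z)" by (simp add: split_beta)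
  have csZ: "continuous_on ({0..<T} \<times> {0<..1}) (\<lambda>x. sol_Z (E (fst x)) (snd x))"
    by (rule continuous_on_compose2[OF sol_Z_joint_cont cE2, unfolded fst_conv snd_conv]) (use E(1) in auto)
  then show "continuous_on ({0..<T} \<times> {0<..1}) (\<lambda>(t, Z). sol_Z (E t) Z)" by (simp add: split_beta)
  have sub: "{0..<T} \<times> {0<..1} \<subseteq> {0..<T} \<times> {0..1::real}" by auto
  have cu: "continuous_on ({0..<T} \<times> {0..1}) (\<lambda>x. integral {0..snd x} (sol (E (fst x))))"
    using continuous_on_integral_upper[of "{0..<T}" "\<lambda>t. sol (E t)"] csol by (simp add: split_beta)
  have "continuous_on ({0..<T} \<times> cbox 0 1) (\<lambda>(t, z). (sol (E t) z)^2)"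
    unfolding split_beta by (intro continuous_intros) (use csol in simp)
  then have "continuous_on {0..<T} (\<lambda>t. integral (cbox 0 1) (\<lambda>z. (sol (E t) z)^2))"
    by (rule integral_continuous_on_param)
  then have ck: "continuous_on ({0..<T} \<times> {0<..1::real}) (\<lambda>x. integral {0..1} (\<lambda>z. (sol (E (fst x)) z)^2))"
    by (auto intro!: continuous_on_compose2[of "{0..<T}" _ _ fst] continuous_intros)
  show "continuous_on ({0..<T} \<times> {0<..1}) (\<lambda>(t, Z). (sol (E t) Z)^2
     - integral {0..Z} (sol (E t)) * sol_Z (E t) Z - 2 * integral {0..1} (\<lambda>z. (sol (E t) z)^2))"
    unfolding split_beta
    by (intro continuous_intros csZ ck continuous_on_subset[OF csol sub] continuous_on_subset[OF cu sub])
  show "((\<lambda>s. sol (E s) Z) has_real_derivative (sol (E t) Z)^2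
     - integral {0..Z} (sol (E t)) * sol_Z (E t) Z - 2 * integral {0..1} (\<lambda>z. (sol (E t) z)^2))
     (at t within {0..<T})" if t: "t \<in> {0..<T}" and Z: "Z \<in> {0..1}" for t Z
    using DERIV_chain_within[OF sol_deriv_e[OF E(1)[OF t] Z] dE[OF t] E(1)] K_ne[OF E(1)[OF t]] by simp
  show "(sol (E t) has_real_derivative sol_Z (E t) Z) (at Z within {0..1})"
    if "t \<in> {0..<T}" "Z \<in> {0<..1}" for t Z by (rule sol_deriv_Z[OF E(1)[OF that(1)] that(2)])
  show "integral {0..1} (sol (E t)) = 0" if "t \<in> {0..<T}" for t
    by (rule integral_sol_total[OF E(1)[OF that]])
  show "sol (E 0) Z = g Z" if "Z \<in> {0..1}" for Z using sol_initial[OF that] E by simp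
qed auto

end

section \<open>Uniqueness\<close>

lemma DERIV_within_nonpos_imp_le:
  fixes f :: "real \<Rightarrow> real"
  assumes "a \<le> b" "\<And>x. x \<in> {a..b} \<Longrightarrow> (f has_real_derivative f' x) (at x within {a..b})"
    and "\<And>x. x \<in> {a..b} \<Longrightarrow> f' x \<le> 0"
  shows "f b \<le> f a"
proof -
  obtain x where "x \<in> {a..b}" "f b - f a = f' x * (b - a)"
    using mvt_very_simple[OF assms(1), of f "\<lambda>x. (*) (f' x)"] assms(2)
    by (auto simp: has_field_derivative_def)
  moreover from this have "f' x * (b - a) \<le> 0"
    using assms by (intro mult_nonpos_nonneg) auto
  ultimately show ?thesis by simp
qed

text \<open>The function \<open>exp (- C t) \<integral>\<^sub>0\<^sup>t E\<close> starts at zero and is nonincreasing.\<close>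

lemma gronwall_zero:
  fixes E :: "real \<Rightarrow> real"
  assumes cont: "continuous_on {0..b} E" and nonneg: "\<And>t. t \<in> {0..b} \<Longrightarrow> 0 \<le> E t" and "0 \<le> C"
    and le: "\<And>t. t \<in> {0..b} \<Longrightarrow> E t \<le> C * integral {0..t} E" and t: "t \<in> {0..b}"
  shows "E t = 0"
proof -
  define F where "F t = integral {0..t} E" for t
  have "exp (- C * t) * F t \<le> exp (- C * 0) * F 0"
  proof (rule DERIV_within_nonpos_imp_le[where f = "\<lambda>t. exp (- C * t) * F t"
        and f' = "\<lambda>t. exp (- C * t) * (E t - C * F t)"])
    fix x assume x: "x \<in> {0..t}"
    have dF: "(F has_real_derivative E x) (at x within {0..t})"
      unfolding F_def[abs_def]
      by (rule integral_has_real_derivative[OF continuous_on_subset[OF cont]]) (use t x in auto)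
    have dE: "((\<lambda>t. exp (- C * t)) has_real_derivative - C * exp (- C * x)) (at x within {0..t})"
      by (auto intro!: derivative_eq_intros)
    show "((\<lambda>t. exp (- C * t) * F t) has_real_derivative exp (- C * x) * (E x - C * F x)) (at x within {0..t})"
      by (rule DERIV_cong[OF DERIV_mult[OF dE dF]]) (simp add: algebra_simps)
    show "exp (- C * x) * (E x - C * F x) \<le> 0"
      using le[of x] x t by (auto simp: F_def mult_nonneg_nonpos)
  qed (use t in auto)
  then have "exp (- C * t) * F t \<le> 0" by (simp add: F_def)
  then have "F t \<le> 0" by (simp add: mult_le_0_iff)
  then have "C * F t \<le> 0" using \<open>0 \<le> C\<close> by (simp add: mult_nonneg_nonpos)
  then show ?thesis using le[OF t] nonneg[OF t] by (simp add: F_def)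
qed

text \<open>The Cauchy-Schwarz inequality, from \<open>\<integral> (f - m)\<^sup>2 \<ge> 0\<close> with the mean value \<open>m\<close> of \<open>f\<close>.\<close>

lemma integral_square_le:
  fixes f :: "real \<Rightarrow> real"
  assumes "continuous_on {0..Z} f" "0 < Z"
  shows "(integral {0..Z} f)^2 \<le> Z * integral {0..Z} (\<lambda>z. (f z)^2)"
proof -
  define m where "m = integral {0..Z} f / Z"
  have 1: "(f has_integral Z * m) {0..Z}"
    using integrable_integral[OF integrable_continuous_real[OF assms(1)]] assms(2) by (simp add: m_def)
  have 2: "((\<lambda>z. (f z)^2) has_integral integral {0..Z} (\<lambda>z. (f z)^2)) {0..Z}"
    by (intro integrable_integral integrable_continuous_real continuous_intros assms)
  have 3: "((\<lambda>z. m^2) has_integral Z * m^2) {0..Z}"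
    using has_integral_const_real[of "m^2" 0 Z] assms(2) by simp
  have "((\<lambda>z. ((f z)^2 - (2 * m) * f z) + m^2) has_integral
      (integral {0..Z} (\<lambda>z. (f z)^2) - (2 * m) * (Z * m)) + Z * m^2) {0..Z}"
    by (intro has_integral_add has_integral_diff has_integral_mult_right 1 2 3)
  then have "0 \<le> (integral {0..Z} (\<lambda>z. (f z)^2) - (2 * m) * (Z * m)) + Z * m^2"
  proof (rule has_integral_nonneg)
    fix z show "0 \<le> ((f z)^2 - (2 * m) * f z) + m^2"
      using zero_le_power2[of "f z - m"] by (simp add: power2_eq_square algebra_simps)
  qed
  then have "Z * (Z * m^2) \<le> Z * integral {0..Z} (\<lambda>z. (f z)^2)"
    using assms(2) by (simp add: power2_eq_square algebra_simps)
  moreover have "(integral {0..Z} f)^2 = Z * (Z * m^2)"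
    using assms(2) by (simp add: m_def power2_eq_square)
  ultimately show ?thesis by simp
qed

lemma continuous_on_compact_bound:
  fixes f :: "'a::topological_space \<Rightarrow> real"
  assumes "compact S" "continuous_on S f"
  obtains B where "0 < B" "\<And>x. x \<in> S \<Longrightarrow> \<bar>f x\<bar> \<le> B"
proof -
  from compact_imp_bounded[OF compact_continuous_image[OF assms(2,1)]]
  obtain B where "0 < B" "\<forall>y\<in>f ` S. norm y \<le> B" by (auto simp: bounded_pos)
  then show ?thesis by (intro that[of B]) auto
qed

lemma abs_integral_le_bound:
  fixes f :: "real \<Rightarrow> real"
  assumes "continuous_on {0..1} f" "\<And>z. z \<in> {0..1} \<Longrightarrow> \<bar>f z\<bar> \<le> B" "r \<in> {0..1}"
  shows "\<bar>integral {0..r} f\<bar> \<le> B * r"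
  using integral_bound[of 0 r f B] continuous_on_subset[OF assms(1), of "{0..r}"] assms by auto

lemma solution_with_continuous:
  assumes "solution_with T g a a_t a_Z" "U \<subseteq> {0..<T}"
  shows "continuous_on (U \<times> {0..1}) (\<lambda>x. a (fst x) (snd x))"
    and "continuous_on (U \<times> {0<..1}) (\<lambda>x. a_t (fst x) (snd x))"
    and "continuous_on (U \<times> {0<..1}) (\<lambda>x. a_Z (fst x) (snd x))"
  using assms by (auto simp: solution_with_def split_beta elim!: continuous_on_subset)

text \<open>The difference \<open>d = a - b\<close> is measured in \<open>L\<^sup>2(r, 1)\<close> with \<open>r > 0\<close>, since nothing is known about
  \<open>b_Z\<close> near \<open>0\<close>.  The transport term \<open>2 u d d_Z\<close> is integrated by parts; the boundary term at \<open>r\<close>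
  is of order \<open>r\<close> because the velocity \<open>u\<close> of \<open>b\<close> vanishes at \<open>0\<close>.  The difference \<open>W\<close> of the
  velocities satisfies \<open>W\<^sup>2 \<le> Z E\<close> with \<open>E = \<integral>\<^sub>0\<^sup>1 d\<^sup>2\<close>, so \<open>2 |W a_Z d| \<le> C (Z powr (2p-1) E + d\<^sup>2)\<close>, and the
  weight is integrable as \<open>p > 0\<close>.  Finally, \<open>d\<close> has mean zero, so the nonlocal term only sees
  \<open>\<integral>\<^sub>0\<^sup>r d\<close> and is of order \<open>r\<close> as well.\<close>

lemma solution_energy_estimate:
  fixes a b :: "real \<Rightarrow> real \<Rightarrow> real"
  assumes a: "solution_with Ta g a a_t a_Z" and b: "solution_with Tb g b b_t b_Z"
    and t1: "0 \<le> t1" "t1 < Ta" "t1 < Tb" and p: "0 < p"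
    and aZ: "\<And>t Z. t \<in> {0..t1} \<Longrightarrow> Z \<in> {0<..1} \<Longrightarrow> \<bar>a_Z t Z\<bar> \<le> C * Z powr (p - 1)" and C: "0 \<le> C"
    and B: "0 < B" "\<And>t Z. t \<in> {0..t1} \<Longrightarrow> Z \<in> {0..1} \<Longrightarrow> \<bar>a t Z\<bar> \<le> B"
      "\<And>t Z. t \<in> {0..t1} \<Longrightarrow> Z \<in> {0..1} \<Longrightarrow> \<bar>b t Z\<bar> \<le> B"
    and t: "t \<in> {0..t1}" and r: "0 < r" "r < 1"
  shows "((\<lambda>t. integral {r..1} (\<lambda>z. (a t z - b t z)^2)) has_real_derivative
      integral {r..1} (\<lambda>z. 2 * (a t z - b t z) * (a_t t z - b_t t z))) (at t within {0..t1})"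
    and "integral {r..1} (\<lambda>z. 2 * (a t z - b t z) * (a_t t z - b_t t z))
      \<le> (5 * B + C + C / (2 * p)) * integral {0..1} (\<lambda>z. (a t z - b t z)^2) + 12 * B^3 * r"
proof -
  let ?U = "{0..t1}"
  have Ua: "?U \<subseteq> {0..<Ta}" and Ub: "?U \<subseteq> {0..<Tb}" using t1 by auto
  note A = a[unfolded solution_with_def] and Bs = b[unfolded solution_with_def]
  note ca = solution_with_continuous(1)[OF a Ua] and cb = solution_with_continuous(1)[OF b Ub]
  note cat = solution_with_continuous(2)[OF a Ua] and caZ = solution_with_continuous(3)[OF a Ua]
    and cbt = solution_with_continuous(2)[OF b Ub] and cbZ = solution_with_continuous(3)[OF b Ub]
  have rs: "{r..1} \<subseteq> {0..1}" "{r..1} \<subseteq> {0<..1}" using r by auto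
  have rp: "?U \<times> {r..1} \<subseteq> ?U \<times> {0..1}" "?U \<times> {r..1} \<subseteq> ?U \<times> {0<..1}" using r by auto
  have box: "cbox r 1 = {r..1}" by simp
  show "((\<lambda>t. integral {r..1} (\<lambda>z. (a t z - b t z)^2)) has_real_derivative
      integral {r..1} (\<lambda>z. 2 * (a t z - b t z) * (a_t t z - b_t t z))) (at t within ?U)"
    unfolding box[symmetric]
  proof (rule leibniz_rule_field_derivative[OF _ _ _ t])
    fix s z assume sz: "s \<in> ?U" "z \<in> cbox r 1"
    have "((\<lambda>s. a s z) has_real_derivative a_t s z) (at s within ?U)"
      by (rule DERIV_subset[OF _ Ua]) (use A sz r t1 in auto)
    moreover have "((\<lambda>s. b s z) has_real_derivative b_t s z) (at s within ?U)"
      by (rule DERIV_subset[OF _ Ub]) (use Bs sz r t1 in auto)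
    ultimately have "((\<lambda>s. a s z - b s z) has_real_derivative a_t s z - b_t s z) (at s within ?U)"
      by (rule DERIV_diff)
    from DERIV_power[OF this, of 2]
    show "((\<lambda>s. (a s z - b s z)^2) has_real_derivative 2 * (a s z - b s z) * (a_t s z - b_t s z)) (at s within ?U)"
      by (rule DERIV_cong) simp
  next
    fix s assume "s \<in> ?U"
    then show "(\<lambda>z. (a s z - b s z)^2) integrable_on cbox r 1"
      by (intro integrable_continuous continuous_intros continuous_on_subset[OF continuous_on_slice[OF ca]]
          continuous_on_subset[OF continuous_on_slice[OF cb]]) (use rs in auto)
  next
    show "continuous_on (?U \<times> cbox r 1) (\<lambda>(s, z). 2 * (a s z - b s z) * (a_t s z - b_t s z))"
      unfolding split_beta box
      by (intro continuous_intros continuous_on_subset[OF ca rp(1)] continuous_on_subset[OF cb rp(1)]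
          continuous_on_subset[OF cat rp(2)] continuous_on_subset[OF cbt rp(2)])
  qed auto
  have cat1: "continuous_on {0..1} (a t)" and cbt1: "continuous_on {0..1} (b t)"
    using continuous_on_slice[OF ca t] continuous_on_slice[OF cb t] by auto
  have s1: "continuous_on {r..1} (a t)" "continuous_on {r..1} (b t)"
    using cat1 cbt1 rs(1) by (auto elim: continuous_on_subset)
  have s2: "continuous_on {r..1} (a_t t)" "continuous_on {r..1} (b_t t)"
    "continuous_on {r..1} (a_Z t)" "continuous_on {r..1} (b_Z t)"
    by (rule continuous_on_subset[OF continuous_on_slice[OF cat t] rs(2)]
      continuous_on_subset[OF continuous_on_slice[OF cbt t] rs(2)]
      continuous_on_subset[OF continuous_on_slice[OF caZ t] rs(2)]
      continuous_on_subset[OF continuous_on_slice[OF cbZ t] rs(2)])+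
  \<comment> \<open>With \<open>u\<close> the velocity belonging to \<open>b\<close>, \<open>u\<^sub>a a_Z - u b_Z = W a_Z + u d_Z\<close>; only \<open>a_Z\<close> is multiplied by \<open>W\<close>.\<close>
  define d where "d z = a t z - b t z" for z
  define u where "u Z = integral {0..Z} (b t)" for Z
  define W where "W Z = integral {0..Z} d" for Z
  define E where "E = integral {0..1} (\<lambda>z. (d z)^2)"
  define k where "k = 2 * integral {0..1} (\<lambda>z. (a t z)^2) - 2 * integral {0..1} (\<lambda>z. (b t z)^2)"
  have cd: "continuous_on {0..1} d" unfolding d_def by (intro continuous_intros cat1 cbt1)
  have du: "(u has_real_derivative b t z) (at z within {0..1})" if "z \<in> {0..1}" for z
    unfolding u_def[abs_def] by (rule integral_has_real_derivative[OF cbt1 that])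
  have dW: "(W has_real_derivative d z) (at z within {0..1})" if "z \<in> {0..1}" for z
    unfolding W_def[abs_def] by (rule integral_has_real_derivative[OF cd that])
  have cu: "continuous_on {r..1} u" and cW: "continuous_on {r..1} W" and cdr: "continuous_on {r..1} d"
    using DERIV_continuous_on[OF du] DERIV_continuous_on[OF dW] cd rs(1) by (auto elim: continuous_on_subset)
  have W_eq: "integral {0..z} (a t) - integral {0..z} (b t) = W z" if "z \<in> {0..1}" for z
    unfolding W_def d_def
    by (subst integral_diff) (use that in \<open>auto intro!: integrable_continuous_real
          continuous_on_subset[OF cat1] continuous_on_subset[OF cbt1]\<close>)
  have pde: "2 * d z * (a_t t z - b_t t z) + (b t z * (d z)^2 + 2 * u z * d z * (a_Z t z - b_Z t z))
     = (2 * (a t z + b t z) * (d z)^2 + b t z * (d z)^2 - 2 * W z * a_Z t z * d z) - 2 * k * d z"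
    if z: "z \<in> {0..1}" for z
  proof -
    define ua where "ua = integral {0..z} (a t)"
    have ea: "a_t t z = (a t z)^2 - ua * a_Z t z - 2 * integral {0..1} (\<lambda>z. (a t z)^2)"
      using A t z t1 unfolding ua_def by (auto simp: algebra_simps)
    have eb: "b_t t z = (b t z)^2 - u z * b_Z t z - 2 * integral {0..1} (\<lambda>z. (b t z)^2)"
      using Bs t z t1 unfolding u_def by (auto simp: algebra_simps)
    have w: "W z = ua - u z" using W_eq[OF z] by (simp add: ua_def u_def)
    show ?thesis unfolding ea eb w k_def d_def by (simp add: algebra_simps power2_eq_square)
  qed
  have bd: "\<bar>d z\<bar> \<le> 2 * B" if "z \<in> {0..1}" for z
    using B(2)[OF t that] B(3)[OF t that] by (simp add: d_def)
  have E0: "0 \<le> E" unfolding E_def by (intro integral_nonneg integrable_continuous_real continuous_intros cd) auto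
  have Erle: "integral {r..1} (\<lambda>z. (d z)^2) \<le> E"
    unfolding E_def by (rule integral_subset_le) (use rs cd cdr in \<open>auto intro!: integrable_continuous_real continuous_intros\<close>)
  have Wd: "2 * \<bar>W z\<bar> * \<bar>a_Z t z\<bar> * \<bar>d z\<bar> \<le> C * (z powr (2 * p - 1) * E + (d z)^2)" if z: "z \<in> {r..1}" for z
  proof -
    have z0: "0 < z" "z \<le> 1" using z r by auto
    have "(W z)^2 \<le> z * integral {0..z} (\<lambda>z. (d z)^2)"
      unfolding W_def by (rule integral_square_le) (use z0 cd in \<open>auto elim: continuous_on_subset\<close>)
    also have "\<dots> \<le> z * E" unfolding E_def
      by (intro mult_left_mono integral_subset_le) (use z0 cd in \<open>auto intro!: integrable_continuous_real continuous_intros elim: continuous_on_subset\<close>)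
    finally have W2: "(W z)^2 \<le> z * E" .
    define q where "q = z powr (p - 1)"
    have q: "q^2 * z = z powr (2 * p - 1)"
    proof -
      have "q^2 * z = z powr (p - 1) * z powr (p - 1) * z powr 1" using z0 by (simp add: q_def power2_eq_square)
      also have "\<dots> = z powr ((p - 1) + (p - 1) + 1)" by (simp only: powr_add)
      also have "(p - 1) + (p - 1) + 1 = 2 * p - 1" by simp
      finally show ?thesis .
    qed
    have "2 * \<bar>W z\<bar> * \<bar>a_Z t z\<bar> * \<bar>d z\<bar> \<le> 2 * \<bar>W z\<bar> * (C * q) * \<bar>d z\<bar>"
      using aZ[OF t, of z] z0 by (intro mult_right_mono mult_left_mono) (auto simp: q_def)
    also have "\<dots> = C * (2 * (q * \<bar>W z\<bar>) * \<bar>d z\<bar>)" by simp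
    also have "\<dots> \<le> C * ((q * \<bar>W z\<bar>)^2 + \<bar>d z\<bar>^2)"
      using C sum_squares_bound[of "q * \<bar>W z\<bar>" "\<bar>d z\<bar>"] by (intro mult_left_mono) auto
    also have "\<dots> \<le> C * (q^2 * (z * E) + (d z)^2)"
      using C mult_left_mono[OF W2, of "q^2"] by (intro mult_left_mono) (auto simp: power_mult_distrib)
    finally show ?thesis using q by (simp add: mult.assoc[symmetric])
  qed
  have dd: "(d has_real_derivative a_Z t z - b_Z t z) (at z within {r..1})" if "z \<in> {r..1}" for z
    unfolding d_def[abs_def]
    by (rule DERIV_diff; rule DERIV_subset[OF _ rs(1)]) (use A Bs t t1 that r in auto)
  have parts: "((\<lambda>z. b t z * (d z)^2 + 2 * u z * d z * (a_Z t z - b_Z t z)) has_integral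
      u 1 * (d 1)^2 - u r * (d r)^2) {r..1}"
  proof (rule fundamental_theorem_of_calculus)
    fix z assume z: "z \<in> {r..1}"
    then have "z \<in> {0..1}" using r by auto
    note d1 = DERIV_subset[OF du[OF this] rs(1)]
    have "((\<lambda>z. u z * (d z)^2) has_real_derivative
        b t z * (d z)^2 + 2 * u z * d z * (a_Z t z - b_Z t z)) (at z within {r..1})"
      by (rule DERIV_cong[OF DERIV_mult[OF d1 DERIV_power[OF dd[OF z], of 2]]]) simp
    then show "((\<lambda>z. u z * (d z)^2) has_vector_derivative
        b t z * (d z)^2 + 2 * u z * d z * (a_Z t z - b_Z t z)) (at z within {r..1})"
      by (simp add: has_real_derivative_iff_has_vector_derivative)
  qed (use r in auto)
  have u1: "u 1 = 0" using Bs t t1 by (simp add: u_def)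
  have ur: "\<bar>u r\<bar> \<le> B * r"
    unfolding u_def using abs_integral_le_bound[OF cbt1 B(3)[OF t], of r] r by simp
  have part_bound: "- (u 1 * (d 1)^2 - u r * (d r)^2) \<le> 4 * B^3 * r"
  proof -
    have "\<bar>d r\<bar>^2 \<le> (2 * B)^2" using bd[of r] r by (intro power_mono) auto
    then have "\<bar>u r\<bar> * (d r)^2 \<le> (B * r) * (2 * B)^2"
      using ur B(1) r by (intro mult_mono) auto
    moreover have "u r * (d r)^2 \<le> \<bar>u r\<bar> * (d r)^2" by (intro mult_right_mono) auto
    ultimately show ?thesis using u1 by (simp add: power2_eq_square power3_eq_cube algebra_simps)
  qed
  have kB: "\<bar>k\<bar> \<le> 2 * B^2"
  proof -
    have sq: "0 \<le> integral {0..1} (\<lambda>z. (f z)^2) \<and> integral {0..1} (\<lambda>z. (f z)^2) \<le> B^2"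
      if "continuous_on {0..1} f" "\<And>z. z \<in> {0..1} \<Longrightarrow> \<bar>f z\<bar> \<le> B" for f :: "real \<Rightarrow> real"
    proof
      show "0 \<le> integral {0..1} (\<lambda>z. (f z)^2)"
        by (intro integral_nonneg integrable_continuous_real continuous_intros that) auto
      have "\<bar>integral {0..1} (\<lambda>z. (f z)^2)\<bar> \<le> B^2 * 1"
        by (rule abs_integral_le_bound) (use that B(1) in \<open>auto intro!: continuous_intros simp: abs_le_square_iff[symmetric]\<close>)
      then show "integral {0..1} (\<lambda>z. (f z)^2) \<le> B^2" by simp
    qed
    show ?thesis using sq[OF cat1 B(2)[OF t]] sq[OF cbt1 B(3)[OF t]] unfolding k_def by linarith
  qed
  have W1: "W 1 = 0" using W_eq[of 1] A Bs t t1 by simp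
  have dint: "(d has_integral - W r) {r..1}"
    using fundamental_theorem_of_calculus[of r 1 W d] dW DERIV_subset[OF dW rs(1)] r W1
    by (simp add: has_real_derivative_iff_has_vector_derivative)
  have Wr: "\<bar>W r\<bar> \<le> 2 * B * r"
    unfolding W_def using abs_integral_le_bound[OF cd bd, of r] r by simp
  have kW: "2 * k * W r \<le> 8 * B^3 * r"
  proof -
    have "\<bar>k\<bar> * \<bar>W r\<bar> \<le> (2 * B^2) * (2 * B * r)" using kB Wr B(1) by (intro mult_mono) auto
    then have "\<bar>k * W r\<bar> \<le> 4 * B^3 * r" by (simp add: abs_mult power2_eq_square power3_eq_cube algebra_simps)
    then show ?thesis unfolding mult.assoc by linarith
  qed
  let ?f = "\<lambda>z. 2 * (a t z + b t z) * (d z)^2 + b t z * (d z)^2 - 2 * W z * a_Z t z * d z"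
  have fint: "(?f has_integral integral {r..1} ?f) {r..1}"
    by (intro integrable_integral integrable_continuous_real continuous_intros s1 s2 cdr cW)
  have pint: "((\<lambda>z. z powr (2 * p - 1)) has_integral (1 powr (2 * p) / (2 * p) - r powr (2 * p) / (2 * p))) {r..1}"
  proof (rule fundamental_theorem_of_calculus)
    fix z assume "z \<in> {r..1}"
    then have "((\<lambda>z. z powr (2 * p)) has_real_derivative (2 * p) * z powr (2 * p - 1)) (at z within {r..1})"
      using r by (intro DERIV_subset[OF has_real_derivative_powr]) auto
    from DERIV_cdivide[OF this, of "2 * p"]
    show "((\<lambda>z. z powr (2 * p) / (2 * p)) has_vector_derivative z powr (2 * p - 1)) (at z within {r..1})"
      using p by (simp add: has_real_derivative_iff_has_vector_derivative)
  qed (use r in auto)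
  have d2int: "((\<lambda>z. (d z)^2) has_integral integral {r..1} (\<lambda>z. (d z)^2)) {r..1}"
    by (intro integrable_integral integrable_continuous_real continuous_intros cdr)
  have fle: "integral {r..1} ?f \<le> (5 * B + C + C / (2 * p)) * E"
  proof -
    have "integral {r..1} ?f \<le> (5 * B + C) * integral {r..1} (\<lambda>z. (d z)^2)
        + (C * E) * (1 powr (2 * p) / (2 * p) - r powr (2 * p) / (2 * p))"
    proof (rule has_integral_le[OF fint has_integral_add[OF has_integral_mult_right[OF d2int] has_integral_mult_right[OF pint]]])
      fix z assume z: "z \<in> {r..1}"
      then have z01: "z \<in> {0..1}" using r by auto
      have "2 * (a t z + b t z) + b t z \<le> 5 * B"
        using B(2)[OF t z01] B(3)[OF t z01] by auto
      then have "(2 * (a t z + b t z) + b t z) * (d z)^2 \<le> 5 * B * (d z)^2" by (intro mult_right_mono) auto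
      moreover have "- (2 * W z * a_Z t z * d z) \<le> 2 * \<bar>W z\<bar> * \<bar>a_Z t z\<bar> * \<bar>d z\<bar>"
        using abs_ge_minus_self[of "2 * W z * a_Z t z * d z"] by (simp add: abs_mult)
      ultimately show "?f z \<le> (5 * B + C) * (d z)^2 + (C * E) * z powr (2 * p - 1)"
        using Wd[OF z] by (simp add: algebra_simps)
    qed
    also have "\<dots> \<le> (5 * B + C) * E + (C * E) * (1 / (2 * p))"
      using Erle B(1) C E0 p by (intro add_mono mult_left_mono) auto
    finally show ?thesis by (simp add: algebra_simps)
  qed
  have "((\<lambda>z. (?f z - 2 * k * d z) - (b t z * (d z)^2 + 2 * u z * d z * (a_Z t z - b_Z t z))) has_integral
      (integral {r..1} ?f - 2 * k * (- W r)) - (u 1 * (d 1)^2 - u r * (d r)^2)) {r..1}"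
    by (rule has_integral_diff[OF has_integral_diff[OF fint has_integral_mult_right[OF dint]] parts])
  then have "((\<lambda>z. 2 * d z * (a_t t z - b_t t z)) has_integral
      (integral {r..1} ?f - 2 * k * (- W r)) - (u 1 * (d 1)^2 - u r * (d r)^2)) {r..1}"
  proof (rule has_integral_eq[rotated])
    fix z assume "z \<in> {r..1}"
    then have "z \<in> {0..1}" using r by auto
    from pde[OF this] show "(?f z - 2 * k * d z) - (b t z * (d z)^2 + 2 * u z * d z * (a_Z t z - b_Z t z))
      = 2 * d z * (a_t t z - b_t t z)" by linarith
  qed
  then have "integral {r..1} (\<lambda>z. 2 * d z * (a_t t z - b_t t z))
      = (integral {r..1} ?f - 2 * k * (- W r)) - (u 1 * (d 1)^2 - u r * (d r)^2)"
    by (rule integral_unique)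
  also have "\<dots> \<le> (5 * B + C + C / (2 * p)) * E + 12 * B^3 * r"
    using fle part_bound kW by (simp add: algebra_simps)
  finally show "integral {r..1} (\<lambda>z. 2 * (a t z - b t z) * (a_t t z - b_t t z))
      \<le> (5 * B + C + C / (2 * p)) * integral {0..1} (\<lambda>z. (a t z - b t z)^2) + 12 * B^3 * r"
    by (simp add: d_def E_def)
qed

text \<open>The energy estimate is integrated in time; then \<open>r\<close> tends to \<open>0\<close> and Gronwall's inequality
  applies.\<close>

theorem solution_unique:
  fixes a b :: "real \<Rightarrow> real \<Rightarrow> real"
  assumes a: "solution_with Ta g a a_t a_Z" and b: "solution_with Tb g b b_t b_Z"
    and t1: "0 \<le> t1" "t1 < Ta" "t1 < Tb" and p: "0 < p"
    and aZ: "\<And>t Z. t \<in> {0..t1} \<Longrightarrow> Z \<in> {0<..1} \<Longrightarrow> \<bar>a_Z t Z\<bar> \<le> C * Z powr (p - 1)" and C: "0 \<le> C"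
    and Z: "Z \<in> {0..1}"
  shows "a t1 Z = b t1 Z"
proof -
  let ?U = "{0..t1}"
  have Ua: "?U \<subseteq> {0..<Ta}" and Ub: "?U \<subseteq> {0..<Tb}" using t1 by auto
  note A = a[unfolded solution_with_def] and Bs = b[unfolded solution_with_def]
  note ca = solution_with_continuous(1)[OF a Ua] and cb = solution_with_continuous(1)[OF b Ub]
  have cpt: "compact (?U \<times> {0..1::real})" by (intro compact_Times) auto
  obtain Ba where Ba: "0 < Ba" "\<And>x. x \<in> ?U \<times> {0..1} \<Longrightarrow> \<bar>a (fst x) (snd x)\<bar> \<le> Ba"
    using continuous_on_compact_bound[OF cpt ca] by blast
  obtain Bb where Bb: "0 < Bb" "\<And>x. x \<in> ?U \<times> {0..1} \<Longrightarrow> \<bar>b (fst x) (snd x)\<bar> \<le> Bb"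
    using continuous_on_compact_bound[OF cpt cb] by blast
  define B where "B = max Ba Bb"
  have B: "0 < B" "\<And>t Z. t \<in> ?U \<Longrightarrow> Z \<in> {0..1} \<Longrightarrow> \<bar>a t Z\<bar> \<le> B"
      "\<And>t Z. t \<in> ?U \<Longrightarrow> Z \<in> {0..1} \<Longrightarrow> \<bar>b t Z\<bar> \<le> B"
    using Ba(1) Ba(2)[of "(_, _)"] Bb(2)[of "(_, _)"] by (auto simp: B_def le_max_iff_disj)
  define E where "E t = integral {0..1} (\<lambda>z. (a t z - b t z)^2)" for t
  define C1 where "C1 = 5 * B + C + C / (2 * p)"
  have C1: "0 \<le> C1" using B(1) C p by (simp add: C1_def)
  have "continuous_on (?U \<times> cbox 0 1) (\<lambda>(t, z). (a t z - b t z)^2)"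
    unfolding split_beta by (intro continuous_intros) (use ca cb in auto)
  from integral_continuous_on_param[OF this] have cE: "continuous_on ?U E"
    by (simp add: E_def[abs_def])
  have cdt: "continuous_on {0..1} (\<lambda>z. a t z - b t z)" if "t \<in> ?U" for t
    by (intro continuous_intros continuous_on_slice[OF ca that] continuous_on_slice[OF cb that])
  have step: "E t \<le> C1 * integral {0..t} E + (12 * B^3 * t1 + 4 * B^2) * r"
    if t: "t \<in> ?U" and r: "0 < r" "r < 1" for t r
  proof -
    define Er where "Er t = integral {r..1} (\<lambda>z. (a t z - b t z)^2)" for t
    have tU: "{0..t} \<subseteq> ?U" using t by auto
    have "Er t - C1 * integral {0..t} E - 12 * B^3 * r * t \<le> Er 0 - C1 * integral {0..0} E - 12 * B^3 * r * 0"
    proof (rule DERIV_within_nonpos_imp_le[where f = "\<lambda>t. Er t - C1 * integral {0..t} E - 12 * B^3 * r * t"])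
      fix s assume s: "s \<in> {0..t}"
      then have sU: "s \<in> ?U" using tU by auto
      note en = solution_energy_estimate[OF a b t1 p aZ C B sU r]
      have "((\<lambda>t. integral {0..t} E) has_real_derivative E s) (at s within {0..t})"
        by (rule integral_has_real_derivative[OF continuous_on_subset[OF cE tU] s])
      from DERIV_diff[OF DERIV_diff[OF DERIV_subset[OF en(1) tU] DERIV_cmult[OF this]] DERIV_cmult[OF DERIV_ident]]
      show "((\<lambda>t. Er t - C1 * integral {0..t} E - 12 * B^3 * r * t) has_real_derivative
          integral {r..1} (\<lambda>z. 2 * (a s z - b s z) * (a_t s z - b_t s z)) - C1 * E s - 12 * B^3 * r * 1)
          (at s within {0..t})"
        unfolding Er_def .
      show "integral {r..1} (\<lambda>z. 2 * (a s z - b s z) * (a_t s z - b_t s z)) - C1 * E s - 12 * B^3 * r * 1 \<le> 0"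
        using en(2) by (simp add: C1_def E_def)
    qed (use t in auto)
    moreover have "Er 0 = 0"
    proof -
      have "Er 0 = integral {r..1} (\<lambda>z. 0)"
        unfolding Er_def by (rule integral_cong) (use A Bs r in auto)
      then show ?thesis by simp
    qed
    moreover have "E t \<le> Er t + 4 * B^2 * r"
    proof -
      have cd2: "continuous_on {0..1} (\<lambda>z. (a t z - b t z)^2)" by (intro continuous_intros cdt t)
      have "E t = integral {0..r} (\<lambda>z. (a t z - b t z)^2) + Er t"
        unfolding E_def Er_def
        by (rule Henstock_Kurzweil_Integration.integral_combine[symmetric]) (use r integrable_continuous_real[OF cd2] in auto)
      moreover have "\<bar>integral {0..r} (\<lambda>z. (a t z - b t z)^2)\<bar> \<le> (2 * B)^2 * r"
      proof (rule abs_integral_le_bound[OF cd2])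
        fix z :: real assume "z \<in> {0..1}"
        then have "\<bar>a t z - b t z\<bar> \<le> 2 * B" using B(2,3)[OF t, of z] by auto
        then have "\<bar>a t z - b t z\<bar>^2 \<le> (2 * B)^2" by (intro power_mono) auto
        then show "\<bar>(a t z - b t z)^2\<bar> \<le> (2 * B)^2" by simp
      qed (use r in auto)
      ultimately show ?thesis by (simp add: power_mult_distrib)
    qed
    moreover have "12 * B^3 * r * t \<le> 12 * B^3 * r * t1" using t r B(1) by (intro mult_left_mono) auto
    ultimately show ?thesis by (simp add: algebra_simps)
  qed
  have "E t1 = 0"
  proof (rule gronwall_zero[OF cE _ C1])
    show "0 \<le> E t" if "t \<in> ?U" for t
      unfolding E_def by (intro integral_nonneg integrable_continuous_real continuous_intros cdt that) auto
    show "E t \<le> C1 * integral {0..t} E" if t: "t \<in> ?U" for t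
    proof -
      have "((\<lambda>r. C1 * integral {0..t} E + (12 * B^3 * t1 + 4 * B^2) * r) \<longlongrightarrow>
          C1 * integral {0..t} E + (12 * B^3 * t1 + 4 * B^2) * 0) (at_right 0)"
        by (intro tendsto_intros)
      moreover have "\<forall>\<^sub>F r in at_right 0. E t \<le> C1 * integral {0..t} E + (12 * B^3 * t1 + 4 * B^2) * r"
        using eventually_at_right_real[OF zero_less_one] by eventually_elim (use step[OF t] in auto)
      ultimately show ?thesis
        using tendsto_lowerbound[of _ _ "at_right (0::real)" "E t"] by simp
    qed
  qed (use t1 in auto)
  moreover have "continuous_on {0..1} (\<lambda>z. (a t1 z - b t1 z)^2)"
    by (intro continuous_intros cdt) (use t1 in simp)
  ultimately have "(a t1 Z - b t1 Z)^2 = 0"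
    using integral_eq_0_iff[of 0 1 "\<lambda>z. (a t1 z - b t1 z)^2"] Z by (auto simp: E_def)
  then show ?thesis by simp
qed

section \<open>Cusped data: integrals near breakdown\<close>

text \<open>At \<open>0\<close> the conventions \<open>0 powr a = 0\<close> and \<open>1 / 0 = 0\<close> would spoil a pointwise bound; a single
  point does not change the integral.\<close>

lemma abs_integral_le_powr:
  fixes f :: "real \<Rightarrow> real"
  assumes f: "f integrable_on {0..1}" and q: "q < 1"
    and le: "\<And>x. x \<in> {0<..1} \<Longrightarrow> \<bar>f x\<bar> \<le> k * x powr (- q)"
  shows "\<bar>integral {0..1} f\<bar> \<le> k / (1 - q)"
proof -
  have P: "((\<lambda>x. k * x powr (-q)) has_integral k * (1 / (1 - q))) {0..1}"
    using has_integral_mult_right[OF has_integral_powr_from_0[of "-q" 1], of k] q by simp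
  have F: "((\<lambda>x. if x = 0 then 0 else f x) has_integral integral {0..1} f) {0..1}"
    by (rule has_integral_spike_finite[OF _ _ integrable_integral[OF f], of "{0}"]) auto
  have ab: "- (k * x powr (-q)) \<le> (if x = 0 then 0 else f x) \<and> (if x = 0 then 0 else f x) \<le> k * x powr (-q)"
    if "x \<in> {0..1}" for x using le[of x] that by (auto simp: abs_le_iff)
  have "integral {0..1} f \<le> k * (1 / (1 - q))"
    by (rule has_integral_le[OF F P]) (use ab in blast)
  moreover have "- (k * (1 / (1 - q))) \<le> integral {0..1} f"
    by (rule has_integral_le[OF has_integral_neg[OF P] F]) (use ab in blast)
  ultimately show ?thesis by simp
qed

lemma powr_interpolation:
  fixes a b J \<delta> :: real
  assumes "0 \<le> a" "a \<le> J" "0 \<le> b" "b \<le> J" "0 \<le> \<delta>" "\<delta> \<le> 1"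
  shows "a powr (1 - \<delta>) * b powr \<delta> \<le> J"
proof -
  have "a powr (1 - \<delta>) * b powr \<delta> \<le> J powr (1 - \<delta>) * J powr \<delta>"
    using assms by (intro mult_mono powr_mono2) auto
  also have "\<dots> = J powr 1" by (simp add: powr_add[symmetric])
  finally show ?thesis using assms by simp
qed

text \<open>For an exponent \<open>b \<ge> 1\<close> this is the mean value theorem.  Raising a smaller exponent to \<open>1\<close> can
  only move \<open>\<rho> powr b\<close> further away from \<open>1\<close>.\<close>

lemma abs_powr_minus_one_le:
  fixes \<rho> b N :: real
  assumes "0 < \<rho>" "\<rho> \<le> N" "1 \<le> N" "0 < b"
  shows "\<bar>\<rho> powr b - 1\<bar> \<le> max 1 b * N powr (max 1 b - 1) * \<bar>\<rho> - 1\<bar>"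
proof -
  define b' where "b' = max 1 b"
  have b': "1 \<le> b'" "b \<le> b'" by (auto simp: b'_def)
  have "\<bar>\<rho> powr b - 1\<bar> \<le> \<bar>\<rho> powr b' - 1\<bar>"
  proof (cases "1 \<le> \<rho>")
    case True
    then show ?thesis using powr_mono[of b b' \<rho>] ge_one_powr_ge_zero[of \<rho> b] b' assms by auto
  next
    case False
    then show ?thesis using powr_mono'[of b b' \<rho>] powr_le1[of b \<rho>] b' assms by auto
  qed
  also have "\<dots> \<le> b' * N powr (b' - 1) * \<bar>\<rho> - 1\<bar>"
  proof -
    let ?f = "\<lambda>y. y powr b'"
    have "norm (?f \<rho> - ?f 1) \<le> (b' * N powr (b' - 1)) * norm (\<rho> - 1)"
    proof (rule field_differentiable_bound[where S = "{0<..N}" and f' = "\<lambda>y. b' * y powr (b' - 1)"])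
      fix y assume y: "y \<in> {0<..N}"
      then show "(?f has_field_derivative b' * y powr (b' - 1)) (at y within {0<..N})"
        by (intro DERIV_subset[OF has_real_derivative_powr]) auto
      show "norm (b' * y powr (b' - 1)) \<le> b' * N powr (b' - 1)"
        using y b' by (auto simp: abs_mult intro!: mult_left_mono powr_mono2)
    qed (use assms in auto)
    then show ?thesis by simp
  qed
  finally show ?thesis by (simp add: b'_def)
qed

text \<open>The datum has its strict maximum at \<open>0\<close> and a cusp of order \<open>p\<close> there; \<open>\<delta>\<close> measures the relative
  size of the correction to the cusp, and \<open>p (1 + \<delta>) < 1\<close> makes \<open>x powr (-p(1+\<delta>))\<close>
  integrable.\<close>

locale cusp_datum = datum g g' M + profile_exponent p for g g' :: "real \<Rightarrow> real" and M p :: real +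
  fixes c m B \<delta> :: real
  assumes c_pos: "0 < c" and m_pos: "0 < m" and B_nonneg: "0 \<le> B"
    and d0: "0 < \<delta>" and d1: "\<delta> < 1" and d_int: "p * (1 + \<delta>) < 1"
    and g_0: "g 0 = M"
    and g_gap: "\<And>x. x \<in> {0..1} \<Longrightarrow> m * x powr p \<le> M - g x"
    and g_cusp: "\<And>x. x \<in> {0..1} \<Longrightarrow> \<bar>M - g x - c * x powr p\<bar> \<le> B * x powr (p * (1 + \<delta>))"
    and g'_bound: "\<And>x. x \<in> {0<..1} \<Longrightarrow> \<bar>g' x\<bar> \<le> B * x powr (p - 1)"
begin

text \<open>The distance to breakdown, written \<open>\<epsilon>\<close> in the explanations below; it equals \<open>J e 0\<close>.\<close>

definition eps :: "real \<Rightarrow> real" where "eps e = 1 - M * e"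
definition mu :: real where "mu = min 1 (m / M)"
definition cs :: real where "cs = c / M"

text \<open>The model for \<open>J\<close> near \<open>x = 0\<close> and \<open>e = 1/M\<close>.  It is exactly self-similar.\<close>

definition Jt :: "real \<Rightarrow> real \<Rightarrow> real" where "Jt e x = eps e + cs * x powr p"

text \<open>At \<open>e = 1/M\<close> the integrand \<open>1/J\<close> has an integrable singularity at \<open>0\<close>, so this is the limit of
  \<open>K\<close> at breakdown.\<close>

definition Ks :: real where "Ks = K (1 / M)"

lemma mu_pos: "0 < mu" and mu_le: "mu \<le> 1" using m_pos M_pos by (auto simp: mu_def)
lemma cs_pos: "0 < cs" using c_pos M_pos by (simp add: cs_def)

lemma eps_pos: "e \<in> I \<Longrightarrow> 0 < eps e"
  using M_pos by (auto simp: I_def eps_def field_simps)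

lemma eps_bounds: "e \<in> {0..1/M} \<Longrightarrow> 0 \<le> eps e \<and> eps e \<le> 1"
  using M_pos by (auto simp: eps_def field_simps)

lemma I_closed: "e \<in> I \<Longrightarrow> e \<in> {0..1/M}" by (auto simp: I_def)

lemma e_eps: "e = (1 - eps e) / M" using M_pos by (simp add: eps_def)

lemma J_eps: "J e x = eps e + e * (M - g x)" by (simp add: J_def eps_def algebra_simps)

lemma J_ge_eps: "e \<in> {0..1/M} \<Longrightarrow> x \<in> {0..1} \<Longrightarrow> eps e \<le> J e x"
  using g_le[of x] by (simp add: J_eps)

text \<open>Since \<open>e = (1 - \<epsilon>)/M\<close>, \<open>J = \<epsilon> + e (M - g)\<close> dominates the convex combination of \<open>1\<close> and
  \<open>(m/M) x\<^sup>p\<close> with weights \<open>\<epsilon>\<close> and \<open>1 - \<epsilon>\<close>.\<close>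

lemma J_ge_powr:
  assumes "e \<in> {0..1/M}" "x \<in> {0..1}" shows "mu * x powr p \<le> J e x"
proof -
  define w where "w = x powr p"
  have w: "0 \<le> w" "w \<le> 1" using assms p0 by (auto simp: w_def powr_le1)
  note ep = eps_bounds[OF assms(1)]
  have "eps e * (mu * w) \<le> eps e * 1"
    using ep w mu_pos mu_le by (intro mult_left_mono mult_le_one) auto
  moreover have "(1 - eps e) * (mu * w) \<le> e * (M - g x)"
  proof -
    have "(1 - eps e) * (mu * w) \<le> (1 - eps e) * (m / M * w)"
      using ep w by (intro mult_left_mono mult_right_mono) (auto simp: mu_def)
    also have "\<dots> = e * (m * w)" using M_pos by (simp add: eps_def)
    also have "\<dots> \<le> e * (M - g x)"
      using g_gap[OF assms(2)] assms(1) by (intro mult_left_mono) (auto simp: w_def)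
    finally show ?thesis .
  qed
  ultimately show ?thesis unfolding J_eps w_def[symmetric] by (simp add: algebra_simps)
qed

lemma powr_split: "x powr (p * (1 + \<delta>)) = x powr p * (x powr p) powr \<delta>"
  by (simp add: powr_powr powr_add[symmetric] algebra_simps)

lemma gap_upper: assumes "x \<in> {0..1}" shows "0 \<le> M - g x" "M - g x \<le> (c + B) * x powr p"
proof -
  show "0 \<le> M - g x" using g_le[OF assms] by simp
  have "x powr (p * (1 + \<delta>)) \<le> x powr p"
    using assms p0 d0 by (intro powr_mono') auto
  then have "B * x powr (p * (1 + \<delta>)) \<le> B * x powr p" using B_nonneg by (rule mult_left_mono)
  then show "M - g x \<le> (c + B) * x powr p" using g_cusp[OF assms] by (simp add: algebra_simps)
qed

lemma J_Jt:
  assumes "e \<in> {0..1/M}" "x \<in> {0..1}"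
  shows "\<bar>J e x - Jt e x\<bar> \<le> (c + B) / M * (eps e * x powr p + x powr (p * (1 + \<delta>)))"
proof -
  note ep = eps_bounds[OF assms(1)] and gu = gap_upper[OF assms(2)]
  have "J e x - Jt e x = - (eps e / M) * (M - g x) + (M - g x - c * x powr p) / M"
    using M_pos unfolding J_eps Jt_def cs_def by (subst (2) e_eps) (simp add: field_simps)
  also have "\<bar>\<dots>\<bar> \<le> (eps e / M) * ((c + B) * x powr p) + B * x powr (p * (1 + \<delta>)) / M"
  proof (rule order_trans[OF abs_triangle_ineq] , rule add_mono)
    show "\<bar>- (eps e / M) * (M - g x)\<bar> \<le> (eps e / M) * ((c + B) * x powr p)"
      using ep gu M_pos unfolding abs_mult by (intro mult_mono) auto
    show "\<bar>(M - g x - c * x powr p) / M\<bar> \<le> B * x powr (p * (1 + \<delta>)) / M"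
      using g_cusp[OF assms(2)] M_pos by (simp add: divide_right_mono)
  qed
  also have "\<dots> \<le> (eps e / M) * ((c + B) * x powr p) + (c + B) * x powr (p * (1 + \<delta>)) / M"
    using M_pos c_pos by (intro add_left_mono divide_right_mono mult_right_mono) auto
  also have "\<dots> = (c + B) / M * (eps e * x powr p + x powr (p * (1 + \<delta>)))"
    by (simp add: algebra_simps add_divide_distrib)
  finally show ?thesis .
qed

lemma g_bounded: obtains Gb where "0 < Gb" "\<And>x. x \<in> {0..1} \<Longrightarrow> \<bar>g x\<bar> \<le> Gb"
  using continuous_on_compact_bound[OF compact_Icc g_cont] by blast

lemma inv_J_integrable:
  assumes "e \<in> {0..1/M}" shows "(\<lambda>x. 1 / J e x) integrable_on {0..1}"
proof (cases "e \<in> I")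
  case True
  then show ?thesis by (intro integrable_continuous_real inv_J_cont)
next
  case False
  then have e: "e = 1 / M" using assms by (auto simp: I_def)
  show ?thesis
  proof (rule measurable_bounded_by_integrable_imp_integrable_real)
    have "J e \<in> borel_measurable (lebesgue_on {0..1})"
      by (rule continuous_imp_measurable_on_sets_lebesgue[OF J_cont]) auto
    then show "(\<lambda>x. 1 / J e x) \<in> borel_measurable (lebesgue_on {0..1})" by measurable
    show "(\<lambda>x. (1 / mu) * x powr (-p)) integrable_on {0..1}"
      using has_integral_mult_right[OF has_integral_powr_from_0[of "-p" 1], of "1 / mu"] p1
      by (auto simp: integrable_on_def)
    show "\<bar>1 / J e x\<bar> \<le> (1 / mu) * x powr (-p)" if x: "x \<in> {0..1}" for x
    proof (cases "x = 0")
      case True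
      then show ?thesis using M_pos by (simp add: e J_def g_0)
    next
      case False
      then have "0 < mu * x powr p" using mu_pos by simp
      with J_ge_powr[OF assms x] have "1 / J e x \<le> 1 / (mu * x powr p)" "0 < J e x"
        by (auto intro!: divide_left_mono mult_pos_pos)
      then show ?thesis by (simp add: powr_minus divide_inverse)
    qed
  qed auto
qed

lemma K_has_integral: "e \<in> {0..1/M} \<Longrightarrow> ((\<lambda>x. 1 / J e x) has_integral K e) {0..1}"
  unfolding K_def by (rule integrable_integral[OF inv_J_integrable])

lemma inv_J_le:
  assumes "e \<in> {0..1/M}" "x \<in> {0<..1}"
  shows "0 < J e x" "1 / J e x \<le> 1 / mu * x powr (-p)"
proof -
  have x: "x \<in> {0..1}" "0 < mu * x powr p" using assms mu_pos by auto
  show J: "0 < J e x" by (rule less_le_trans[OF x(2) J_ge_powr[OF assms(1) x(1)]])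
  have "1 / J e x \<le> 1 / (mu * x powr p)"
    using J_ge_powr[OF assms(1) x(1)] x(2) mu_pos J by (intro divide_left_mono mult_pos_pos) auto
  then show "1 / J e x \<le> 1 / mu * x powr (-p)" by (simp add: powr_minus divide_inverse)
qed

definition Khi :: real where "Khi = 1 / mu / (1 - p)"

lemma K_le: assumes "e \<in> {0..1/M}" shows "K e \<le> Khi"
proof -
  have "\<bar>integral {0..1} (\<lambda>x. 1 / J e x)\<bar> \<le> 1 / mu / (1 - p)"
    by (rule abs_integral_le_powr[OF inv_J_integrable[OF assms] p1]) (use inv_J_le[OF assms] in \<open>auto simp: abs_of_pos\<close>)
  then show ?thesis by (simp add: K_def Khi_def)
qed

lemma K_ge: obtains Klo where "0 < Klo" "\<And>e. e \<in> {0..1/M} \<Longrightarrow> Klo \<le> K e"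
proof -
  obtain Gb where Gb: "0 < Gb" "\<And>x. x \<in> {0..1} \<Longrightarrow> \<bar>g x\<bar> \<le> Gb" using g_bounded by blast
  define h where "h = 1 + Gb / M"
  have h: "0 < h" using Gb M_pos by (simp add: h_def add_pos_pos)
  have "1 / h \<le> K e" if e: "e \<in> {0..1/M}" for e
  proof -
    have i1: "((\<lambda>x. if x = 0 then 0 else 1 / J e x) has_integral K e) {0..1}"
      by (rule has_integral_spike_finite[OF _ _ K_has_integral[OF e], of "{0}"]) auto
    have i2: "((\<lambda>x::real. if x = 0 then 0 else 1 / h) has_integral (1 / h)) {0..1}"
    proof (rule has_integral_spike_finite[where S = "{0}"])
      show "((\<lambda>x::real. 1 / h) has_integral (1 / h)) {0..1}"
        using has_integral_const_real[of "1 / h" 0 1] by simp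
    qed auto
    show ?thesis
    proof (rule has_integral_le[OF i2 i1])
      fix x :: real assume x: "x \<in> {0..1}"
      show "(if x = 0 then 0 else 1 / h) \<le> (if x = 0 then 0 else 1 / J e x)"
      proof (cases "x = 0")
        case False
        then have x': "x \<in> {0<..1}" using x by auto
        have "\<bar>e * g x\<bar> \<le> (1/M) * Gb" unfolding abs_mult
          using e Gb(2)[OF x] M_pos by (intro mult_mono) auto
        then have "J e x \<le> h" by (simp add: J_def h_def)
        then show ?thesis using False inv_J_le(1)[OF e x'] h by (auto intro!: divide_left_mono mult_pos_pos)
      qed simp
    qed
  qed
  then show ?thesis using that[of "1 / h"] h by simp
qed

lemma Khi_pos: "0 < Khi" using mu_pos p1 by (simp add: Khi_def)

text \<open>One factor is bounded below by \<open>\<mu> x\<^sup>p\<close>, the other one by the geometric mean of \<open>\<epsilon>\<close> and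
  \<open>\<mu> x\<^sup>p\<close> with exponents \<open>1 - \<delta>\<close> and \<open>\<delta>\<close>.  The resulting power of \<open>x\<close> is integrable, and a
  factor \<open>\<epsilon>\<^sup>\<delta>\<close> is gained over \<open>1/\<epsilon>\<close>.  Both \<open>K - Ks\<close> and \<open>G\<close> are estimated in this way.\<close>

lemma J_product_lower:
  assumes "e \<in> I" "e' \<in> {0..1/M}" "x \<in> {0<..1}"
  shows "1 / (J e x * J e' x) \<le> eps e powr (\<delta> - 1) * (mu powr (- (1 + \<delta>)) * x powr (- (p * (1 + \<delta>))))"
proof -
  have x: "x \<in> {0..1}" using assms by auto
  note ec = I_closed[OF assms(1)]
  define y where "y = mu * x powr p"
  have y: "0 < y" using assms mu_pos by (simp add: y_def)
  note ep = eps_pos[OF assms(1)]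
  have 1: "eps e powr (1 - \<delta>) * y powr \<delta> \<le> J e x"
    using J_ge_eps[OF ec x] J_ge_powr[OF ec x] ep y d0 d1 by (intro powr_interpolation) (auto simp: y_def)
  have 2: "y \<le> J e' x" using J_ge_powr[OF assms(2) x] by (simp add: y_def)
  have "(eps e powr (1 - \<delta>) * y powr \<delta>) * y \<le> J e x * J e' x"
    using 1 2 y inv_J_le(1)[OF ec assms(3)] by (intro mult_mono) auto
  then have "1 / (J e x * J e' x) \<le> 1 / ((eps e powr (1 - \<delta>) * y powr \<delta>) * y)"
    using y ep inv_J_le(1)[OF ec assms(3)] inv_J_le(1)[OF assms(2,3)]
    by (intro divide_left_mono mult_pos_pos) auto
  also have "\<dots> = eps e powr (\<delta> - 1) * y powr (- (1 + \<delta>))"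
  proof -
    have "y powr (- (1 + \<delta>)) = 1 / (y powr \<delta> * y)"
      using y powr_add[of y \<delta> 1] powr_minus_divide[of y "1 + \<delta>"] by (simp add: add.commute)
    moreover have "eps e powr (\<delta> - 1) = 1 / eps e powr (1 - \<delta>)"
      using powr_minus[of "eps e" "1 - \<delta>"] by (simp add: divide_inverse)
    ultimately show ?thesis by simp
  qed
  also have "y powr (- (1 + \<delta>)) = mu powr (- (1 + \<delta>)) * x powr (- (p * (1 + \<delta>)))"
    unfolding y_def by (simp only: powr_mult powr_powr mult_minus_right)
  finally show ?thesis .
qed

lemma K_asymp: obtains C where "0 < C" "\<And>e. e \<in> I \<Longrightarrow> \<bar>K e - Ks\<bar> \<le> C * eps e powr \<delta>"
proof -
  obtain Gb where Gb: "0 < Gb" "\<And>x. x \<in> {0..1} \<Longrightarrow> \<bar>g x\<bar> \<le> Gb" using g_bounded by blast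
  define C where "C = Gb / M * mu powr (- (1 + \<delta>)) / (1 - p * (1 + \<delta>))"
  have M1: "1 / M \<in> {0..1/M}" using M_pos by simp
  have "\<bar>K e - Ks\<bar> \<le> C * eps e powr \<delta>" if e: "e \<in> I" for e
  proof -
    note ec = I_closed[OF e] and ep = eps_pos[OF e]
    have "K e - Ks = integral {0..1} (\<lambda>x. 1 / J e x - 1 / J (1/M) x)"
      unfolding K_def Ks_def by (rule integral_diff[symmetric, OF inv_J_integrable[OF ec] inv_J_integrable[OF M1]])
    also have "\<bar>\<dots>\<bar> \<le> (eps e powr \<delta> * (Gb / M * mu powr (- (1 + \<delta>)))) / (1 - p * (1 + \<delta>))"
    proof (rule abs_integral_le_powr)
      show "(\<lambda>x. 1 / J e x - 1 / J (1/M) x) integrable_on {0..1}"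
        by (intro integrable_diff inv_J_integrable ec M1)
      fix x :: real assume x: "x \<in> {0<..1}"
      note J1 = inv_J_le(1)[OF ec x] and J2 = inv_J_le(1)[OF M1 x]
      have "1 / J e x - 1 / J (1/M) x = (J (1/M) x - J e x) * (1 / (J e x * J (1/M) x))"
        using J1 J2 by (simp add: field_simps)
      also have "J (1/M) x - J e x = - (eps e / M) * g x"
        using M_pos by (simp add: J_def eps_def field_simps)
      also have "\<bar>- (eps e / M) * g x * (1 / (J e x * J (1/M) x))\<bar>
          \<le> (eps e / M * Gb) * (eps e powr (\<delta> - 1) * (mu powr (- (1 + \<delta>)) * x powr (- (p * (1 + \<delta>)))))"
        unfolding abs_mult
        using ep M_pos Gb(2)[of x] x J1 J2 J_product_lower[OF e M1 x] Gb(1)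
        by (intro mult_mono) (auto simp: abs_mult)
      also have "\<dots> = (eps e powr 1 * eps e powr (\<delta> - 1)) * (Gb / M * mu powr (- (1 + \<delta>))) * x powr (- (p * (1 + \<delta>)))"
        using ep by simp
      also have "eps e powr 1 * eps e powr (\<delta> - 1) = eps e powr (1 + (\<delta> - 1))"
        by (simp only: powr_add)
      also have "1 + (\<delta> - 1) = \<delta>" by simp
      finally show "\<bar>1 / J e x - 1 / J (1/M) x\<bar>
          \<le> eps e powr \<delta> * (Gb / M * mu powr (- (1 + \<delta>))) * x powr (- (p * (1 + \<delta>)))" .
    qed (rule d_int)
    finally show ?thesis by (simp add: C_def mult.commute)
  qed
  moreover have "0 < C" using Gb M_pos mu_pos d_int by (simp add: C_def)
  ultimately show ?thesis using that by blast
qed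

lemma G_asymp: obtains C where "0 < C" "\<And>e. e \<in> I \<Longrightarrow> \<bar>G e\<bar> \<le> C * eps e powr (\<delta> - 1)"
proof -
  obtain Gb where Gb: "0 < Gb" "\<And>x. x \<in> {0..1} \<Longrightarrow> \<bar>g x\<bar> \<le> Gb" using g_bounded by blast
  define C where "C = Gb * mu powr (- (1 + \<delta>)) / (1 - p * (1 + \<delta>))"
  have "\<bar>G e\<bar> \<le> C * eps e powr (\<delta> - 1)" if e: "e \<in> I" for e
  proof -
    note ec = I_closed[OF e] and ep = eps_pos[OF e]
    have "\<bar>G e\<bar> \<le> (eps e powr (\<delta> - 1) * (Gb * mu powr (- (1 + \<delta>)))) / (1 - p * (1 + \<delta>))"
      unfolding G_def
    proof (rule abs_integral_le_powr)
      show "(\<lambda>y. g y / (J e y)^2) integrable_on {0..1}"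
        by (intro integrable_continuous_real gJ2_cont e)
      fix x :: real assume x: "x \<in> {0<..1}"
      note J1 = inv_J_le(1)[OF ec x]
      have "\<bar>g x / (J e x)^2\<bar> = \<bar>g x\<bar> * (1 / (J e x * J e x))"
        using J1 by (simp add: power2_eq_square abs_mult)
      also have "\<dots> \<le> Gb * (eps e powr (\<delta> - 1) * (mu powr (- (1 + \<delta>)) * x powr (- (p * (1 + \<delta>)))))"
        using Gb(2)[of x] x J1 J_product_lower[OF e ec x] Gb(1) by (intro mult_mono) auto
      finally show "\<bar>g x / (J e x)^2\<bar> \<le> eps e powr (\<delta> - 1) * (Gb * mu powr (- (1 + \<delta>))) * x powr (- (p * (1 + \<delta>)))"
        by (simp add: mult_ac)
    qed (rule d_int)
    then show ?thesis by (simp add: C_def mult_ac)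
  qed
  moreover have "0 < C" using Gb mu_pos d_int by (simp add: C_def)
  ultimately show ?thesis using that by blast
qed

lemma K_cont_closed: "continuous_on {0..1/M} K"
  unfolding continuous_on_eq_continuous_within
proof
  fix e assume e: "e \<in> {0..1/M}"
  show "continuous (at e within {0..1/M}) K"
  proof (cases "e \<in> I")
    case True
    have "at e within {0..1/M} = at e within I"
      by (rule at_within_nhd[of e "{..<1/M}"]) (use True in \<open>auto simp: I_def\<close>)
    then show ?thesis using K_cont True by (simp add: continuous_on_eq_continuous_within)
  next
    case False
    then have e1: "e = 1/M" using e by (auto simp: I_def)
    obtain C where C: "0 < C" "\<And>e. e \<in> I \<Longrightarrow> \<bar>K e - Ks\<bar> \<le> C * eps e powr \<delta>" using K_asymp by blast
    have ceps: "continuous_on {0..1/M} (\<lambda>e. C * eps e powr \<delta>)"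
      by (intro continuous_intros continuous_on_powr') (use eps_bounds d0 in \<open>auto simp: eps_def intro!: continuous_intros\<close>)
    have "((\<lambda>e. C * eps e powr \<delta>) \<longlongrightarrow> C * eps (1/M) powr \<delta>) (at e within {0..1/M})"
      using ceps e e1 by (auto simp: continuous_on_def)
    then have lim: "((\<lambda>e. C * eps e powr \<delta>) \<longlongrightarrow> 0) (at e within {0..1/M})"
      using M_pos by (simp add: eps_def)
    have ev: "\<forall>\<^sub>F e in at e within {0..1/M}. norm (K e - Ks) \<le> C * eps e powr \<delta>"
      unfolding eventually_at_filter
      by (rule always_eventually) (use e1 C(2) in \<open>auto simp: I_def\<close>)
    have "((\<lambda>e. K e - Ks) \<longlongrightarrow> 0) (at e within {0..1/M})"
      by (rule Lim_null_comparison[OF ev lim])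
    then show ?thesis unfolding continuous_within e1 Ks_def by (simp add: LIM_zero_iff)
  qed
qed

lemma K_pos_closed: assumes "e \<in> {0..1/M}" shows "0 < K e"
proof -
  obtain Klo where "0 < Klo" "\<And>e. e \<in> {0..1/M} \<Longrightarrow> Klo \<le> K e" using K_ge by blast
  then show ?thesis using assms less_le_trans by blast
qed

lemma Ks_pos: "0 < Ks" using K_pos_closed M_pos by (simp add: Ks_def)

section \<open>Blow-up time and physical time\<close>

definition clock :: "real \<Rightarrow> real" where "clock e = integral {0..e} (\<lambda>s. (K s)^2)"
definition T :: real where "T = clock (1 / M)"
definition param :: "real \<Rightarrow> real" where "param t = inv_into {0..1/M} clock t"

lemma K2_cont: "continuous_on {0..1/M} (\<lambda>s. (K s)^2)"
  by (intro continuous_intros K_cont_closed)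

lemma K2_integrable: "e \<in> {0..1/M} \<Longrightarrow> (\<lambda>s. (K s)^2) integrable_on {e..1/M}"
  by (rule integrable_continuous_real) (rule continuous_on_subset[OF K2_cont], auto)

lemma clock_deriv: "e \<in> {0..1/M} \<Longrightarrow> (clock has_real_derivative (K e)^2) (at e within {0..1/M})"
  unfolding clock_def[abs_def] by (rule integral_has_real_derivative[OF K2_cont])

lemma clock_cont: "continuous_on {0..1/M} clock"
  by (rule DERIV_continuous_on[OF clock_deriv])

lemma remaining_time:
  assumes "e \<in> {0..1/M}" shows "T - clock e = integral {e..1/M} (\<lambda>s. (K s)^2)"
  unfolding T_def clock_def
  using Henstock_Kurzweil_Integration.integral_combine[of 0 e "1/M" "\<lambda>s. (K s)^2"] K2_integrable[of 0] assms M_pos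
  by auto

lemma clock_strict_mono: "strict_mono_on {0..1/M} clock"
proof (rule strict_mono_onI)
  fix r s assume rs: "r \<in> {0..1/M}" "s \<in> {0..1/M}" "r < s"
  show "clock r < clock s"
  proof (rule DERIV_pos_imp_increasing_open[OF rs(3)])
    fix z assume z: "r < z" "z < s"
    then have "at z within {0..1/M} = at z" using rs by (intro at_within_interior) auto
    then show "\<exists>y. (clock has_real_derivative y) (at z) \<and> 0 < y"
      using clock_deriv[of z] K_pos_closed[of z] z rs by (intro exI[of _ "(K z)^2"]) auto
  next
    show "continuous_on {r..s} clock" by (rule continuous_on_subset[OF clock_cont]) (use rs in auto)
  qed
qed

lemma clock_0: "clock 0 = 0" by (simp add: clock_def)

lemma T_pos: "0 < T"
  using strict_mono_onD[OF clock_strict_mono, of 0 "1/M"] M_pos clock_0 by (simp add: T_def)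

lemma param_clock: "e \<in> {0..1/M} \<Longrightarrow> param (clock e) = e"
  unfolding param_def using strict_mono_on_imp_inj_on[OF clock_strict_mono] by (rule inv_into_f_f)

lemma clock_surj: assumes "t \<in> {0..<T}" obtains e where "e \<in> I" "clock e = t" "param t = e"
proof -
  obtain e where e: "0 \<le> e" "e \<le> 1/M" "clock e = t"
    using IVT'[of clock 0 t "1/M"] clock_cont assms M_pos by (auto simp: clock_0 T_def)
  moreover have "e \<noteq> 1/M" using e assms by (auto simp: T_def)
  ultimately show ?thesis using that[of e] param_clock[of e] by (auto simp: I_def)
qed

lemma param_in: "t \<in> {0..<T} \<Longrightarrow> param t \<in> I" and clock_param: "t \<in> {0..<T} \<Longrightarrow> clock (param t) = t"
  by (metis clock_surj)+

lemma param_0: "param 0 = 0" using param_clock[of 0] M_pos by (simp add: clock_0)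

lemma param_mono: assumes "s \<in> {0..<T}" "t \<in> {0..<T}" "s \<le> t" shows "param s \<le> param t"
proof (rule ccontr)
  assume "\<not> param s \<le> param t"
  then have "clock (param t) < clock (param s)"
    using strict_mono_onD[OF clock_strict_mono, of "param t" "param s"] param_in[OF assms(1)] param_in[OF assms(2)] by (auto simp: I_def)
  then show False using clock_param assms by simp
qed

lemma param_deriv:
  assumes "t \<in> {0..<T}"
  shows "(param has_real_derivative 1 / (K (param t))^2) (at t within {0..<T})"
proof -
  note e = I_closed[OF param_in[OF assms]]
  have "(param has_real_derivative 1 / (K (param t))^2) (at (clock (param t)) within {clock 0..clock (1/M)})"
    by (rule strict_mono_on_inverse_has_real_derivative[OF clock_cont clock_strict_mono e clock_deriv[OF e] _ param_clock])
      (use K_pos_closed[OF e] in auto)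
  then have "(param has_real_derivative 1 / (K (param t))^2) (at t within {0..T})"
    using clock_param[OF assms] by (simp add: clock_0 T_def)
  then show ?thesis by (rule DERIV_subset) auto
qed

lemma solution: "solution_with T g (\<lambda>t. sol (param t))
     (\<lambda>t Z. (sol (param t) Z)^2 - integral {0..Z} (sol (param t)) * sol_Z (param t) Z
       - 2 * integral {0..1} (\<lambda>z. (sol (param t) z)^2)) (\<lambda>t. sol_Z (param t))"
  by (rule explicit_solution[OF param_in param_0 param_deriv])

text \<open>Up to a time \<open>t1 < T\<close> positions are at most a constant times starting points, so the solution
  inherits the bound \<open>Z powr (p-1)\<close> on the derivative of the datum.\<close>

lemma sol_Z_bound:
  assumes t1: "t1 \<in> {0..<T}"
  obtains C where "0 \<le> C" "\<And>t Z. t \<in> {0..t1} \<Longrightarrow> Z \<in> {0<..1} \<Longrightarrow> \<bar>sol_Z (param t) Z\<bar> \<le> C * Z powr (p - 1)"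
proof -
  obtain Klo where Klo: "0 < Klo" "\<And>e. e \<in> {0..1/M} \<Longrightarrow> Klo \<le> K e" using K_ge by blast
  define w where "w = Klo * eps (param t1)"
  have w: "0 < w" using Klo eps_pos[OF param_in[OF t1]] by (simp add: w_def)
  have "\<bar>sol_Z (param t) Z\<bar> \<le> (B * w powr (p - 1) / w) * Z powr (p - 1)"
    if t: "t \<in> {0..t1}" and Z: "Z \<in> {0<..1}" for t Z
  proof -
    have tT: "t \<in> {0..<T}" using t t1 by auto
    define e where "e = param t"
    have e: "e \<in> I" using param_in[OF tT] by (simp add: e_def)
    have Z': "Z \<in> {0..1}" using Z by auto
    define x where "x = X e Z"
    have x: "x \<in> {0<..1}" "x \<in> {0..1}" "flow e x = Z"
      using X_pos[OF e Z] flow_X[OF e Z'] by (auto simp: x_def)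
    have epe: "eps (param t1) \<le> eps e"
      using param_mono[OF tT t1] t M_pos by (auto simp: eps_def e_def)
    have KJ: "w \<le> K e * J e y" if "y \<in> {0..1}" for y
      unfolding w_def using Klo(2)[OF I_closed[OF e]] Klo(1) J_ge_eps[OF I_closed[OF e] that] epe eps_pos[OF param_in[OF t1]]
      by (intro mult_mono) auto
    have "Z \<le> x / w"
    proof -
      have "flow e x - 0 * x / w \<le> x / w"
      proof -
        have "flow e x - x / w \<le> flow e 0 - 0 / w"
        proof (rule DERIV_within_nonpos_imp_le[where f = "\<lambda>x. flow e x - x / w" and f' = "\<lambda>y. 1 / (K e * J e y) - 1 / w"])
          fix y assume y: "y \<in> {0..x}"
          then have y1: "y \<in> {0..1}" using x by auto
          show "((\<lambda>x. flow e x - x / w) has_real_derivative 1 / (K e * J e y) - 1 / w) (at y within {0..x})"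
            by (intro DERIV_diff DERIV_cdivide DERIV_ident DERIV_subset[OF flow_deriv_x[OF e y1]]) (use x in auto)
          show "1 / (K e * J e y) - 1 / w \<le> 0"
            using KJ[OF y1] w by (simp add: divide_left_mono)
        qed (use x in auto)
        then show ?thesis by simp
      qed
      then show ?thesis using x by simp
    qed
    then have "w * Z \<le> x" using w by (simp add: field_simps)
    then have "x powr (p - 1) \<le> (w * Z) powr (p - 1)"
      using w Z p1 by (intro powr_mono2') auto
    then have "\<bar>g' x\<bar> \<le> B * (w powr (p - 1) * Z powr (p - 1))"
      using g'_bound[OF x(1)] B_nonneg mult_left_mono[of "x powr (p-1)" _ B] by (fastforce simp: powr_mult)
    then have "\<bar>g' x\<bar> / (K e * J e x) \<le> (B * (w powr (p - 1) * Z powr (p - 1))) / w"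
      using KJ[OF x(2)] w by (intro frac_le) auto
    moreover have "\<bar>sol_Z e Z\<bar> = \<bar>g' x\<bar> / (K e * J e x)"
      using KJ[OF x(2)] w by (simp add: sol_Z_def x_def[symmetric] abs_divide)
    ultimately show ?thesis by (simp add: e_def)
  qed
  then show ?thesis using that[of "B * w powr (p - 1) / w"] B_nonneg w by simp
qed

text \<open>The remaining time is the integral of \<open>K\<^sup>2\<close> over an interval of length \<open>\<epsilon>/M\<close>, on which \<open>K\<close> differs
  from \<open>Ks\<close> by \<open>O(\<epsilon>\<^sup>\<delta>)\<close>.\<close>

lemma time_asymp:
  obtains C where "0 < C" "\<And>e. e \<in> I \<Longrightarrow> \<bar>(T - clock e) - Ks^2 * eps e / M\<bar> \<le> C * eps e powr (1 + \<delta>)"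
proof -
  obtain C where C: "0 < C" "\<And>e. e \<in> I \<Longrightarrow> \<bar>K e - Ks\<bar> \<le> C * eps e powr \<delta>" using K_asymp by blast
  have Ks: "0 < Ks" "Ks \<le> Khi" using Ks_pos K_le[of "1/M"] M_pos by (auto simp: Ks_def)
  have "\<bar>(T - clock e) - Ks^2 * eps e / M\<bar> \<le> (C * (2 * Khi) / M) * eps e powr (1 + \<delta>)" if e: "e \<in> I" for e
  proof -
    note ec = I_closed[OF e] and ep = eps_pos[OF e]
    have len: "1/M - e = eps e / M" using M_pos by (simp add: eps_def field_simps)
    have 1: "((\<lambda>s. (K s)^2 - Ks^2) has_integral (T - clock e) - (1/M - e) * Ks^2) {e..1/M}"
      using has_integral_diff[OF integrable_integral[OF K2_integrable[OF ec]] has_integral_const_real[of "Ks^2" e "1/M"]]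
        ec remaining_time[OF ec] by simp
    have "norm ((T - clock e) - (1/M - e) * Ks^2) \<le> (C * (2 * Khi) * eps e powr \<delta>) * measure lborel {e..1/M}"
    proof (rule has_integral_bound_real[OF _ finite.emptyI 1])
      show "0 \<le> C * (2 * Khi) * eps e powr \<delta>" using C Khi_pos by simp
      fix s assume "s \<in> {e..1/M} - {}"
      then have s: "s \<in> {e..1/M}" by simp
      then have s': "s \<in> {0..1/M}" using ec by auto
      have "\<bar>K s - Ks\<bar> \<le> C * eps e powr \<delta>"
      proof (cases "s \<in> I")
        case True
        have "eps s powr \<delta> \<le> eps e powr \<delta>"
          using s eps_pos[OF True] d0 M_pos by (intro powr_mono2) (auto simp: eps_def)
        then show ?thesis using C(2)[OF True] C(1) mult_left_mono[of "eps s powr \<delta>" "eps e powr \<delta>" C] by linarith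
      next
        case False
        then have "s = 1/M" using s' by (auto simp: I_def)
        then show ?thesis using C by (simp add: Ks_def)
      qed
      moreover have "\<bar>K s + Ks\<bar> \<le> 2 * Khi" using K_le[OF s'] K_pos_closed[OF s'] Ks by simp
      ultimately have "\<bar>K s - Ks\<bar> * \<bar>K s + Ks\<bar> \<le> (C * eps e powr \<delta>) * (2 * Khi)"
        by (intro mult_mono) auto
      then show "norm ((K s)^2 - Ks^2) \<le> C * (2 * Khi) * eps e powr \<delta>"
        by (simp add: abs_mult[symmetric] power2_eq_square algebra_simps)
    qed
    also have "measure lborel {e..1/M} = eps e / M" using ec len by simp
    also have "(C * (2 * Khi) * eps e powr \<delta>) * (eps e / M) = (C * (2 * Khi) / M) * (eps e powr 1 * eps e powr \<delta>)"
      using ep by simp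
    also have "eps e powr 1 * eps e powr \<delta> = eps e powr (1 + \<delta>)" by (simp only: powr_add)
    finally show ?thesis using len by (simp add: mult.commute)
  qed
  then show ?thesis using that[of "C * (2 * Khi) / M"] C Khi_pos M_pos by simp
qed

lemma time_upper: assumes "e \<in> I" shows "T - clock e \<le> Khi^2 * eps e / M"
proof -
  note ec = I_closed[OF assms]
  have "integral {e..1/M} (\<lambda>s. (K s)^2) \<le> integral {e..1/M} (\<lambda>s. Khi^2)"
    using K2_integrable[OF ec]
  proof (rule integral_le)
    fix s assume "s \<in> {e..1/M}"
    then have "s \<in> {0..1/M}" using ec by auto
    then show "(K s)^2 \<le> Khi^2" using K_le K_pos_closed by (intro power_mono) (auto simp: less_imp_le)
  qed auto
  also have "\<dots> = Khi^2 * eps e / M" using ec M_pos by (simp add: eps_def field_simps)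
  finally show ?thesis using remaining_time[OF ec] by simp
qed

lemma time_lower: obtains l where "0 < l" "\<And>e. e \<in> I \<Longrightarrow> l * eps e \<le> T - clock e"
proof -
  obtain Klo where Klo: "0 < Klo" "\<And>e. e \<in> {0..1/M} \<Longrightarrow> Klo \<le> K e" using K_ge by blast
  have "Klo^2 / M * eps e \<le> T - clock e" if e: "e \<in> I" for e
  proof -
    note ec = I_closed[OF e]
    have "Klo^2 / M * eps e = integral {e..1/M} (\<lambda>s. Klo^2)" using ec M_pos by (simp add: eps_def field_simps)
    also have "\<dots> \<le> integral {e..1/M} (\<lambda>s. (K s)^2)"
    proof (rule integral_le[OF _ K2_integrable[OF ec]])
      fix s assume "s \<in> {e..1/M}"
      then have "s \<in> {0..1/M}" using ec by auto
      then show "Klo^2 \<le> (K s)^2" using Klo by (intro power_mono) (auto simp: less_imp_le)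
    qed auto
    finally show ?thesis using remaining_time[OF ec] by simp
  qed
  then show ?thesis using that[of "Klo^2 / M"] Klo M_pos by simp
qed

end

section \<open>Convergence to the profile\<close>

context cusp_datum
begin

definition Rt :: "real \<Rightarrow> real \<Rightarrow> real" where "Rt e x = integral {0..x} (\<lambda>y. 1 / Jt e y)"
definition D :: real where "D = (c + B) / M / mu"
definition L :: real where "L = (c + B) / c"

lemma D_pos: "0 < D" using c_pos B_nonneg M_pos mu_pos by (simp add: D_def)
lemma L_ge: "1 \<le> L" using c_pos B_nonneg by (simp add: L_def)

lemma Jt_lower: assumes "e \<in> I" "x \<in> {0..1}"
  shows "eps e \<le> Jt e x" "cs * x powr p \<le> Jt e x" "0 < Jt e x"
  using eps_pos[OF assms(1)] cs_pos by (auto simp: Jt_def add_pos_nonneg)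

lemma J_le_Jt: assumes "e \<in> I" "x \<in> {0..1}" shows "J e x \<le> L * Jt e x"
proof -
  have e: "0 \<le> e" "e \<le> 1/M" using assms by (auto simp: I_def)
  have "e * (M - g x) \<le> (1/M) * ((c + B) * x powr p)"
    using e gap_upper[OF assms(2)] M_pos by (intro mult_mono) auto
  also have "\<dots> = L * (cs * x powr p)" using c_pos by (simp add: L_def cs_def)
  finally have "J e x \<le> 1 * eps e + L * (cs * x powr p)" by (simp add: J_eps)
  also have "\<dots> \<le> L * eps e + L * (cs * x powr p)"
    using L_ge eps_pos[OF assms(1)] by (intro add_right_mono mult_right_mono) auto
  finally show ?thesis by (simp add: Jt_def algebra_simps)
qed

lemma inv_diff: "0 < (u::real) \<Longrightarrow> 0 < v \<Longrightarrow> \<bar>1 / u - 1 / v\<bar> = \<bar>u - v\<bar> * (1 / (u * v))"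
  by (simp add: field_simps abs_divide)

lemma inv_J_Jt_relative:
  assumes e: "e \<in> I" and x: "x \<in> {0..1}"
  shows "\<bar>1 / J e x - 1 / Jt e x\<bar> \<le> D * (eps e + (x powr p) powr \<delta>) * (1 / Jt e x)"
proof (cases "x = 0")
  case True
  then show ?thesis
    using D_pos eps_pos[OF e] g_0 p0 by (simp add: J_eps Jt_def)
next
  case False
  define w where "w = x powr p"
  have w: "0 < w" using False by (simp add: w_def)
  note J = J_pos[OF e x] and Jt = Jt_lower[OF e x] and ep = eps_pos[OF e]
  have muJ: "mu * w \<le> J e x" using J_ge_powr[OF I_closed[OF e] x] by (simp add: w_def)
  have "\<bar>1 / J e x - 1 / Jt e x\<bar> = \<bar>J e x - Jt e x\<bar> * (1 / (J e x * Jt e x))"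
    by (rule inv_diff) (use J Jt in auto)
  also have "\<dots> \<le> ((c + B) / M * (eps e * w + w * w powr \<delta>)) * (1 / ((mu * w) * Jt e x))"
    using J_Jt[OF I_closed[OF e] x] w mu_pos muJ J Jt ep c_pos B_nonneg M_pos unfolding powr_split w_def[symmetric]
    by (intro mult_mono divide_left_mono mult_right_mono mult_pos_pos mult_nonneg_nonneg) (auto simp: add_nonneg_nonneg)
  also have "\<dots> = D * (eps e + w powr \<delta>) * (1 / Jt e x)"
  proof -
    have "eps e * w + w * w powr \<delta> = w * (eps e + w powr \<delta>)" by (simp add: algebra_simps)
    then show ?thesis using w by (simp add: D_def)
  qed
  finally show ?thesis by (simp add: w_def)
qed

text \<open>Interpolation between the two lower bounds for \<open>Jt\<close>.  It converts a gain \<open>x powr (p\<delta>)\<close>, which is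
  useful only near \<open>0\<close>, into a gain \<open>\<epsilon>\<^sup>\<delta>\<close>.\<close>

lemma powr_delta_Jt:
  assumes e: "e \<in> I" and x: "x \<in> {0..1}"
  shows "(x powr p) powr \<delta> * (1 / Jt e x) \<le> cs powr (- \<delta>) * eps e powr (\<delta> - 1)"
proof -
  note Jt = Jt_lower[OF e x] and ep = eps_pos[OF e]
  define w where "w = (x powr p) powr \<delta>"
  have "eps e powr (1 - \<delta>) * (cs * x powr p) powr \<delta> \<le> Jt e x"
    using Jt ep cs_pos d0 d1 by (intro powr_interpolation) auto
  then have le: "eps e powr (1 - \<delta>) * cs powr \<delta> * w \<le> Jt e x"
    by (simp add: powr_mult w_def)
  have pos: "0 < eps e powr (1 - \<delta>) * cs powr \<delta>" using ep cs_pos by simp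
  have "w * (1 / Jt e x) \<le> 1 / (eps e powr (1 - \<delta>) * cs powr \<delta>)"
    using le pos Jt(3) by (simp add: field_simps)
  also have "\<dots> = cs powr (- \<delta>) * eps e powr (\<delta> - 1)"
    using powr_minus_divide[of "eps e" "1 - \<delta>"] powr_minus_divide[of cs \<delta>] by simp
  finally show ?thesis by (simp add: w_def)
qed

lemma eps_powr_ge_1: "e \<in> I \<Longrightarrow> 1 \<le> eps e powr (\<delta> - 1)"
  using eps_pos[of e] eps_bounds[OF I_closed, of e] d1 powr_mono'[of "\<delta> - 1" 0 "eps e"] by simp

lemma inv_J_Jt_absolute:
  obtains C where "0 < C" "\<And>e x. e \<in> I \<Longrightarrow> x \<in> {0..1} \<Longrightarrow> \<bar>1 / J e x - 1 / Jt e x\<bar> \<le> C * eps e powr (\<delta> - 1)"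
proof
  show "0 < D * (1 + cs powr (- \<delta>))" using D_pos cs_pos by (simp add: add_pos_pos)
  fix e x :: real assume ex: "e \<in> I" "x \<in> {0..1}"
  note Jt = Jt_lower[OF ex] and ep = eps_pos[OF ex(1)]
  have "\<bar>1 / J e x - 1 / Jt e x\<bar> \<le> D * (eps e * (1 / Jt e x) + (x powr p) powr \<delta> * (1 / Jt e x))"
    using inv_J_Jt_relative[OF ex] by (simp add: algebra_simps)
  also have "\<dots> \<le> D * (1 * eps e powr (\<delta> - 1) + cs powr (- \<delta>) * eps e powr (\<delta> - 1))"
  proof (intro mult_left_mono add_mono powr_delta_Jt ex)
    have "eps e * (1 / Jt e x) \<le> 1" using Jt by simp
    then show "eps e * (1 / Jt e x) \<le> 1 * eps e powr (\<delta> - 1)" using eps_powr_ge_1[OF ex(1)] by simp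
  qed (use D_pos in auto)
  finally show "\<bar>1 / J e x - 1 / Jt e x\<bar> \<le> D * (1 + cs powr (- \<delta>)) * eps e powr (\<delta> - 1)"
    by (simp add: algebra_simps)
qed

lemma inv_Jt_cont: assumes "e \<in> I" "x \<in> {0..1}" shows "continuous_on {0..x} (\<lambda>y. 1 / Jt e y)"
proof -
  have "continuous_on {0..x} (Jt e)"
    unfolding Jt_def[abs_def] by (intro continuous_intros) auto
  moreover have "Jt e y \<noteq> 0" if "y \<in> {0..x}" for y
    using Jt_lower(3)[OF assms(1), of y] that assms(2) by simp
  ultimately show ?thesis by (intro continuous_intros) auto
qed

lemma Rt_has_integral: "e \<in> I \<Longrightarrow> x \<in> {0..1} \<Longrightarrow> ((\<lambda>y. 1 / Jt e y) has_integral Rt e x) {0..x}"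
  unfolding Rt_def by (intro integrable_integral integrable_continuous_real inv_Jt_cont)

lemma R_has_integral: "e \<in> I \<Longrightarrow> x \<in> {0..1} \<Longrightarrow> ((\<lambda>y. 1 / J e y) has_integral R e x) {0..x}"
  unfolding R_def
  by (intro integrable_integral integrable_continuous_real continuous_on_subset[OF inv_J_cont]) auto

lemma R_pos: "e \<in> I \<Longrightarrow> x \<in> {0<..1} \<Longrightarrow> 0 < R e x"
  using strict_mono_onD[OF R_strict_mono, of e 0 x] by simp

lemma Rt_le_R: assumes e: "e \<in> I" and x: "x \<in> {0..1}" shows "Rt e x \<le> L * R e x"
proof (rule has_integral_le[OF Rt_has_integral[OF e x] has_integral_mult_right[OF R_has_integral[OF e x]]])
  fix y assume "y \<in> {0..x}"
  then have y: "y \<in> {0..1}" using x by auto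
  show "1 / Jt e y \<le> L * (1 / J e y)"
    using J_le_Jt[OF e y] J_pos[OF e y] Jt_lower(3)[OF e y] by (simp add: field_simps)
qed

lemma R_Rt: assumes e: "e \<in> I" and x: "x \<in> {0..1}"
  shows "\<bar>R e x - Rt e x\<bar> \<le> D * (eps e + (x powr p) powr \<delta>) * Rt e x"
proof -
  let ?k = "D * (eps e + (x powr p) powr \<delta>)"
  have le: "\<bar>1 / J e y - 1 / Jt e y\<bar> \<le> ?k * (1 / Jt e y)" if "y \<in> {0..x}" for y
  proof -
    have y: "y \<in> {0..1}" using that x by auto
    have "(y powr p) powr \<delta> \<le> (x powr p) powr \<delta>"
      using that p0 d0 by (intro powr_mono2) auto
    then have "D * (eps e + (y powr p) powr \<delta>) * (1 / Jt e y) \<le> ?k * (1 / Jt e y)"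
      using D_pos Jt_lower(3)[OF e y] by (intro mult_right_mono mult_left_mono) auto
    then show ?thesis using inv_J_Jt_relative[OF e y] by linarith
  qed
  note d = has_integral_diff[OF R_has_integral[OF e x] Rt_has_integral[OF e x]]
    and k = has_integral_mult_right[OF Rt_has_integral[OF e x], of ?k]
  have "R e x - Rt e x \<le> ?k * Rt e x"
    by (rule has_integral_le[OF d k]) (use le in \<open>auto simp: abs_le_iff\<close>)
  moreover have "- (?k * Rt e x) \<le> R e x - Rt e x"
    by (rule has_integral_le[OF has_integral_neg[OF k] d]) (use le in \<open>fastforce simp: abs_le_iff\<close>)
  ultimately show ?thesis by linarith
qed

text \<open>The substitution \<open>r = (cs/\<epsilon>) powr (1/p) y\<close> maps the model integral to \<open>stretch\<close>: for the model the
  profile is exact.\<close>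

lemma profile_Rt:
  assumes e: "e \<in> I" and x: "x \<in> {0..1}"
  shows "profile (cs powr (1/p) * eps e powr (1 - 1/p) * Rt e x) = eps e / Jt e x"
proof -
  note ep = eps_pos[OF e]
  define k where "k = (cs / eps e) powr (1/p)"
  have k: "0 < k" "k powr p = cs / eps e" using cs_pos ep p0 by (auto simp: k_def powr_powr)
  have Jk: "1 / (1 + (k * y) powr p) = eps e * (1 / Jt e y)" for y
  proof -
    have "1 + (k * y) powr p = Jt e y / eps e"
      using ep by (simp add: powr_mult k(2) Jt_def add_divide_distrib)
    then show ?thesis by simp
  qed
  have "((\<lambda>y. k *\<^sub>R (1 / (1 + (k * y) powr p))) has_integral integral {k * 0..k * x} (\<lambda>r. 1 / (1 + r powr p))) {0..x}"
    by (rule has_integral_substitution[OF _ _ _ integrand_continuous])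
      (use k x in \<open>auto intro!: derivative_eq_intros mult_left_mono\<close>)
  then have "((\<lambda>y. (k * eps e) * (1 / Jt e y)) has_integral stretch (k * x)) {0..x}"
    by (simp add: Jk stretch_def mult.assoc)
  then have "stretch (k * x) = (k * eps e) * Rt e x"
    by (rule has_integral_unique[OF _ has_integral_mult_right[OF Rt_has_integral[OF e x]]])
  also have "k * eps e = cs powr (1/p) * eps e powr (1 - 1/p)"
    using ep by (simp add: k_def powr_divide powr_diff)
  finally have "profile (cs powr (1/p) * eps e powr (1 - 1/p) * Rt e x) = profile (stretch (k * x))" by simp
  also have "\<dots> = eps e * (1 / Jt e x)" using profile_stretch[of "k * x"] k x Jk by simp
  finally show ?thesis by simp
qed

text \<open>Chosen such that the rescaled position of a particle under the model flow, with \<open>K\<close> replaced by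
  \<open>Ks\<close> and \<open>T - t\<close> by \<open>Ks\<^sup>2 \<epsilon> / M\<close>, is the argument of the profile in \<open>profile_Rt\<close>.\<close>

definition nu_lim :: real where "nu_lim = (M / Ks^2) powr (1/p - 1) / (Ks * cs powr (1/p))"

definition ansatz :: "real \<Rightarrow> real \<Rightarrow> real" where
  "ansatz t Z = 1 / (T - t) * profile (Z / (nu_lim * (T - t) powr (1/p - 1)))"

lemma nu_lim_pos: "0 < nu_lim" using M_pos Ks_pos cs_pos by (simp add: nu_lim_def)

text \<open>The two arguments of the profile differ by three factors: the ratio \<open>Rt/R\<close> of the model
  integral to the true one, \<open>K/Ks\<close>, and a power of the remaining time over its leading term.  By
  \<open>profile_ratio\<close> their distances from \<open>1\<close> enter as relative errors.\<close>

lemma profile_comparison: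
  obtains C where "0 < C"
    "\<And>e x. e \<in> I \<Longrightarrow> x \<in> {0..1} \<Longrightarrow>
      \<bar>profile (flow e x / (nu_lim * (T - clock e) powr (1/p - 1))) - eps e / Jt e x\<bar>
        \<le> C * (eps e powr \<delta> + (x powr p) powr \<delta>) * (eps e / Jt e x)"
proof -
  obtain CK where CK: "0 < CK" "\<And>e. e \<in> I \<Longrightarrow> \<bar>K e - Ks\<bar> \<le> CK * eps e powr \<delta>" using K_asymp by blast
  obtain CT where CT: "0 < CT" "\<And>e. e \<in> I \<Longrightarrow> \<bar>(T - clock e) - Ks^2 * eps e / M\<bar> \<le> CT * eps e powr (1 + \<delta>)"
    using time_asymp by blast
  define b where "b = p / (1 - p)"
  have b: "0 < b" "(1/p - 1) * b = 1" using p0 p1 by (auto simp: b_def field_simps)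
  define N where "N = max 1 (L * Khi / Ks)"
  define C0 where "C0 = max 1 b * N powr (max 1 b - 1)"
  define thmax where "thmax = Khi^2 / Ks^2"
  define C\<rho> where "C\<rho> = (D * L * Khi + CK) / Ks"
  define C where "C = C0 * C\<rho> * thmax + CT * M / Ks^2"
  have N: "1 \<le> N" by (simp add: N_def)
  have C0: "0 < C0" using N by (simp add: C0_def)
  have th: "0 < thmax" using Khi_pos Ks_pos by (simp add: thmax_def)
  have Cr: "0 < C\<rho>" using D_pos L_ge Khi_pos CK Ks_pos by (simp add: C\<rho>_def add_pos_pos)
  have C: "0 < C" using C0 Cr th CT M_pos Ks_pos by (simp add: C_def add_pos_pos)
  have "\<bar>profile (flow e x / (nu_lim * (T - clock e) powr (1/p - 1))) - eps e / Jt e x\<bar>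
        \<le> C * (eps e powr \<delta> + (x powr p) powr \<delta>) * (eps e / Jt e x)"
    if e: "e \<in> I" and x: "x \<in> {0..1}" for e x
  proof (cases "x = 0")
    case True
    then show ?thesis using eps_pos[OF e] C by (simp add: Jt_def profile_0 p0)
  next
    case False
    then have x0: "x \<in> {0<..1}" using x by auto
    note ep = eps_pos[OF e] and Kp = K_pos[OF e] and Rp = R_pos[OF e x0] and Jt = Jt_lower[OF e x]
    define tau where "tau = T - clock e"
    define tau' where "tau' = Ks^2 * eps e / M"
    define h where "h = eps e powr \<delta> + (x powr p) powr \<delta>"
    have h: "0 < h" using ep by (simp add: h_def add_pos_nonneg)
    have tp: "0 < tau" unfolding tau_def T_def
      using strict_mono_onD[OF clock_strict_mono, of e "1/M"] e M_pos by (auto simp: I_def)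
    have tp': "0 < tau'" using Ks_pos ep M_pos by (simp add: tau'_def)
    have Rtp: "0 < Rt e x"
      using strict_mono_onD[OF R_strict_mono[OF e], of 0 x]
    proof -
      have "R e x \<le> Rt e x * (1 + D * (eps e + (x powr p) powr \<delta>))"
        using R_Rt[OF e x] by (simp add: algebra_simps)
      then have "0 < Rt e x * (1 + D * (eps e + (x powr p) powr \<delta>))" using Rp by linarith
      moreover have "0 < 1 + D * (eps e + (x powr p) powr \<delta>)"
        using D_pos ep by (intro add_pos_nonneg mult_nonneg_nonneg) auto
      ultimately show ?thesis by (rule zero_less_mult_pos2)
    qed
    \<comment> \<open>The arguments of the profile for the model and for the claimed limit.\<close>
    define x1 where "x1 = cs powr (1/p) * eps e powr (1 - 1/p) * Rt e x"
    define x2 where "x2 = flow e x / (nu_lim * tau powr (1/p - 1))"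
    define \<rho> where "\<rho> = (Rt e x / R e x) * (K e / Ks)"
    have pos: "0 < x1" "0 < x2" "0 < \<rho>"
      using cs_pos ep Rtp Rp Kp nu_lim_pos tp Ks_pos by (auto simp: x1_def x2_def \<rho>_def flow_def)
    have ratio: "x1 / x2 = \<rho> * (tau / tau') powr (1/p - 1)"
    proof -
      have "tau' powr (1/p - 1) = eps e powr (1/p - 1) / (M / Ks^2) powr (1/p - 1)"
        by (simp add: tau'_def powr_mult powr_divide)
      moreover have "eps e powr (1 - 1/p) = 1 / eps e powr (1/p - 1)"
        using powr_minus_divide[of "eps e" "1/p - 1"] by simp
      ultimately show ?thesis
        using cs_pos ep M_pos Ks_pos Rp Kp tp
        unfolding x1_def x2_def \<rho>_def flow_def nu_lim_def powr_divide[of tau tau'] by (simp add: mult_ac)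
    qed
    have exp: "(x1 / x2) powr b = \<rho> powr b * (tau / tau')"
      unfolding ratio powr_mult powr_powr b(2) using tp tp' by simp
    have \<rho>_le: "\<rho> \<le> N"
    proof -
      have "Rt e x / R e x \<le> L" using Rt_le_R[OF e x] Rp by (simp add: field_simps)
      moreover have "K e / Ks \<le> Khi / Ks" using K_le[OF I_closed[OF e]] Ks_pos by (simp add: divide_right_mono)
      ultimately have "\<rho> \<le> L * (Khi / Ks)"
        unfolding \<rho>_def using Kp Ks_pos L_ge by (intro mult_mono) auto
      then show ?thesis by (simp add: N_def)
    qed
    have \<rho>1: "\<bar>\<rho> - 1\<bar> \<le> C\<rho> * h"
    proof -
      have e1: "eps e \<le> eps e powr \<delta>"
        using powr_mono'[of \<delta> 1 "eps e"] ep eps_bounds[OF I_closed[OF e]] d1 by simp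
      have "\<bar>Rt e x / R e x - 1\<bar> = \<bar>R e x - Rt e x\<bar> / R e x" using Rp by (simp add: field_simps abs_divide abs_minus_commute)
      also have "\<dots> \<le> (D * (eps e + (x powr p) powr \<delta>) * Rt e x) / R e x"
        using R_Rt[OF e x] Rp by (intro divide_right_mono) auto
      also have "\<dots> \<le> (D * h * (L * R e x)) / R e x"
        using Rt_le_R[OF e x] Rp Rtp D_pos ep e1 h
        by (intro divide_right_mono mult_mono) (auto simp: h_def)
      also have "\<dots> = D * L * h" using Rp by simp
      finally have 1: "\<bar>Rt e x / R e x - 1\<bar> \<le> D * L * h" .
      have "\<rho> - 1 = (Rt e x / R e x - 1) * (K e / Ks) + (K e - Ks) / Ks"
        using Ks_pos by (simp add: \<rho>_def field_simps)
      also have "\<bar>\<dots>\<bar> \<le> \<bar>Rt e x / R e x - 1\<bar> * (K e / Ks) + \<bar>K e - Ks\<bar> / Ks"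
        using Kp Ks_pos abs_triangle_ineq[of "(Rt e x / R e x - 1) * (K e / Ks)" "(K e - Ks) / Ks"]
        by (simp add: abs_mult)
      also have "\<dots> \<le> (D * L * h) * (Khi / Ks) + (CK * h) / Ks"
      proof (intro add_mono mult_mono divide_right_mono 1)
        have "CK * eps e powr \<delta> \<le> CK * h" using CK(1) by (simp add: h_def)
        then show "\<bar>K e - Ks\<bar> \<le> CK * h" using CK(2)[OF e] by linarith
      qed (use K_le[OF I_closed[OF e]] Ks_pos Kp D_pos L_ge h in auto)
      also have "\<dots> = C\<rho> * h" by (simp add: C\<rho>_def add_divide_distrib algebra_simps)
      finally show ?thesis .
    qed
    have \<theta>1: "\<bar>tau / tau' - 1\<bar> \<le> (CT * M / Ks^2) * h"
    proof -
      have "\<bar>tau / tau' - 1\<bar> = \<bar>tau - tau'\<bar> / tau'" using tp' by (simp add: field_simps abs_divide)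
      also have "\<dots> \<le> CT * eps e powr (1 + \<delta>) / tau'"
        using CT(2)[OF e] tp' by (intro divide_right_mono) (auto simp: tau_def tau'_def)
      also have "\<dots> = (CT * M / Ks^2) * eps e powr \<delta>"
        using ep by (simp add: tau'_def powr_add)
      also have "\<dots> \<le> (CT * M / Ks^2) * h"
        using CT(1) M_pos by (intro mult_left_mono) (auto simp: h_def)
      finally show ?thesis .
    qed
    have \<theta>_le: "tau / tau' \<le> thmax"
    proof -
      have "tau / tau' \<le> (Khi^2 * eps e / M) / tau'"
        using time_upper[OF e] tp' by (intro divide_right_mono) (auto simp: tau_def)
      also have "\<dots> = thmax" using ep M_pos by (simp add: tau'_def thmax_def)
      finally show ?thesis .
    qed
    have "\<bar>profile x2 / profile x1 - 1\<bar> \<le> \<bar>\<rho> powr b * (tau / tau') - 1\<bar>"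
      using profile_ratio[OF pos(1,2)] by (simp add: exp b_def[symmetric])
    also have "\<rho> powr b * (tau / tau') - 1 = (\<rho> powr b - 1) * (tau / tau') + (tau / tau' - 1)"
      by (simp add: algebra_simps)
    also have "\<bar>\<dots>\<bar> \<le> \<bar>\<rho> powr b - 1\<bar> * (tau / tau') + \<bar>tau / tau' - 1\<bar>"
      using abs_triangle_ineq[of "(\<rho> powr b - 1) * (tau / tau')" "tau / tau' - 1"] tp tp' by (simp add: abs_mult)
    also have "\<dots> \<le> (C0 * (C\<rho> * h)) * thmax + (CT * M / Ks^2) * h"
    proof (intro add_mono mult_mono \<theta>1 \<theta>_le)
      have "\<bar>\<rho> powr b - 1\<bar> \<le> C0 * \<bar>\<rho> - 1\<bar>"
        unfolding C0_def by (rule abs_powr_minus_one_le[OF pos(3) \<rho>_le N b(1)])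
      also have "\<dots> \<le> C0 * (C\<rho> * h)" using \<rho>1 C0 by (intro mult_left_mono) auto
      finally show "\<bar>\<rho> powr b - 1\<bar> \<le> C0 * (C\<rho> * h)" .
    qed (use C0 Cr h tp tp' in auto)
    also have "\<dots> = C * h" by (simp add: C_def algebra_simps)
    finally have "\<bar>profile x2 / profile x1 - 1\<bar> \<le> C * h" .
    then have "\<bar>profile x2 / profile x1 - 1\<bar> * profile x1 \<le> C * h * profile x1"
      using profile_pos[of x1] by (intro mult_right_mono) auto
    moreover have "\<bar>profile x2 / profile x1 - 1\<bar> * profile x1 = \<bar>profile x2 - profile x1\<bar>"
    proof -
      have "\<bar>profile x2 / profile x1 - 1\<bar> * \<bar>profile x1\<bar> = \<bar>profile x2 - profile x1\<bar>"
        unfolding abs_mult[symmetric] using profile_pos[of x1] by (simp add: left_diff_distrib)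
      then show ?thesis using profile_pos[of x1] by simp
    qed
    moreover have "profile x1 = eps e / Jt e x" unfolding x1_def by (rule profile_Rt[OF e x])
    ultimately show ?thesis by (simp add: x2_def tau_def h_def)
  qed
  then show ?thesis using that C by blast
qed

text \<open>The solution is transformed into the rescaled profile in five steps, each of which costs at most a
  multiple of \<open>\<epsilon> powr (\<delta>-1)\<close>.\<close>

lemma solution_asymp_eps:
  obtains C where "0 < C"
    "\<And>e x. e \<in> I \<Longrightarrow> x \<in> {0..1} \<Longrightarrow>
      \<bar>A e x - ansatz (clock e) (flow e x)\<bar>
        \<le> C * eps e powr (\<delta> - 1)"
proof -
  obtain CK where CK: "0 < CK" "\<And>e. e \<in> I \<Longrightarrow> \<bar>K e - Ks\<bar> \<le> CK * eps e powr \<delta>" using K_asymp by blast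
  obtain CG where CG: "0 < CG" "\<And>e. e \<in> I \<Longrightarrow> \<bar>G e\<bar> \<le> CG * eps e powr (\<delta> - 1)" using G_asymp by blast
  obtain CT where CT: "0 < CT" "\<And>e. e \<in> I \<Longrightarrow> \<bar>(T - clock e) - Ks^2 * eps e / M\<bar> \<le> CT * eps e powr (1 + \<delta>)"
    using time_asymp by blast
  obtain l where l: "0 < l" "\<And>e. e \<in> I \<Longrightarrow> l * eps e \<le> T - clock e" using time_lower by blast
  obtain CJ where CJ: "0 < CJ" "\<And>e x. e \<in> I \<Longrightarrow> x \<in> {0..1} \<Longrightarrow> \<bar>1 / J e x - 1 / Jt e x\<bar> \<le> CJ * eps e powr (\<delta> - 1)"
    using inv_J_Jt_absolute by blast
  obtain CP where CP: "0 < CP"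
    "\<And>e x. e \<in> I \<Longrightarrow> x \<in> {0..1} \<Longrightarrow>
      \<bar>profile (flow e x / (nu_lim * (T - clock e) powr (1/p - 1))) - eps e / Jt e x\<bar>
        \<le> CP * (eps e powr \<delta> + (x powr p) powr \<delta>) * (eps e / Jt e x)"
    using profile_comparison by blast
  obtain Klo where Klo: "0 < Klo" "\<And>e. e \<in> {0..1/M} \<Longrightarrow> Klo \<le> K e" using K_ge by blast
  define C1 where "C1 = ((c + B) / mu + CG / Klo) / Klo^2"
  define C2 where "C2 = M / Klo^2 * CJ"
  define C3 where "C3 = M * (2 * Khi * CK) / (Klo^2 * Ks^2)"
  define C4 where "C4 = CT / (l * (Ks^2 / M))"
  define C5 where "C5 = CP * (1 + cs powr (- \<delta>)) / l"
  have cB: "0 < c + B" using c_pos B_nonneg by simp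
  have Cpos: "0 < C1" "0 < C2" "0 < C3" "0 < C4" "0 < C5"
    using cB mu_pos CG Klo M_pos CJ Khi_pos CK Ks_pos CT l CP cs_pos
    by (simp_all add: C1_def C2_def C3_def C4_def C5_def add_pos_pos)
  have "\<bar>A e x - ansatz (clock e) (flow e x)\<bar>
        \<le> (C1 + C2 + C3 + C4 + C5) * eps e powr (\<delta> - 1)" if e: "e \<in> I" and x: "x \<in> {0..1}" for e x
  proof -
    note ep = eps_pos[OF e] and Kp = K_pos[OF e] and Jt = Jt_lower[OF e x] and J = J_pos[OF e x]
    note ec = I_closed[OF e]
    define w where "w = eps e powr (\<delta> - 1)"
    have w: "1 \<le> w" using eps_powr_ge_1[OF e] by (simp add: w_def)
    have ew: "eps e powr \<delta> = eps e * w"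
    proof -
      have "eps e * w = eps e powr 1 * eps e powr (\<delta> - 1)" using ep by (simp add: w_def)
      also have "\<dots> = eps e powr (1 + (\<delta> - 1))" by (simp only: powr_add)
      finally show ?thesis by simp
    qed
    define tau where "tau = T - clock e"
    define tau' where "tau' = Ks^2 * eps e / M"
    define P where "P = profile (flow e x / (nu_lim * tau powr (1/p - 1)))"
    have tl: "l * eps e \<le> tau" using l(2)[OF e] by (simp add: tau_def)
    have tp: "0 < tau" using tl l(1) ep by (meson less_le_trans mult_pos_pos)
    have tp': "0 < tau'" using Ks_pos ep M_pos by (simp add: tau'_def)
    have Ks: "Ks \<le> Khi" using K_le[of "1/M"] M_pos by (simp add: Ks_def)
    have K2: "Klo^2 \<le> (K e)^2" using Klo(1) Klo(2)[OF ec] by (intro power_mono) auto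
    have Klo2: "0 < Klo^2" using Klo(1) by simp
    \<comment> \<open>From the exact value to \<open>1/J\<close>, from \<open>J\<close> to \<open>Jt\<close>, from \<open>K\<close> to \<open>Ks\<close>, from \<open>tau'\<close> to the remaining time, and from the model position to the true one.\<close>
    let ?a1 = "A e x - M / (K e)^2 * (1 / J e x)"
    let ?a2 = "M / (K e)^2 * (1 / J e x - 1 / Jt e x)"
    let ?a3 = "(M / (K e)^2 - M / Ks^2) * (1 / Jt e x)"
    let ?a4 = "(1 / tau' - 1 / tau) * (eps e / Jt e x)"
    let ?a5 = "1 / tau * (eps e / Jt e x - P)"
    have tele: "A e x - 1 / tau * P = ?a1 + ?a2 + ?a3 + ?a4 + ?a5"
    proof -
      have "1 / tau' * (eps e / Jt e x) = M / Ks^2 * (1 / Jt e x)"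
        using ep M_pos Ks_pos by (simp add: tau'_def)
      moreover have "a - s2 * P' = (a - q * u) + q * (u - v) + (q - r) * v + (s1 - s2) * y + s2 * (y - P')"
        if "s1 * y = r * v" for a q u v r s1 s2 y P' :: real
        using that by (simp add: algebra_simps)
      ultimately show ?thesis by blast
    qed
    have a1: "\<bar>?a1\<bar> \<le> C1 * w"
    proof -
      have gJ: "\<bar>(M - g x) / J e x\<bar> \<le> (c + B) / mu"
      proof (cases "x = 0")
        case True
        then show ?thesis using g_0 c_pos B_nonneg mu_pos by simp
      next
        case False
        then have xp: "0 < x powr p" by simp
        have "(M - g x) / J e x \<le> ((c + B) * x powr p) / (mu * x powr p)"
          using gap_upper[OF x] J_ge_powr[OF ec x] xp mu_pos c_pos B_nonneg by (intro frac_le) auto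
        also have "\<dots> = (c + B) / mu" using xp by simp
        finally show ?thesis using gap_upper(1)[OF x] J by (simp add: abs_of_nonneg)
      qed
      have "?a1 = - ((M - g x) / J e x + G e / K e) / (K e)^2"
        by (simp add: A_def diff_divide_distrib add_divide_distrib)
      also have "\<bar>\<dots>\<bar> = \<bar>(M - g x) / J e x + G e / K e\<bar> / (K e)^2"
        by (simp only: abs_divide abs_minus_cancel abs_power2 abs_minus)
      also have "\<dots> \<le> ((c + B) / mu * w + CG * w / Klo) / Klo^2"
      proof (rule frac_le)
        have "\<bar>G e / K e\<bar> \<le> CG * w / Klo"
          using CG(2)[OF e] Klo(1) Klo(2)[OF ec] CG(1) w Kp unfolding abs_divide w_def[symmetric]
          by (intro frac_le) auto
        moreover have "(c + B) / mu * 1 \<le> (c + B) / mu * w"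
          using w c_pos B_nonneg mu_pos by (intro mult_left_mono) auto
        ultimately show "\<bar>(M - g x) / J e x + G e / K e\<bar> \<le> (c + B) / mu * w + CG * w / Klo"
          using gJ by linarith
      qed (use K2 Klo2 c_pos B_nonneg mu_pos w CG Klo in \<open>auto intro!: add_nonneg_nonneg\<close>)
      also have "\<dots> = C1 * w" by (simp add: C1_def algebra_simps add_divide_distrib)
      finally show ?thesis .
    qed
    have MK: "M / (K e)^2 \<le> M / Klo^2" using K2 Klo2 M_pos Kp by (intro divide_left_mono mult_pos_pos) auto
    have a2: "\<bar>?a2\<bar> \<le> C2 * w"
    proof -
      have "\<bar>?a2\<bar> = M / (K e)^2 * \<bar>1 / J e x - 1 / Jt e x\<bar>" using M_pos by (simp add: abs_mult)
      also have "\<dots> \<le> M / Klo^2 * (CJ * w)"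
        using MK CJ(2)[OF e x] M_pos unfolding w_def by (intro mult_mono) auto
      finally show ?thesis by (simp add: C2_def)
    qed
    have a3: "\<bar>?a3\<bar> \<le> C3 * w"
    proof -
      have "M / (K e)^2 - M / Ks^2 = M * ((Ks - K e) * (Ks + K e)) / ((K e)^2 * Ks^2)"
        using Kp Ks_pos by (simp add: field_simps power2_eq_square)
      also have "\<bar>\<dots>\<bar> = M * (\<bar>K e - Ks\<bar> * (Ks + K e)) / ((K e)^2 * Ks^2)"
        using M_pos Kp Ks_pos by (simp add: abs_mult abs_minus_commute)
      also have "\<dots> \<le> M * ((CK * (eps e * w)) * (2 * Khi)) / (Klo^2 * Ks^2)"
        using CK(2)[OF e] CK(1) M_pos Kp Ks_pos Ks K_le[OF ec] K2 Klo2 ep w Khi_pos unfolding ew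
        by (intro frac_le mult_mono mult_left_mono mult_pos_pos mult_nonneg_nonneg) auto
      finally have "\<bar>M / (K e)^2 - M / Ks^2\<bar> \<le> C3 * w * eps e" by (simp add: C3_def field_simps)
      then have "\<bar>?a3\<bar> \<le> C3 * w * eps e * (1 / Jt e x)"
        using Jt(3) unfolding abs_mult by (intro mult_mono) auto
      also have "\<dots> \<le> C3 * w * 1"
      proof -
        have "eps e * (1 / Jt e x) \<le> 1" using Jt by simp
        then show ?thesis unfolding mult.assoc using Cpos w by (intro mult_left_mono) auto
      qed
      finally show ?thesis by simp
    qed
    have eJ: "0 \<le> eps e / Jt e x" "eps e / Jt e x \<le> 1" using Jt ep by auto
    have a4: "\<bar>?a4\<bar> \<le> C4 * w"
    proof -
      have "\<bar>1 / tau' - 1 / tau\<bar> = \<bar>tau' - tau\<bar> * (1 / (tau' * tau))" by (rule inv_diff[OF tp' tp])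
      also have "\<dots> \<le> (CT * (eps e * (eps e * w))) * (1 / (tau' * (l * eps e)))"
      proof (intro mult_mono divide_left_mono mult_left_mono tl)
        show "\<bar>tau' - tau\<bar> \<le> CT * (eps e * (eps e * w))"
          using CT(2)[OF e] ep unfolding powr_add ew by (simp add: tau_def tau'_def abs_minus_commute)
      qed (use tp tp' l ep CT w in auto)
      also have "\<dots> = C4 * w" using ep l M_pos Ks_pos by (simp add: tau'_def C4_def field_simps)
      finally have "\<bar>1 / tau' - 1 / tau\<bar> \<le> C4 * w" .
      then have "\<bar>?a4\<bar> \<le> (C4 * w) * 1"
        unfolding abs_mult using eJ by (intro mult_mono) auto
      then show ?thesis by simp
    qed
    have a5: "\<bar>?a5\<bar> \<le> C5 * w"
    proof -
      have "\<bar>eps e / Jt e x - P\<bar> \<le> CP * (eps e powr \<delta> + (x powr p) powr \<delta>) * (eps e / Jt e x)"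
        using CP(2)[OF e x] by (simp add: P_def tau_def abs_minus_commute)
      also have "\<dots> = CP * eps e * (w * (eps e / Jt e x) + (x powr p) powr \<delta> * (1 / Jt e x))"
        by (simp add: ew algebra_simps)
      also have "\<dots> \<le> CP * eps e * (w * 1 + cs powr (- \<delta>) * w)"
        using CP(1) ep eJ w powr_delta_Jt[OF e x] unfolding w_def[symmetric]
        by (intro mult_left_mono add_mono) auto
      finally have "\<bar>?a5\<bar> \<le> 1 / (l * eps e) * (CP * eps e * (w * 1 + cs powr (- \<delta>) * w))"
        unfolding abs_mult using tp tl l(1) ep
        by (intro mult_mono) (auto simp: abs_of_pos intro!: divide_left_mono)
      also have "\<dots> = C5 * w" using ep l(1) by (simp add: C5_def field_simps)
      finally show ?thesis .
    qed
    have "\<bar>A e x - 1 / tau * P\<bar> \<le> C1 * w + C2 * w + C3 * w + C4 * w + C5 * w"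
      unfolding tele using a1 a2 a3 a4 a5 by linarith
    then show ?thesis by (simp add: ansatz_def tau_def P_def w_def algebra_simps)
  qed
  then show ?thesis using that[of "C1 + C2 + C3 + C4 + C5"] Cpos by force
qed

theorem solution_asymp:
  obtains C where "0 < C"
    "\<And>t Z. t \<in> {0..<T} \<Longrightarrow> Z \<in> {0..1} \<Longrightarrow>
      \<bar>sol (param t) Z - ansatz t Z\<bar>
        \<le> C * (T - t) powr (-1 + \<delta>)"
proof -
  obtain C where C: "0 < C"
    "\<And>e x. e \<in> I \<Longrightarrow> x \<in> {0..1} \<Longrightarrow>
      \<bar>A e x - ansatz (clock e) (flow e x)\<bar>
        \<le> C * eps e powr (\<delta> - 1)"
    using solution_asymp_eps by blast
  define q where "q = M / Khi^2"
  have q: "0 < q" using M_pos Khi_pos by (simp add: q_def)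
  have "\<bar>sol (param t) Z - ansatz t Z\<bar>
        \<le> (C * q powr (\<delta> - 1)) * (T - t) powr (-1 + \<delta>)" if t: "t \<in> {0..<T}" and Z: "Z \<in> {0..1}" for t Z
  proof -
    note e = param_in[OF t]
    have "q * (T - t) \<le> eps (param t)"
      using time_upper[OF e] clock_param[OF t] M_pos Khi_pos by (simp add: q_def field_simps)
    then have "eps (param t) powr (\<delta> - 1) \<le> (q * (T - t)) powr (\<delta> - 1)"
      using q t d1 by (intro powr_mono2') auto
    then have "C * eps (param t) powr (\<delta> - 1) \<le> C * (q * (T - t)) powr (\<delta> - 1)"
      using C(1) by (intro mult_left_mono) auto
    moreover have "\<bar>sol (param t) Z - ansatz t Z\<bar>
        \<le> C * eps (param t) powr (\<delta> - 1)"
      using C(2)[OF e X_in[OF e Z]] clock_param[OF t] flow_X[OF e Z] by (simp add: sol_def)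
    moreover have "C * (q * (T - t)) powr (\<delta> - 1) = (C * q powr (\<delta> - 1)) * (T - t) powr (-1 + \<delta>)"
      by (simp add: powr_mult)
    ultimately show ?thesis by linarith
  qed
  then show ?thesis using that[of "C * q powr (\<delta> - 1)"] C q by simp
qed

lemma sol_at_zero_unbounded: "filterlim (\<lambda>t. sol (param t) 0) at_top (at_left T)"
proof -
  obtain C where C: "0 < C"
    "\<And>t Z. t \<in> {0..<T} \<Longrightarrow> Z \<in> {0..1} \<Longrightarrow>
      \<bar>sol (param t) Z - ansatz t Z\<bar>
        \<le> C * (T - t) powr (-1 + \<delta>)"
    using solution_asymp by blast
  have "filterlim (\<lambda>s. 1 / s - C * s powr (-1 + \<delta>)) at_top (at_right (0::real))"
    using d0 C(1) by real_asymp
  moreover have "filterlim (\<lambda>t. T - t) (at_right 0) (at_left T)"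
    unfolding filterlim_at by (auto intro!: tendsto_eq_intros simp: eventually_at_filter)
  ultimately have "filterlim (\<lambda>t. 1 / (T - t) - C * (T - t) powr (-1 + \<delta>)) at_top (at_left T)"
    by (rule filterlim_compose)
  moreover have "\<forall>\<^sub>F t in at_left T. 1 / (T - t) - C * (T - t) powr (-1 + \<delta>) \<le> sol (param t) 0"
    using eventually_at_left_real[OF T_pos]
  proof eventually_elim
    case (elim t)
    then show ?case using C(2)[of t 0] by (simp add: ansatz_def profile_0 abs_le_iff)
  qed
  ultimately show ?thesis by (rule filterlim_at_top_mono)
qed

lemma param_solution_on: "solution_on T g (\<lambda>t. sol (param t))"
  unfolding solution_on_iff using solution by blast

text \<open>Another solution agrees with the explicit one as long as both exist.  It cannot exist beyond \<open>T\<close>,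
  because it would then be bounded at \<open>Z = 0\<close> up to time \<open>T\<close>,
  where the explicit one tends to infinity.\<close>

theorem solution_maximal: "maximal_solution T g (\<lambda>t. sol (param t))"
  unfolding maximal_solution_def
proof (intro conjI allI impI param_solution_on)
  fix T' b assume "0 < T' \<and> solution_on T' g b"
  then obtain b_t b_Z where T': "0 < T'" and b: "solution_with T' g b b_t b_Z"
    unfolding solution_on_iff by blast
  have eq: "sol (param t) Z = b t Z" if t: "0 \<le> t" "t < T" "t < T'" and Z: "Z \<in> {0..1}" for t Z
  proof -
    have "t \<in> {0..<T}" using t by auto
    from sol_Z_bound[OF this] obtain C where C: "0 \<le> C"
      "\<And>s Z. s \<in> {0..t} \<Longrightarrow> Z \<in> {0<..1} \<Longrightarrow> \<bar>sol_Z (param s) Z\<bar> \<le> C * Z powr (p - 1)" by blast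
    show ?thesis by (rule solution_unique[OF solution b t p0 C(2) C(1) Z])
  qed
  show le: "T' \<le> T"
  proof (rule ccontr)
    assume "\<not> T' \<le> T"
    then have "T < T'" by simp
    have cb: "continuous_on ({0..<T'} \<times> {0..1}) (\<lambda>x. b (fst x) (snd x))"
      using b by (simp add: solution_with_def split_beta)
    have "continuous_on {0..T} (\<lambda>t. b t 0)"
      by (rule continuous_on_compose2[OF cb, where f = "\<lambda>t. (t, 0)", unfolded fst_conv snd_conv])
        (use \<open>T < T'\<close> in \<open>auto intro!: continuous_intros\<close>)
    then obtain Bd where Bd: "\<And>t. t \<in> {0..T} \<Longrightarrow> \<bar>b t 0\<bar> \<le> Bd"
      using continuous_on_compact_bound[OF compact_Icc] by blast
    have "\<forall>\<^sub>F t in at_left T. Bd < sol (param t) 0"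
      using sol_at_zero_unbounded by (simp add: filterlim_at_top_dense)
    then have "\<forall>\<^sub>F t in at_left T. False"
      using eventually_at_left_real[OF T_pos]
    proof eventually_elim
      case (elim t)
      then show False using eq[of t 0] Bd[of t] \<open>T < T'\<close> by auto
    qed
    then show False by (simp add: trivial_limit_at_left_real)
  qed
  show "\<forall>t\<in>{0..<T'}. \<forall>Z\<in>{0..1}. b t Z = sol (param t) Z"
    using eq le by auto
qed

end

lemma continuous_imp_measurable_01:
  "continuous_on {0..1} f \<Longrightarrow> f \<in> borel_measurable (lebesgue_on {0..1::real})" for f :: "real \<Rightarrow> real"
  by (rule continuous_imp_measurable_on_sets_lebesgue) auto

lemma Linf_norm_le:
  assumes "continuous_on {0..1} f" "\<And>z. z \<in> {0..1} \<Longrightarrow> \<bar>f z\<bar> \<le> c"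
  shows "Linf_norm f \<le> ereal c"
  unfolding Linf_norm_def
proof (rule esssup_I)
  show "(\<lambda>z. ereal \<bar>f z\<bar>) \<in> borel_measurable (lebesgue_on {0..1})"
    using continuous_imp_measurable_01[OF assms(1)] by measurable
  show "AE x in lebesgue_on {0..1}. ereal \<bar>f x\<bar> \<le> ereal c"
    by (rule AE_I2) (use assms(2) in auto)
qed

text \<open>By continuity a value below \<open>|f 0|\<close> is exceeded on some interval \<open>(0, r)\<close>, which has positive
  measure.\<close>

lemma Linf_norm_ge:
  assumes f: "continuous_on {0..1} f" shows "ereal \<bar>f 0\<bar> \<le> Linf_norm f"
proof (rule ccontr)
  assume "\<not> ereal \<bar>f 0\<bar> \<le> Linf_norm f"
  then obtain y where y: "Linf_norm f < ereal y" "y < \<bar>f 0\<bar>"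
    by (metis not_le less_ereal.simps(1) ereal_dense2)
  have "continuous_on {0..1} (\<lambda>z. \<bar>f z\<bar>)" by (intro continuous_intros f)
  then have "((\<lambda>z. \<bar>f z\<bar>) \<longlongrightarrow> \<bar>f 0\<bar>) (at 0 within {0..1})"
    by (simp add: continuous_on_def)
  then have "\<forall>\<^sub>F z in at 0 within {0..1}. y < \<bar>f z\<bar>" using y(2) by (rule order_tendstoD)
  then obtain d where d: "0 < d" "\<And>z. z \<in> {0..1} \<Longrightarrow> z \<noteq> 0 \<Longrightarrow> dist z 0 < d \<Longrightarrow> y < \<bar>f z\<bar>"
    unfolding eventually_at by blast
  define r where "r = min d 1"
  have r: "0 < r" "r \<le> d" "r \<le> 1" using d(1) by (auto simp: r_def)
  have "AE z in lebesgue_on {0..1}. ereal \<bar>f z\<bar> \<le> Linf_norm f"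
    unfolding Linf_norm_def by (rule esssup_AE)
  then have "AE z in lebesgue. z \<in> {0..1} \<longrightarrow> ereal \<bar>f z\<bar> \<le> Linf_norm f"
    by (simp add: AE_restrict_space_iff)
  then have "AE z in lebesgue. z \<notin> {0<..<r}"
  proof (rule AE_mp, intro AE_I2 impI notI)
    fix z assume z: "z \<in> {0..1} \<longrightarrow> ereal \<bar>f z\<bar> \<le> Linf_norm f" "z \<in> {0<..<r}"
    then have "z \<in> {0..1}" "y < \<bar>f z\<bar>" using r d(2)[of z] by auto
    then have "ereal \<bar>f z\<bar> < ereal y" using z(1) by (intro le_less_trans[OF _ y(1)]) simp
    then show False using \<open>y < \<bar>f z\<bar>\<close> by simp
  qed
  then have "{0<..<r} \<in> null_sets lebesgue"
    by (subst (asm) AE_iff_null_sets[symmetric]) auto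
  then have "emeasure lebesgue {0<..<r} = 0" by auto
  then show False using r by simp
qed

lemma blows_up:
  assumes "cusp_datum g g' M p c m B \<delta>"
  obtains T nu C a where "T > 0" "nu > 0" "C > 0" "blows_up_at T g a"
    "\<And>t. t \<in> {0..<T} \<Longrightarrow> Linf_norm (\<lambda>Z. a t Z - 1 / (T - t) *
        profile_exponent.profile p (Z / (nu * (T - t) powr (1/p - 1)))) \<le> ereal (C * (T - t) powr (-1 + \<delta>))"
proof -
  interpret cusp_datum g g' M p c m B \<delta> by fact
  obtain C where C: "0 < C"
    "\<And>t Z. t \<in> {0..<T} \<Longrightarrow> Z \<in> {0..1} \<Longrightarrow>
      \<bar>sol (param t) Z - 1 / (T - t) * profile (Z / (nu_lim * (T - t) powr (1/p - 1)))\<bar>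
        \<le> C * (T - t) powr (-1 + \<delta>)"
    using solution_asymp[unfolded ansatz_def] by blast
  have blow: "((\<lambda>t. Linf_norm (sol (param t))) \<longlongrightarrow> \<infinity>) (at_left T)"
  proof (rule tendsto_sandwich[where h = "\<lambda>_. \<infinity>"])
    show "((\<lambda>t. ereal (sol (param t) 0)) \<longlongrightarrow> \<infinity>) (at_left T)"
      unfolding tendsto_PInfty_eq_at_top using sol_at_zero_unbounded .
    show "\<forall>\<^sub>F t in at_left T. ereal (sol (param t) 0) \<le> Linf_norm (sol (param t))"
      using eventually_at_left_real[OF T_pos]
    proof eventually_elim
      case (elim t)
      then have "param t \<in> I" by (intro param_in) auto
      from Linf_norm_ge[OF sol_cont[OF this]] show ?case
        by (rule order_trans[rotated]) simp
    qed
  qed auto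
  have "continuous_on {0..1} (\<lambda>Z. sol (param t) Z - 1 / (T - t) * profile (Z / (nu_lim * (T - t) powr (1/p - 1))))"
    if t: "t \<in> {0..<T}" for t
  proof -
    have "0 < nu_lim * (T - t) powr (1/p - 1)" using nu_lim_pos t by simp
    then have "continuous_on {0..1} (\<lambda>Z. profile (Z / (nu_lim * (T - t) powr (1/p - 1))))"
      by (intro continuous_on_compose2[OF profile_continuous]) (auto intro!: continuous_intros)
    then show ?thesis by (intro continuous_intros sol_cont param_in t)
  qed
  then show ?thesis
    using that[of T nu_lim C "\<lambda>t. sol (param t)"] T_pos nu_lim_pos C solution_maximal blow
      Linf_norm_le by (force simp: blows_up_at_def)
qed

section \<open>Perturbed profiles as data\<close>

lemma C1_norm_bounds:
  assumes f: "C1_space f" and le: "C1_norm f \<le> k"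
  shows "continuous_on {0..1} f"
    and "\<And>z. z \<in> {0..1} \<Longrightarrow> (f has_real_derivative vector_derivative f (at z within {0..1})) (at z within {0..1})"
    and "\<And>z. z \<in> {0..1} \<Longrightarrow> \<bar>vector_derivative f (at z within {0..1})\<bar> \<le> k"
    and "\<And>z. z \<in> {0..1} \<Longrightarrow> \<bar>f z - f 0\<bar> \<le> k * z"
proof -
  let ?d = "\<lambda>z. vector_derivative f (at z within {0..1})"
  have diff: "f differentiable_on {0..1}" and cd: "continuous_on {0..1} ?d"
    using f by (auto simp: C1_space_def)
  show c: "continuous_on {0..1} f" by (rule differentiable_imp_continuous_on[OF diff])
  show der: "(f has_real_derivative ?d z) (at z within {0..1})" if "z \<in> {0..1}" for z
    using diff that
    by (simp add: differentiable_on_def vector_derivative_works[symmetric] has_real_derivative_iff_has_vector_derivative)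
  have bdd: "bdd_above ((\<lambda>z. \<bar>h z\<bar>) ` {0..1})" if h: "continuous_on {0..1} h" for h :: "real \<Rightarrow> real"
  proof -
    obtain b where "\<And>x. x \<in> {0..1} \<Longrightarrow> \<bar>h x\<bar> \<le> b"
      using continuous_on_compact_bound[OF compact_Icc h] by blast
    then show ?thesis by (intro bdd_aboveI[of _ b]) auto
  qed
  show b: "\<bar>?d z\<bar> \<le> k" if z: "z \<in> {0..1}" for z
  proof -
    have "\<bar>?d z\<bar> \<le> (SUP z\<in>{0..1}. \<bar>?d z\<bar>)" by (rule cSUP_upper[OF z bdd[OF cd]])
    moreover have "\<bar>f z\<bar> \<le> (SUP z\<in>{0..1}. \<bar>f z\<bar>)" by (rule cSUP_upper[OF z bdd[OF c]])
    ultimately show ?thesis using le abs_ge_zero[of "f z"] unfolding C1_norm_def by linarith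
  qed
  show "\<bar>f z - f 0\<bar> \<le> k * z" if z: "z \<in> {0..1}" for z
    using field_differentiable_bound[of "{0..1}" f ?d k z 0] der b z by auto
qed

text \<open>The gap of the profile alone is at least \<open>2 k x\<^sup>p\<close>, uniformly in the width \<open>\<nu> \<le> N\<close>.  A
  perturbation of size \<open>k\<close> in \<open>C\<^sup>1\<close> changes it by at most \<open>k x \<le> k x\<^sup>p\<close>, so half of it survives.
  Together with the vanishing mean the gap also forces the maximum to be positive.\<close>

lemma perturbed_profile_cusp_datum:
  assumes p: "profile_exponent p" and d: "0 < \<delta>" "\<delta> < 1" "p * (1 + \<delta>) < 1"
    and lam: "0 < lam" and nu: "0 < \<nu>" "\<nu> \<le> N"
    and k: "k = 1 / (2 * lam * (1 + N powr p))"
    and a0: "\<And>Z. Z \<in> {0..1} \<Longrightarrow> a0 Z = 1 / lam * profile_exponent.profile p (Z / \<nu>) + f Z"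
    and f: "C1_space f" "C1_norm f \<le> k" and mean: "integral {0..1} a0 = 0"
  obtains g' M c m B where "cusp_datum a0 g' M p c m B \<delta>"
proof -
  interpret profile_exponent p by fact
  note fb = C1_norm_bounds[OF f]
  let ?d = "\<lambda>z. vector_derivative f (at z within {0..1})"
  have N: "0 < N" using nu by simp
  have kpos: "0 < k" using lam unfolding k by simp
  define M where "M = a0 0"
  define g' where "g' x = 1 / lam * (profile' (x / \<nu>) * (1 / \<nu>)) + ?d x" for x
  define c where "c = 1 / (lam * \<nu> powr p)"
  define B where "B = 1 / (lam * \<nu> powr (2 * p)) + 1 / (lam * \<nu> powr p) + k"
  have B: "1 / (lam * \<nu> powr (2 * p)) + k \<le> B" "1 / (lam * \<nu> powr p) + k \<le> B" "0 \<le> B"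
    using lam nu kpos by (auto simp: B_def)
  have M: "M = 1 / lam + f 0" using a0[of 0] by (simp add: M_def profile_0)
  have diff: "M - a0 x = 1 / lam * (1 - profile (x / \<nu>)) - (f x - f 0)" if "x \<in> {0..1}" for x
    using a0[OF that] unfolding M by (simp add: right_diff_distrib)
  have x_le: "x \<le> x powr q" if "x \<in> {0..1}" "0 < q" "q \<le> 1" for x q :: real
    using powr_mono'[of q 1 x] that by auto
  have gap: "k * x powr p \<le> M - a0 x" if x: "x \<in> {0..1}" for x
  proof -
    define w where "w = x powr p"
    define v where "v = \<nu> powr p"
    have w: "0 \<le> w" "w \<le> 1" using x p0 by (auto simp: w_def powr_le1)
    have v: "0 < v" "v \<le> N powr p" using nu p0 by (auto simp: v_def intro!: powr_mono2)
    have "2 * k * w = 1 / lam * (w / (1 + N powr p))" 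
    proof -
      have "2 * (1 / (2 * lam * n)) * w = 1 / lam * (w / n)" for n :: real by simp
      then show ?thesis unfolding k .
    qed
    also have "\<dots> \<le> 1 / lam * (w / (v + w))"
    proof (intro mult_left_mono)
      show "w / (1 + N powr p) \<le> w / (v + w)"
        using w v by (intro divide_left_mono) (auto intro!: mult_pos_pos add_pos_nonneg)
    qed (use lam in auto)
    also have "w / (v + w) = (x / \<nu>) powr p / (1 + (x / \<nu>) powr p)"
      using v w by (simp add: powr_divide w_def[symmetric] v_def[symmetric] field_simps)
    also have "1 / lam * \<dots> \<le> 1 / lam * (1 - profile (x / \<nu>))"
      using lam x nu by (intro mult_left_mono one_minus_profile_ge) auto
    finally have "2 * k * w \<le> 1 / lam * (1 - profile (x / \<nu>))" .
    moreover have "f x - f 0 \<le> k * w"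
    proof -
      have "k * x \<le> k * w" using x_le[OF x p0] p1 kpos by (intro mult_left_mono) (auto simp: w_def)
      then show ?thesis using fb(4)[OF x] by (simp add: abs_le_iff)
    qed
    ultimately show ?thesis unfolding diff[OF x] w_def by linarith
  qed
  have "continuous_on {0..1} (\<lambda>x. profile (x / \<nu>))"
    by (rule continuous_on_compose2[OF profile_continuous]) (use nu in \<open>auto intro!: continuous_intros\<close>)
  then have "continuous_on {0..1} (\<lambda>x. 1 / lam * profile (x / \<nu>) + f x)"
    by (intro continuous_intros fb(1))
  then have cont: "continuous_on {0..1} a0" by (rule continuous_on_eq) (simp add: a0)
  have "cusp_datum a0 g' M p c k B \<delta>"
  proof unfold_locales
    show "continuous_on {0..1} a0" by (rule cont)
    show "(a0 has_real_derivative g' x) (at x within {0..1})" if x: "x \<in> {0<..1}" for x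
    proof (rule has_field_derivative_transform_within[OF _ zero_less_one])
      have dx: "((\<lambda>x. x / \<nu>) has_real_derivative 1 / \<nu>) (at x within {0..1})"
        by (rule DERIV_cdivide[OF DERIV_ident])
      have "((\<lambda>x. profile (x / \<nu>)) has_real_derivative profile' (x / \<nu>) * (1 / \<nu>)) (at x within {0..1})"
        by (rule DERIV_chain2[OF profile_has_derivative dx]) (use x nu in simp)
      then show "((\<lambda>x. 1 / lam * profile (x / \<nu>) + f x) has_real_derivative g' x) (at x within {0..1})"
        unfolding g'_def by (intro DERIV_add DERIV_cmult fb(2)) (use x in auto)
    qed (use x a0 in auto)
    show "continuous_on {0<..1} g'"
      unfolding g'_def
    proof (intro continuous_intros)
      show "continuous_on {0<..1} (\<lambda>x. profile' (x / \<nu>))"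
        by (rule continuous_on_compose2[OF profile'_continuous]) (use nu in \<open>auto intro!: continuous_intros\<close>)
      show "continuous_on {0<..1} ?d"
        using f(1) unfolding C1_space_def by (auto elim: continuous_on_subset)
    qed
    show "a0 x \<le> M" if x: "x \<in> {0..1}" for x
    proof -
      have "0 \<le> k * x powr p" using kpos by simp
      with gap[OF x] show ?thesis by linarith
    qed
    show "0 < M"
    proof -
      have h: "((\<lambda>x. M - k * x powr p) has_integral (M - k * (1 / (p + 1)))) {0..1}"
        using has_integral_diff[OF has_integral_const_real[of M 0 1]
          has_integral_mult_right[OF has_integral_powr_from_0[of p 1], of k]] p0 by simp
      have "0 \<le> M - k * (1 / (p + 1))"
        using has_integral_le[OF integrable_integral[OF integrable_continuous_real[OF cont]] h] gap mean
        by (auto simp: algebra_simps)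
      moreover have "0 < k * (1 / (p + 1))" using kpos p0 by simp
      ultimately show ?thesis by linarith
    qed
    show "\<bar>M - a0 x - c * x powr p\<bar> \<le> B * x powr (p * (1 + \<delta>))" if x: "x \<in> {0..1}" for x
    proof -
      let ?y = "x powr (p * (1 + \<delta>))"
      have y: "x powr (2 * p) \<le> ?y" using x p0 d by (intro powr_mono') auto
      have "c * x powr p = 1 / lam * (x / \<nu>) powr p" by (simp add: c_def powr_divide)
      then have "M - a0 x - c * x powr p
          = 1 / lam * ((1 - profile (x / \<nu>)) - (x / \<nu>) powr p) - (f x - f 0)"
        unfolding diff[OF x] by (simp add: right_diff_distrib)
      also have "\<bar>\<dots>\<bar> \<le> \<bar>1 / lam * ((1 - profile (x / \<nu>)) - (x / \<nu>) powr p)\<bar> + \<bar>f x - f 0\<bar>"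
        by (rule abs_triangle_ineq4)
      also have "\<dots> \<le> 1 / lam * ((x / \<nu>) powr (2 * p)) + k * ?y"
      proof (rule add_mono)
        show "\<bar>1 / lam * ((1 - profile (x / \<nu>)) - (x / \<nu>) powr p)\<bar> \<le> 1 / lam * ((x / \<nu>) powr (2 * p))"
          using profile_cusp[of "x / \<nu>"] x nu lam unfolding abs_mult by (intro mult_mono) auto
        have "k * x \<le> k * ?y" using x_le[OF x, of "p * (1 + \<delta>)"] p0 d kpos by (intro mult_left_mono) auto
        then show "\<bar>f x - f 0\<bar> \<le> k * ?y" using fb(4)[OF x] by linarith
      qed
      also have "1 / lam * ((x / \<nu>) powr (2 * p)) = 1 / (lam * \<nu> powr (2 * p)) * x powr (2 * p)"
        by (simp add: powr_divide)
      also have "\<dots> + k * ?y \<le> 1 / (lam * \<nu> powr (2 * p)) * ?y + k * ?y"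
        using y lam by (intro add_right_mono mult_left_mono) auto
      also have "\<dots> = (1 / (lam * \<nu> powr (2 * p)) + k) * ?y" by (simp add: algebra_simps)
      also have "\<dots> \<le> B * ?y" using B by (intro mult_right_mono) auto
      finally show ?thesis .
    qed
    show "\<bar>g' x\<bar> \<le> B * x powr (p - 1)" if x: "x \<in> {0<..1}" for x
    proof -
      let ?y = "x powr (p - 1)"
      have y: "1 \<le> ?y" using powr_mono'[of "p - 1" 0 x] x p1 by auto
      have "\<bar>1 / lam * (profile' (x / \<nu>) * (1 / \<nu>))\<bar> \<le> 1 / lam * ((x / \<nu>) powr (p - 1) * (1 / \<nu>))"
        using profile'_bound[of "x / \<nu>"] x nu lam unfolding abs_mult
        by (intro mult_mono) auto
      also have "\<dots> = 1 / (lam * \<nu> powr p) * ?y"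
        using nu by (simp add: powr_divide powr_diff)
      finally have "\<bar>g' x\<bar> \<le> 1 / (lam * \<nu> powr p) * ?y + \<bar>?d x\<bar>"
        unfolding g'_def by linarith
      also have "\<dots> \<le> 1 / (lam * \<nu> powr p) * ?y + k * ?y"
      proof -
        have "k * 1 \<le> k * ?y" using y kpos by (intro mult_left_mono) auto
        then show ?thesis using fb(3)[of x] x by auto
      qed
      also have "\<dots> = (1 / (lam * \<nu> powr p) + k) * ?y" by (simp add: algebra_simps)
      also have "\<dots> \<le> B * ?y" using B by (intro mult_right_mono) auto
      finally show ?thesis .
    qed
    show "0 < c" using lam nu by (simp add: c_def)
  qed (use mean B kpos d gap M_def in auto)
  then show ?thesis by (rule that)
qed

theorem theorem1p3:
  fixes \<beta> :: real
  assumes "\<beta> > 0"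
  shows "\<exists>(\<phi> :: real \<Rightarrow> real) (\<delta> :: real).
    holder_space (1 / (\<beta> + 1)) {0..} \<phi> \<and> \<not> smooth_within {0..} \<phi> \<and>
    (\<forall>x\<ge>0. \<phi> x > 0) \<and> \<phi> 0 = 1 \<and> strict_antimono_on {0..} \<phi> \<and> \<delta> > 0 \<and>
    (\<forall>nu_star > (0::real). \<exists>lam_star > (0::real). \<forall>lam\<^sub>0. 0 < lam\<^sub>0 \<and> lam\<^sub>0 \<le> lam_star \<longrightarrow>
      (\<exists>\<kappa> > (0::real). \<forall>(\<nu>\<^sub>0 :: real) (pert\<^sub>0 :: real \<Rightarrow> real) (a\<^sub>0 :: real \<Rightarrow> real).
        (\<forall>Z\<in>{0..1}. a\<^sub>0 Z = 1 / lam\<^sub>0 * \<phi> (Z / \<nu>\<^sub>0) + pert\<^sub>0 Z) \<and>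
        0 < \<nu>\<^sub>0 / lam\<^sub>0 powr \<beta> \<and> \<nu>\<^sub>0 / lam\<^sub>0 powr \<beta> \<le> nu_star \<and>
        C1_space pert\<^sub>0 \<and> C1_norm pert\<^sub>0 \<le> \<kappa> \<and>
        integral {0..1} a\<^sub>0 = 0
        \<longrightarrow>
        (\<exists>(T :: real) (nu_inf :: real) (C :: real) (a :: real \<Rightarrow> real \<Rightarrow> real)
            (pert :: real \<Rightarrow> real \<Rightarrow> real).
          T > 0 \<and> nu_inf > 0 \<and> C > 0 \<and>
          blows_up_at T a\<^sub>0 a \<and>
          (\<forall>t\<in>{0..<T}. \<forall>Z\<in>{0..1}.
             a t Z = 1 / (T - t) * \<phi> (Z / (nu_inf * (T - t) powr \<beta>)) + pert t Z) \<and>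
          (\<forall>t\<in>{0..<T}. Linf_norm (pert t) \<le> ereal (C * (T - t) powr (-1 + \<delta>))))))"
proof -
  define p where "p = 1 / (\<beta> + 1)"
  \<comment> \<open>Taking half of \<open>\<beta>\<close> makes \<open>p (1 + \<delta>) < 1\<close>; \<open>\<delta> < 1\<close> is needed for the interpolation.\<close>
  define \<delta> where "\<delta> = min \<beta> 1 / 2"
  have p: "0 < p" "p < 1" "1 / p - 1 = \<beta>" using assms by (auto simp: p_def field_simps)
  interpret profile_exponent p by unfold_locales (use p in auto)
  have d: "0 < \<delta>" "\<delta> < 1" "p * (1 + \<delta>) < 1"
  proof -
    show "0 < \<delta>" "\<delta> < 1" using assms by (auto simp: \<delta>_def)
    have "\<delta> < \<beta>" using assms by (auto simp: \<delta>_def)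
    then show "p * (1 + \<delta>) < 1" using assms by (simp add: p_def field_simps)
  qed
  have main: "\<exists>T nu_inf C a pert. T > 0 \<and> nu_inf > 0 \<and> C > 0 \<and> blows_up_at T a0 a \<and>
        (\<forall>t\<in>{0..<T}. \<forall>Z\<in>{0..1}.
             a t Z = 1 / (T - t) * profile (Z / (nu_inf * (T - t) powr \<beta>)) + pert t Z) \<and>
        (\<forall>t\<in>{0..<T}. Linf_norm (pert t) \<le> ereal (C * (T - t) powr (-1 + \<delta>)))"
    if lam: "0 < lam"
      and h: "(\<forall>Z\<in>{0..1}. a0 Z = 1 / lam * profile (Z / \<nu>) + f Z) \<and>
        0 < \<nu> / lam powr \<beta> \<and> \<nu> / lam powr \<beta> \<le> nu_star \<and>
        C1_space f \<and> C1_norm f \<le> 1 / (2 * lam * (1 + (nu_star * lam powr \<beta>) powr p)) \<and>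
        integral {0..1} a0 = 0"
    for lam \<nu> nu_star :: real and f a0 :: "real \<Rightarrow> real"
  proof -
    have nu: "0 < \<nu>" "\<nu> \<le> nu_star * lam powr \<beta>"
      using h lam by (auto simp: zero_less_divide_iff pos_divide_le_eq)
    obtain g' M c m B where cd: "cusp_datum a0 g' M p c m B \<delta>"
      using perturbed_profile_cusp_datum[OF profile_exponent_axioms d lam nu refl, of a0 f] h by blast
    obtain T nu C a where r: "T > 0" "nu > 0" "C > 0" "blows_up_at T a0 a"
      "\<And>t. t \<in> {0..<T} \<Longrightarrow> Linf_norm (\<lambda>Z. a t Z - 1 / (T - t) *
          profile (Z / (nu * (T - t) powr (1/p - 1)))) \<le> ereal (C * (T - t) powr (-1 + \<delta>))"
      using blows_up[OF cd] by blast
    show ?thesis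
      by (rule exI[of _ T], rule exI[of _ nu], rule exI[of _ C], rule exI[of _ a],
          rule exI[of _ "\<lambda>t Z. a t Z - 1 / (T - t) * profile (Z / (nu * (T - t) powr \<beta>))"])
        (use r in \<open>simp add: p(3)\<close>)
  qed
  show ?thesis
  proof (rule exI[of _ profile], rule exI[of _ \<delta>], intro conjI allI impI, goal_cases)
    case 1
    show ?case using profile_holder by (simp add: p_def)
  next
    case (7 nu_star)
    show ?case
    proof (rule exI[of _ 1], intro conjI allI impI, goal_cases)
      case (2 lam)
      show ?case
        by (rule exI[of _ "1 / (2 * lam * (1 + (nu_star * lam powr \<beta>) powr p))"], intro conjI allI impI main)
          (use 2 in auto)
    qed simp
  qed (use profile_pos profile_0 profile_not_smooth profile_strict_antimono d in auto)
qed

end
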